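(* Robust-SP admits an FPTAS for fixed $\sigma$: for any $\epsilon>0$, one can compute a $(1+\epsilon)$-approximate solution in time $\mathcal{O}(n^3\sigma^2(\frac{n^2}{\epsilon})^{\sigma})$.
   Context: Robust-SP: input is an undirected graph $G$ with $n$ vertices, vertices $s,t$, for each vertex $i$ a finite set $\mathcal{U}_i$ of possible positions in a metric space $(\mathcal{M},d)$, and the matrix of distances between all pairs of these positions. Writing $\mathcal{U}=\times_i\mathcal{U}_i$, the goal is to find an $s$-$t$ path $P$ minimizing $c(P)=\max_{u\in\mathcal{U}}\sum_{\{i,j\}\in E[P]} d(u_i,u_j)$. Here $\sigma=\max_i|\mathcal{U}_i|$.
   Formalization: The running time is proved as O(n^3 σ^2 max(1, n^2/ε)^σ) on a unit-cost real RAM; this is the stated bound whenever ε ≤ n^2, while for larger ε the stated formula tends to 0 and cannot bound a running time. Each U_i is taken nonempty. *)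

theory Defs
  imports "HOL-Analysis.Analysis"
begin

section \<open>The robust shortest path problem\<close>

record 'm robust_sp =
  nverts :: nat
  edges :: "nat set set"
  src :: nat
  dst :: nat
  ambient :: "'m metric"
  positions :: "nat \<Rightarrow> 'm set"

definition wf_instance :: "'m robust_sp \<Rightarrow> bool" where
  "wf_instance I \<longleftrightarrow>
     edges I \<subseteq> {{i, j} | i j. i < nverts I \<and> j < nverts I \<and> i \<noteq> j} \<and>
     src I < nverts I \<and> dst I < nverts I \<and>
     (\<forall>i<nverts I. finite (positions I i) \<and> positions I i \<noteq> {} \<and>
        positions I i \<subseteq> mspace (ambient I))"

definition scenarios :: "'m robust_sp \<Rightarrow> (nat \<Rightarrow> 'm) set" where
  "scenarios I = (\<Pi>\<^sub>E i\<in>{..<nverts I}. positions I i)"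

definition max_positions :: "'m robust_sp \<Rightarrow> nat" where
  "max_positions I = Max ((\<lambda>i. card (positions I i)) ` {..<nverts I})"

definition st_path :: "'m robust_sp \<Rightarrow> nat list \<Rightarrow> bool" where
  "st_path I P \<longleftrightarrow>
     P \<noteq> [] \<and> hd P = src I \<and> last P = dst I \<and> set P \<subseteq> {..<nverts I} \<and> distinct P \<and>
     (\<forall>k. Suc k < length P \<longrightarrow> {P ! k, P ! Suc k} \<in> edges I)"

text \<open>The vertices of a path are distinct, so summing over consecutive vertices is the same
  as summing over the edge set of the path.\<close>

definition path_length :: "'m robust_sp \<Rightarrow> (nat \<Rightarrow> 'm) \<Rightarrow> nat list \<Rightarrow> real" where
  "path_length I u P = (\<Sum>k<length P - 1. mdist (ambient I) (u (P ! k)) (u (P ! Suc k)))"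

definition cost :: "'m robust_sp \<Rightarrow> nat list \<Rightarrow> real" where
  "cost I P = Max ((\<lambda>u. path_length I u P) ` scenarios I)"

definition opt :: "'m robust_sp \<Rightarrow> real" where
  "opt I = Min (cost I ` {P. st_path I P})"

lemma finite_scenarios: "wf_instance I \<Longrightarrow> finite (scenarios I)"
  unfolding wf_instance_def scenarios_def by (auto intro!: finite_PiE)

lemma scenarios_nonempty: "wf_instance I \<Longrightarrow> scenarios I \<noteq> {}"
  unfolding wf_instance_def scenarios_def by (auto simp: PiE_eq_empty_iff)

lemma finite_st_paths: "finite {P. st_path I P}"
  by (rule finite_subset[OF _ finite_subset_distinct[of "{..<nverts I}"]])
     (auto simp: st_path_def)

definition approx_solution :: "'m robust_sp \<Rightarrow> real \<Rightarrow> nat list \<Rightarrow> bool" where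
  "approx_solution I \<epsilon> P \<longleftrightarrow> st_path I P \<and> cost I P \<le> (1 + \<epsilon>) * opt I"

text \<open>An instance without any path from the source to the destination is answered by the
  empty list.\<close>

definition correct_answer :: "'m robust_sp \<Rightarrow> real \<Rightarrow> nat list \<Rightarrow> bool" where
  "correct_answer I \<epsilon> P \<longleftrightarrow>
     (if \<exists>Q. st_path I Q then approx_solution I \<epsilon> P else P = [])"


section \<open>A real RAM with unit-cost steps\<close>

text \<open>
  Programs are while-programs over two kinds of cells, holding natural and real numbers.
  A cell is addressed by an array name and a list of indices whose length is fixed by the
  program text; a scalar is an array with the empty index list.

  Only operations that are standard in unit-cost models are present: on natural numbers
  there is no multiplication and no bit operation, so that \<open>t\<close> steps lengthen
  them by only \<open>O(t)\<close> bits; on real numbers there are the field operations and comparison, but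
  neither rounding nor any other way to turn a real number into a natural number, and the
  only constants are natural numbers. A program is a finite piece of text, hence the
  expressions in it have bounded size and each of them is evaluated in constant time.
\<close>

type_synonym name = string

record store =
  nats :: "name \<Rightarrow> nat list \<Rightarrow> nat"
  reals :: "name \<Rightarrow> nat list \<Rightarrow> real"

datatype nexp =
    NConst nat
  | NCell name "nexp list"
  | NAdd nexp nexp
  | NSub nexp nexp

datatype rexp =
    RNat nexp
  | RCell name "nexp list"
  | RAdd rexp rexp
  | RSub rexp rexp
  | RMul rexp rexp
  | RDiv rexp rexp

datatype bexp =
    NLess nexp nexp
  | RLess rexp rexp
  | BNot bexp
  | BAnd bexp bexp

datatype com =
    Skip
  | NAssign name "nexp list" nexp
  | RAssign name "nexp list" rexp
  | Seq com com
  | Cond bexp com com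
  | While bexp com

primrec nval :: "nexp \<Rightarrow> store \<Rightarrow> nat" where
  "nval (NConst c) st = c"
| "nval (NCell x ix) st = nats st x (map (\<lambda>i. nval i st) ix)"
| "nval (NAdd a b) st = nval a st + nval b st"
| "nval (NSub a b) st = nval a st - nval b st"

primrec rval :: "rexp \<Rightarrow> store \<Rightarrow> real" where
  "rval (RNat a) st = real (nval a st)"
| "rval (RCell x ix) st = reals st x (map (\<lambda>i. nval i st) ix)"
| "rval (RAdd a b) st = rval a st + rval b st"
| "rval (RSub a b) st = rval a st - rval b st"
| "rval (RMul a b) st = rval a st * rval b st"
| "rval (RDiv a b) st = rval a st / rval b st"

primrec bval :: "bexp \<Rightarrow> store \<Rightarrow> bool" where
  "bval (NLess a b) st \<longleftrightarrow> nval a st < nval b st"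
| "bval (RLess a b) st \<longleftrightarrow> rval a st < rval b st"
| "bval (BNot b) st \<longleftrightarrow> \<not> bval b st"
| "bval (BAnd a b) st \<longleftrightarrow> bval a st \<and> bval b st"

definition store_upd :: "(name \<Rightarrow> nat list \<Rightarrow> 'v) \<Rightarrow> name \<Rightarrow> nat list \<Rightarrow> 'v \<Rightarrow> name \<Rightarrow> nat list \<Rightarrow> 'v"
  where "store_upd m x ix v = m(x := (m x)(ix := v))"

text \<open>\<open>exec p st t st'\<close>: started in \<open>st\<close>, the program \<open>p\<close> halts in \<open>st'\<close> after \<open>t\<close> steps.\<close>

inductive exec :: "com \<Rightarrow> store \<Rightarrow> nat \<Rightarrow> store \<Rightarrow> bool" where
  Skip: "exec Skip st 1 st"
| NAssign: "exec (NAssign x ix a) st 1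
    (st\<lparr>nats := store_upd (nats st) x (map (\<lambda>i. nval i st) ix) (nval a st)\<rparr>)"
| RAssign: "exec (RAssign x ix a) st 1
    (st\<lparr>reals := store_upd (reals st) x (map (\<lambda>i. nval i st) ix) (rval a st)\<rparr>)"
| Seq: "exec p st t st' \<Longrightarrow> exec q st' t' st'' \<Longrightarrow> exec (Seq p q) st (t + t') st''"
| CondTrue: "bval b st \<Longrightarrow> exec p st t st' \<Longrightarrow> exec (Cond b p q) st (1 + t) st'"
| CondFalse: "\<not> bval b st \<Longrightarrow> exec q st t st' \<Longrightarrow> exec (Cond b p q) st (1 + t) st'"
| WhileFalse: "\<not> bval b st \<Longrightarrow> exec (While b p) st 1 st"
| WhileTrue: "bval b st \<Longrightarrow> exec p st t st' \<Longrightarrow> exec (While b p) st' t' st'' \<Longrightarrow>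
    exec (While b p) st (1 + t + t') st''"

inductive_cases exec_SkipE: "exec Skip st t st'"
inductive_cases exec_NAssignE: "exec (NAssign x ix a) st t st'"
inductive_cases exec_RAssignE: "exec (RAssign x ix a) st t st'"
inductive_cases exec_SeqE: "exec (Seq p q) st t st'"
inductive_cases exec_CondE: "exec (Cond b p q) st t st'"
inductive_cases exec_WhileE: "exec (While b p) st t st'"

lemma exec_deterministic:
  "exec p st t1 st1 \<Longrightarrow> exec p st t2 st2 \<Longrightarrow> t2 = t1 \<and> st2 = st1"
proof (induction arbitrary: t2 st2 rule: exec.induct)
  case (Seq p st t st' q t' st'')
  from Seq.prems obtain u v su where "exec p st u su" "exec q su v st2" "t2 = u + v"
    by (rule exec_SeqE)
  with Seq.IH(1)[of u su] Seq.IH(2)[of v st2] show ?case by simp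
next
  case (CondTrue b st p t st' q)
  from CondTrue.prems CondTrue.hyps obtain u where "exec p st u st2" "t2 = 1 + u"
    by (auto elim: exec_CondE)
  with CondTrue.IH[of u st2] show ?case by simp
next
  case (CondFalse b st q t st' p)
  from CondFalse.prems CondFalse.hyps obtain u where "exec q st u st2" "t2 = 1 + u"
    by (auto elim: exec_CondE)
  with CondFalse.IH[of u st2] show ?case by simp
next
  case (WhileFalse b st p)
  from WhileFalse.prems WhileFalse.hyps show ?case by (auto elim: exec_WhileE)
next
  case (WhileTrue b st p t st' t' st'')
  from WhileTrue.prems WhileTrue.hyps(1) obtain u v su
    where "exec p st u su" "exec (While b p) su v st2" "t2 = 1 + u + v"
    by (auto elim: exec_WhileE)
  with WhileTrue.IH(1)[of u su] WhileTrue.IH(2)[of v st2] show ?case by simp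
qed (auto elim: exec_SkipE exec_NAssignE exec_RAssignE)


section \<open>Input, output and running time\<close>

text \<open>\<open>pt i a\<close> is the \<open>a\<close>-th position of vertex \<open>i\<close>. The program never sees the positions
  themselves, only their pairwise distances.\<close>

definition enumerates :: "'m robust_sp \<Rightarrow> (nat \<Rightarrow> nat \<Rightarrow> 'm) \<Rightarrow> bool" where
  "enumerates I pt \<longleftrightarrow>
     (\<forall>i<nverts I. bij_betw (pt i) {..<card (positions I i)} (positions I i))"

definition input_nats :: "'m robust_sp \<Rightarrow> name \<Rightarrow> nat list \<Rightarrow> nat" where
  "input_nats I x ix =
     (if x = ''n'' \<and> ix = [] then nverts I
      else if x = ''s'' \<and> ix = [] then src I
      else if x = ''t'' \<and> ix = [] then dst I
      else if x = ''adj'' then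
        (case ix of [i, j] \<Rightarrow> if {i, j} \<in> edges I then 1 else 0 | _ \<Rightarrow> 0)
      else if x = ''card'' then
        (case ix of [i] \<Rightarrow> if i < nverts I then card (positions I i) else 0 | _ \<Rightarrow> 0)
      else 0)"

definition input_reals ::
    "'m robust_sp \<Rightarrow> (nat \<Rightarrow> nat \<Rightarrow> 'm) \<Rightarrow> real \<Rightarrow> name \<Rightarrow> nat list \<Rightarrow> real" where
  "input_reals I pt \<epsilon> x ix =
     (if x = ''eps'' \<and> ix = [] then \<epsilon>
      else if x = ''dist'' then
        (case ix of
           [i, a, j, b] \<Rightarrow>
             if i < nverts I \<and> a < card (positions I i) \<and>
                j < nverts I \<and> b < card (positions I j)
             then mdist (ambient I) (pt i a) (pt j b) else 0
         | _ \<Rightarrow> 0)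
      else 0)"

definition input_store :: "'m robust_sp \<Rightarrow> (nat \<Rightarrow> nat \<Rightarrow> 'm) \<Rightarrow> real \<Rightarrow> store" where
  "input_store I pt \<epsilon> = \<lparr>nats = input_nats I, reals = input_reals I pt \<epsilon>\<rparr>"

definition output_path :: "store \<Rightarrow> nat list" where
  "output_path st = map (\<lambda>k. nats st ''path'' [k]) [0..<nats st ''len'' []]"

definition approximates_within ::
    "com \<Rightarrow> 'm robust_sp \<Rightarrow> (nat \<Rightarrow> nat \<Rightarrow> 'm) \<Rightarrow> real \<Rightarrow> real \<Rightarrow> bool" where
  "approximates_within p I pt \<epsilon> T \<longleftrightarrow>
     (\<exists>t st. exec p (input_store I pt \<epsilon>) t st \<and> real t \<le> T \<and> correct_answer I \<epsilon> (output_path st))"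

text \<open>The number of cells occupied by an instance: three scalars, the adjacency matrix,
  the sizes of the position sets, and the distance matrix.\<close>

definition input_size :: "'m robust_sp \<Rightarrow> nat" where
  "input_size I =
     3 + (nverts I)\<^sup>2 + nverts I + (\<Sum>i<nverts I. card (positions I i))\<^sup>2"

definition fptas_on :: "'m robust_sp set \<Rightarrow> com \<Rightarrow> bool" where
  "fptas_on \<I> p \<longleftrightarrow>
     (\<exists>(c::real) (k::nat). \<forall>I\<in>\<I>. \<forall>pt \<epsilon>. enumerates I pt \<longrightarrow> 0 < \<epsilon> \<longrightarrow>
        approximates_within p I pt \<epsilon> (c * (real (input_size I) + 1 / \<epsilon>) ^ k))"

text \<open>For \<open>\<epsilon> \<le> n\<^sup>2\<close> this is literally \<open>n\<^sup>3 \<sigma>\<^sup>2 (n\<^sup>2 / \<epsilon>)\<^sup>\<sigma>\<close>. The maximum only matters for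
  \<open>\<epsilon> > n\<^sup>2\<close>, where that formula tends to \<open>0\<close> as \<open>\<epsilon>\<close> grows and cannot bound a number of steps.\<close>

definition time_bound :: "'m robust_sp \<Rightarrow> real \<Rightarrow> real" where
  "time_bound I \<epsilon> =
     real (nverts I) ^ 3 * real (max_positions I) ^ 2 *
     (max 1 (real (nverts I) ^ 2 / \<epsilon>)) ^ max_positions I"

end

theory Submission
  imports Defs
begin

text \<open>
  Give each edge the largest distance between positions of its ends. Along a path, the edges of even
  index can all attain their maximum in one scenario, and so can those of odd index; so the shortest
  path for these weights has length \<open>A\<close> with \<open>OPT \<le> A \<le> 2 OPT\<close>. It is already good enough if
  \<open>\<epsilon> \<ge> 1\<close> or \<open>A = 0\<close>, and it is the only path if \<open>n \<le> 2\<close>.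

  Otherwise distances are rounded down to multiples of \<open>\<delta> = \<epsilon> A / (2 n)\<close>, which costs at most
  \<open>n \<delta> \<le> \<epsilon> OPT\<close> on a path. The worst case of a path ending in \<open>i\<close> is described by the vector of its largest
  rounded lengths, one for each position of \<open>i\<close>, and the vector of an extended path depends only on
  this vector. Entries above \<open>2 n / \<epsilon>\<close> can be discarded since \<open>OPT \<le> A\<close>, so there are at most
  \<open>(2 n / \<epsilon> + 1)\<^sup>\<sigma> \<le> (n\<^sup>2 / \<epsilon>)\<^sup>\<sigma>\<close> vectors per vertex when \<open>n \<ge> 3\<close> and \<open>\<epsilon> < 1\<close>. A dynamic program over the
  number of edges, the last vertex and the vector finds an optimal walk with as few edges as possible;
  it is a simple path, because removing a cycle never increases the vector.
\<close>

subsection \<open>Timed total correctness\<close>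

text \<open>The bound has n^2/\<epsilon> under the exponent \<sigma>, so a constant factor in the
  number \<open>B\<close> of values per entry would be raised to the power \<sigma>.
  \<open>B\<close> itself must be at most n^2/\<epsilon>, which sets the cases
  \<open>\<epsilon> \<ge> 1\<close> and \<open>n \<le> 2\<close> apart. The machine shapes the rest.
  It has neither multiplication of naturals nor rounding of reals, and index lists have a length
  fixed by the program, while one program must serve all \<sigma>. A vector is therefore stored as
  one number whose digits in base \<open>B\<close> are its entries; digits and multiples of powers
  are tabulated by additions. \<open>B\<close> and the rounded distances are found by counting,
  which is affordable because it stops at \<open>B\<close>. One program does both searches, over
  pairs of a vertex and a state. A single state with real edge weights gives shortest paths; vectors
  as states, with weight 0, give the rounded problem. Positions are chosen anew at each visit of a
  vertex, so the vectors describe the robust cost only where no vertex repeats. This is why the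
  search must end in a simple path.\<close>

definition runs :: "com \<Rightarrow> store \<Rightarrow> nat \<Rightarrow> (store \<Rightarrow> bool) \<Rightarrow> bool" where
  "runs p st T Q \<longleftrightarrow> (\<exists>t st'. exec p st t st' \<and> t \<le> T \<and> Q st')"

section \<open>Frames and proof rules for bounded running time\<close>

primrec nat_writes :: "com \<Rightarrow> name set" where
  "nat_writes Skip = {}"
| "nat_writes (NAssign x ix a) = {x}"
| "nat_writes (RAssign x ix a) = {}"
| "nat_writes (Seq p q) = nat_writes p \<union> nat_writes q"
| "nat_writes (Cond b p q) = nat_writes p \<union> nat_writes q"
| "nat_writes (While b p) = nat_writes p"

primrec real_writes :: "com \<Rightarrow> name set" where
  "real_writes Skip = {}"
| "real_writes (NAssign x ix a) = {}"
| "real_writes (RAssign x ix a) = {x}"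
| "real_writes (Seq p q) = real_writes p \<union> real_writes q"
| "real_writes (Cond b p q) = real_writes p \<union> real_writes q"
| "real_writes (While b p) = real_writes p"

text \<open>Cells are framed as whole arrays: names can be read off the program text, indices are
  computed at run time.\<close>

definition same_except :: "name set \<Rightarrow> name set \<Rightarrow> store \<Rightarrow> store \<Rightarrow> bool" where
  "same_except X Y st st' \<longleftrightarrow>
     (\<forall>x. x \<notin> X \<longrightarrow> nats st' x = nats st x) \<and> (\<forall>y. y \<notin> Y \<longrightarrow> reals st' y = reals st y)"

lemma same_except_nats: "same_except X Y st st' \<Longrightarrow> x \<notin> X \<Longrightarrow> nats st' x = nats st x"
  and same_except_reals: "same_except X Y st st' \<Longrightarrow> y \<notin> Y \<Longrightarrow> reals st' y = reals st y"
  by (auto simp: same_except_def)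

lemma same_except_refl: "same_except X Y st st"
  by (simp add: same_except_def)

lemma same_except_trans:
  "same_except X Y st st' \<Longrightarrow> same_except X' Y' st' st'' \<Longrightarrow> X \<subseteq> Z \<Longrightarrow> X' \<subseteq> Z \<Longrightarrow> Y \<subseteq> V \<Longrightarrow> Y' \<subseteq> V \<Longrightarrow>
   same_except Z V st st''"
  unfolding same_except_def by (metis subsetD)

lemma exec_same_except: "exec p st t st' \<Longrightarrow> same_except (nat_writes p) (real_writes p) st st'"
  by (induction rule: exec.induct)
     (auto simp: same_except_def store_upd_def)

lemma store_upd_apply [simp]:
  "store_upd f x ix v y iy = (if y = x \<and> iy = ix then v else f y iy)"
  "y \<noteq> x \<Longrightarrow> store_upd f x ix v y = f y"
  by (auto simp: store_upd_def)

text \<open>The change that a loop makes to its own counter. Loop invariants are required to be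
  stable under it.\<close>

definition set_nat :: "name \<Rightarrow> nat \<Rightarrow> store \<Rightarrow> store" where
  "set_nat x v st = st\<lparr>nats := store_upd (nats st) x [] v\<rparr>"

lemma nats_set_nat [simp]: "nats (set_nat x v st) y iy = (if y = x \<and> iy = [] then v else nats st y iy)"
  and nats_set_nat_other [simp]: "y \<noteq> x \<Longrightarrow> nats (set_nat x v st) y = nats st y"
  and reals_set_nat [simp]: "reals (set_nat x v st) = reals st"
  by (simp_all add: set_nat_def)

lemma same_except_set_nat:
  "x \<in> X \<Longrightarrow> same_except X Y st (set_nat x v st') \<longleftrightarrow> same_except X Y st st'"
  by (auto simp: same_except_def fun_eq_iff)

lemma runs_mono: "runs p st T Q \<Longrightarrow> T \<le> T' \<Longrightarrow> (\<And>st'. Q st' \<Longrightarrow> Q' st') \<Longrightarrow> runs p st T' Q'"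
  unfolding runs_def by (meson le_trans)

lemma runs_time: "runs p st T Q \<Longrightarrow> T \<le> T' \<Longrightarrow> runs p st T' Q"
  by (rule runs_mono)

lemma runs_frame:
  "runs p st T Q \<Longrightarrow> runs p st T (\<lambda>st'. Q st' \<and> same_except (nat_writes p) (real_writes p) st st')"
  unfolding runs_def using exec_same_except by blast

lemma runs_Skip: "Q st \<Longrightarrow> runs Skip st 1 Q"
  unfolding runs_def using exec.Skip by blast

lemma runs_NAssign:
  "Q (st\<lparr>nats := store_upd (nats st) x (map (\<lambda>i. nval i st) ix) (nval a st)\<rparr>) \<Longrightarrow>
   runs (NAssign x ix a) st 1 Q"
  unfolding runs_def using exec.NAssign by blast

lemma runs_RAssign:
  "Q (st\<lparr>reals := store_upd (reals st) x (map (\<lambda>i. nval i st) ix) (rval a st)\<rparr>) \<Longrightarrow>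
   runs (RAssign x ix a) st 1 Q"
  unfolding runs_def using exec.RAssign by blast

lemma runs_Seq: "runs p st T (\<lambda>st'. runs q st' T' Q) \<Longrightarrow> runs (Seq p q) st (T + T') Q"
  unfolding runs_def using exec.Seq by (meson add_mono)

lemma runs_Seq_frame:
  assumes "runs p st T R"
    and "\<And>st'. R st' \<Longrightarrow> same_except (nat_writes p) (real_writes p) st st' \<Longrightarrow> runs q st' T' Q"
  shows "runs (Seq p q) st (T + T') Q"
  by (rule runs_Seq, rule runs_mono[OF runs_frame[OF assms(1)] order_refl]) (use assms(2) in blast)

text \<open>Adding the bounds of the two branches instead of taking their maximum keeps all time
  bounds linear expressions, at the price of a constant.\<close>

lemma runs_Cond:
  assumes "bval b st \<Longrightarrow> runs p st T Q" "\<not> bval b st \<Longrightarrow> runs q st T' Q"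
  shows "runs (Cond b p q) st (1 + (T + T')) Q"
proof (cases "bval b st")
  case True
  then obtain t st' where "exec p st t st'" "t \<le> T" "Q st'"
    using assms(1) unfolding runs_def by blast
  then show ?thesis
    unfolding runs_def using exec.CondTrue[OF True] by (intro exI[of _ "1 + t"] exI[of _ st']) auto
next
  case False
  then obtain t st' where "exec q st t st'" "t \<le> T'" "Q st'"
    using assms(2) unfolding runs_def by blast
  then show ?thesis
    unfolding runs_def using exec.CondFalse[OF False] by (intro exI[of _ "1 + t"] exI[of _ st']) auto
qed

text \<open>Meant to be evaluated by simplification. The precondition \<open>False\<close> for a
  loop makes any step count for it sound in \<open>loop_free_steps\<close>.\<close>

primrec loop_free_wp :: "com \<Rightarrow> (store \<Rightarrow> bool) \<Rightarrow> store \<Rightarrow> bool" where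
  "loop_free_wp Skip Q st = Q st"
| "loop_free_wp (NAssign x ix a) Q st =
     Q (st\<lparr>nats := store_upd (nats st) x (map (\<lambda>i. nval i st) ix) (nval a st)\<rparr>)"
| "loop_free_wp (RAssign x ix a) Q st =
     Q (st\<lparr>reals := store_upd (reals st) x (map (\<lambda>i. nval i st) ix) (rval a st)\<rparr>)"
| "loop_free_wp (Seq p q) Q st = loop_free_wp p (loop_free_wp q Q) st"
| "loop_free_wp (Cond b p q) Q st = (if bval b st then loop_free_wp p Q st else loop_free_wp q Q st)"
| "loop_free_wp (While b p) Q st = False"

primrec loop_free_steps :: "com \<Rightarrow> nat" where
  "loop_free_steps Skip = 1"
| "loop_free_steps (NAssign x ix a) = 1"
| "loop_free_steps (RAssign x ix a) = 1"
| "loop_free_steps (Seq p q) = loop_free_steps p + loop_free_steps q"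
| "loop_free_steps (Cond b p q) = 1 + (loop_free_steps p + loop_free_steps q)"
| "loop_free_steps (While b p) = 0"

lemma runs_loop_free:
  assumes "loop_free_wp p Q st" "loop_free_steps p \<le> T"
  shows "runs p st T Q"
proof -
  have "runs p st (loop_free_steps p) Q"
    using assms(1)
  proof (induction p arbitrary: Q st)
    case (Seq p q)
    have "runs p st (loop_free_steps p) (loop_free_wp q Q)"
      using Seq.prems by (intro Seq.IH) simp
    then show ?case
      by (auto intro!: runs_Seq elim: runs_mono intro: Seq.IH)
  next
    case (Cond b p q)
    show ?case
      unfolding loop_free_steps.simps by (rule runs_Cond; rule Cond.IH; use Cond.prems in simp)
  qed (simp_all add: runs_Skip[simplified] runs_NAssign[simplified] runs_RAssign[simplified])
  then show ?thesis
    using assms(2) by (rule runs_time)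
qed

text \<open>The index of the invariant counts passes, and \<open>i < m\<close> is demanded whenever
  the guard holds, so \<open>m\<close> bounds their number. Each step also receives the frame from
  the initial store, which spares the invariant all cells that the body leaves alone.\<close>

lemma runs_While:
  assumes "I 0 st"
    and step: "\<And>i st'. I i st' \<Longrightarrow> bval b st' \<Longrightarrow>
          same_except (nat_writes p) (real_writes p) st st' \<Longrightarrow> i < m \<and> runs p st' T (I (Suc i))"
  shows "runs (While b p) st (1 + m * (T + 1)) (\<lambda>st'. (\<exists>i. I i st') \<and> \<not> bval b st')"
proof -
  have "runs (While b p) st' (1 + (m - i) * (T + 1)) (\<lambda>st'. (\<exists>i. I i st') \<and> \<not> bval b st')"
    if "I i st'" "same_except (nat_writes p) (real_writes p) st st'" for i st'
    using that
  proof (induction "m - i" arbitrary: i st' rule: less_induct)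
    case less
    show ?case
    proof (cases "bval b st'")
      case False
      with less.prems exec.WhileFalse[OF False] show ?thesis
        unfolding runs_def by (intro exI[of _ 1] exI[of _ st']) auto
    next
      case True
      with step[OF less.prems(1) True less.prems(2)] have i: "i < m" and r: "runs p st' T (I (Suc i))"
        by auto
      then obtain t st'' where e: "exec p st' t st''" "t \<le> T" "I (Suc i) st''"
        unfolding runs_def by blast
      have "same_except (nat_writes p) (real_writes p) st st''"
        using less.prems(2) exec_same_except[OF e(1)] by (auto intro: same_except_trans)
      from less.hyps[OF _ e(3) this] i
      have "runs (While b p) st'' (1 + (m - Suc i) * (T + 1)) (\<lambda>st'. (\<exists>i. I i st') \<and> \<not> bval b st')"
        by auto
      then obtain u st3 where u: "exec (While b p) st'' u st3" "u \<le> 1 + (m - Suc i) * (T + 1)"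
        "\<exists>i. I i st3" "\<not> bval b st3"
        unfolding runs_def by blast
      have "m - i = Suc (m - Suc i)"
        using i by simp
      then have "1 + t + u \<le> 1 + (m - i) * (T + 1)"
        using e(2) u(2) by simp
      with exec.WhileTrue[OF True e(1) u(1)] u(3,4) show ?thesis
        unfolding runs_def by blast
    qed
  qed
  from this[OF assms(1) same_except_refl] show ?thesis
    by simp
qed

definition For :: "name \<Rightarrow> nexp \<Rightarrow> com \<Rightarrow> com" where
  "For x e p = Seq (NAssign x [] (NConst 0))
     (While (NLess (NCell x []) e) (Seq p (NAssign x [] (NAdd (NCell x []) (NConst 1)))))"

lemma writes_For [simp]:
  "nat_writes (For x e p) = insert x (nat_writes p)"
  "real_writes (For x e p) = real_writes p"
  by (auto simp: For_def)

text \<open>The bound \<open>e\<close> is evaluated anew before each pass, hence it must keep its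
  value in every store that the body can produce. The time consists of the initialisation, the last
  test, and \<open>T + 2\<close> per pass for the test, the body and the increment.\<close>

lemma runs_For:
  assumes x: "x \<notin> nat_writes p"
    and bound: "\<And>st'. same_except (insert x (nat_writes p)) (real_writes p) st st' \<Longrightarrow> nval e st' = m"
    and indep: "\<And>i st' v. I i st' \<Longrightarrow> I i (set_nat x v st')"
    and init: "I 0 st"
    and step: "\<And>i st'. i < m \<Longrightarrow> I i st' \<Longrightarrow> nats st' x [] = i \<Longrightarrow>
          same_except (insert x (nat_writes p)) (real_writes p) st st' \<Longrightarrow> runs p st' T (I (Suc i))"
    and time: "2 + m * (T + 2) \<le> T'"
  shows "runs (For x e p) st T' (I m)"
proof -
  let ?W = "insert x (nat_writes p)" and ?V = "real_writes p"
  let ?b = "NLess (NCell x []) e"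
  let ?q = "Seq p (NAssign x [] (NAdd (NCell x []) (NConst 1)))"
  let ?J = "\<lambda>i st'. I i st' \<and> nats st' x [] = i \<and> i \<le> m \<and> same_except ?W ?V st st'"
  have "runs (While ?b ?q) (set_nat x 0 st) (1 + m * ((T + 1) + 1))
          (\<lambda>st'. (\<exists>i. ?J i st') \<and> \<not> bval ?b st')"
  proof (rule runs_While)
    show "?J 0 (set_nat x 0 st)"
      using indep[OF init] by (simp add: same_except_set_nat same_except_refl)
    fix i st'
    assume J: "?J i st'" and b: "bval ?b st'"
    then have i: "i < m"
      using bound[of st'] by simp
    have "runs ?q st' (T + 1) (?J (Suc i))"
    proof (rule runs_Seq_frame)
      show "runs p st' T (I (Suc i))"
        using step[of i st'] J i by simp
      fix st''
      assume I: "I (Suc i) st''" and fr: "same_except (nat_writes p) (real_writes p) st' st''"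
      have e: "st''\<lparr>nats := store_upd (nats st'') x (map (\<lambda>i. nval i st'') [])
             (nval (NAdd (NCell x []) (NConst 1)) st'')\<rparr> = set_nat x (Suc i) st''"
        using same_except_nats[OF fr x] J by (simp add: set_nat_def)
      have "same_except ?W ?V st st''"
        using J fr by (auto intro: same_except_trans)
      then show "runs (NAssign x [] (NAdd (NCell x []) (NConst 1))) st'' 1 (?J (Suc i))"
        using I i indep by (intro runs_NAssign) (simp only: e, simp add: same_except_set_nat)
    qed
    with i show "i < m \<and> runs ?q st' (T + 1) (?J (Suc i))"
      by blast
  qed
  then have "runs (While ?b ?q) (set_nat x 0 st) (1 + m * (T + 2)) (I m)"
    by (rule runs_mono) (use bound in auto)
  then have "runs (For x e p) st (1 + (1 + m * (T + 2))) (I m)"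
    unfolding For_def by (intro runs_Seq runs_NAssign) (simp add: set_nat_def)
  then show ?thesis
    by (rule runs_mono) (use time in auto)
qed

text \<open>Each level of nesting raises the constant before the product of the loop lengths by 4: 2
  for the initialisation and the last test, 2 for the test and the increment of each pass. The
  sequences 12, 16, 20, ... of constants come from here, and a final factor 1 in a bound is the
  \<open>X\<close> of an innermost body.\<close>

lemma loop_time:
  fixes m :: nat
  assumes "T \<le> c * X" "m \<le> M" "1 \<le> M" "1 \<le> X" "c + 4 \<le> c'"
  shows "2 + m * (T + 2) \<le> c' * (M * X)"
proof -
  have "1 \<le> M * X"
    using assms(3,4) by (simp add: Suc_le_eq)
  have "m * (T + 2) \<le> M * (c * X + 2 * X)"
    using assms by (intro mult_le_mono) auto
  then have "2 + m * (T + 2) \<le> 2 * (M * X) + M * (c * X + 2 * X)"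
    using \<open>1 \<le> M * X\<close> by linarith
  also have "\<dots> = (c + 4) * (M * X)"
    by (simp add: algebra_simps)
  also have "\<dots> \<le> c' * (M * X)"
    using assms(5) by (intro mult_le_mono1)
  finally show ?thesis .
qed

subsection \<open>Layered shortest walks\<close>

abbreviation Var :: "name \<Rightarrow> nexp" where
  "Var x \<equiv> NCell x []"

text \<open>The array \<open>R\<close> marking reachable states is a parameter: the search runs twice and needs an array
  that still holds its initial zeros each time.\<close>

definition relax :: "name \<Rightarrow> com" where
  "relax R =
     Cond (BAnd (NLess (NConst 0) (NCell R [Var ''k'', Var ''i'', Var ''c'']))
          (BAnd (NLess (NConst 0) (NCell ''adj'' [Var ''i'', Var ''j'']))
                (NLess (NCell ''nxt'' [Var ''i'', Var ''c'', Var ''j'']) (Var ''N''))))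
       (Seq (NAssign ''e'' [] (NCell ''nxt'' [Var ''i'', Var ''c'', Var ''j'']))
       (Seq (NAssign ''h'' [] (NAdd (Var ''k'') (NConst 1)))
       (Seq (RAssign ''x'' [] (RAdd (RCell ''B'' [Var ''k'', Var ''i'', Var ''c''])
                                     (RCell ''w'' [Var ''i'', Var ''c'', Var ''j''])))
         (Cond (BAnd (NLess (NConst 0) (NCell R [Var ''h'', Var ''j'', Var ''e'']))
                     (BNot (RLess (RCell ''x'' []) (RCell ''B'' [Var ''h'', Var ''j'', Var ''e'']))))
            Skip
            (Seq (NAssign R [Var ''h'', Var ''j'', Var ''e''] (NConst 1))
            (Seq (RAssign ''B'' [Var ''h'', Var ''j'', Var ''e''] (RCell ''x'' []))
            (Seq (NAssign ''par'' [Var ''h'', Var ''j'', Var ''e''] (Var ''i''))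
                 (NAssign ''parc'' [Var ''h'', Var ''j'', Var ''e''] (Var ''c'')))))))))
       Skip"

definition propagate :: "name \<Rightarrow> com" where
  "propagate R =
     For ''k'' (Var ''n'') (For ''i'' (Var ''n'') (For ''c'' (Var ''N'')
       (For ''j'' (Var ''n'') (relax R))))"

text \<open>Layers are scanned upwards and only a strict improvement replaces the candidate, so ties
  go to the walk with fewest edges.\<close>

definition select :: "name \<Rightarrow> com" where
  "select R =
     For ''k'' (Var ''n'') (For ''c'' (Var ''N'')
       (Cond (BAnd (NLess (NConst 0) (NCell R [Var ''k'', Var ''t'', Var ''c'']))
               (BNot (BAnd (NLess (NConst 0) (Var ''found''))
                  (BNot (RLess (RAdd (RCell ''B'' [Var ''k'', Var ''t'', Var ''c'']) (RCell ''fin'' [Var ''c'']))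
                               (RCell ''best'' []))))))
          (Seq (NAssign ''found'' [] (NConst 1))
          (Seq (RAssign ''best'' [] (RAdd (RCell ''B'' [Var ''k'', Var ''t'', Var ''c'']) (RCell ''fin'' [Var ''c''])))
          (Seq (NAssign ''bk'' [] (Var ''k''))
               (NAssign ''bc'' [] (Var ''c'')))))
          Skip))"

text \<open>The path is written from its end. The new vertex waits in \<open>e\<close> because the
  old \<open>ci\<close> is still an index when the new state is read. The last pass writes entry 0
  before it reads a parent, so what it finds there has no effect on the path.\<close>

definition backtrack :: com where
  "backtrack =
     Seq (NAssign ''len'' [] (NAdd (Var ''bk'') (NConst 1)))
     (Seq (NAssign ''ci'' [] (Var ''t''))
     (Seq (NAssign ''cc'' [] (Var ''bc''))
       (For ''l'' (Var ''len'')
         (Seq (NAssign ''h'' [] (NSub (Var ''bk'') (Var ''l'')))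
         (Seq (NAssign ''path'' [Var ''h''] (Var ''ci''))
         (Seq (NAssign ''e'' [] (NCell ''par'' [Var ''h'', Var ''ci'', Var ''cc'']))
         (Seq (NAssign ''cc'' [] (NCell ''parc'' [Var ''h'', Var ''ci'', Var ''cc'']))
              (NAssign ''ci'' [] (Var ''e''))))))))) "

text \<open>Only the marks \<open>R\<close> have to start at zero. \<open>B\<close> and the parent
  arrays may hold values of an earlier search, since no decision depends on such a cell before it is
  marked; \<open>found\<close> is reset because the first search may have set it.\<close>

definition layered :: "name \<Rightarrow> com" where
  "layered R =
     Seq (NAssign R [NConst 0, Var ''s'', NConst 0] (NConst 1))
     (Seq (RAssign ''B'' [NConst 0, Var ''s'', NConst 0] (RNat (NConst 0)))
     (Seq (propagate R)
     (Seq (NAssign ''found'' [] (NConst 0))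
     (Seq (select R)
       (Cond (NLess (NConst 0) (Var ''found'')) backtrack Skip)))))"

lemma writes_relax [simp]:
  "nat_writes (relax R) = {''e'', ''h'', R, ''par'', ''parc''}" "real_writes (relax R) = {''x'', ''B''}"
  by (auto simp: relax_def)

lemma writes_propagate [simp]:
  "nat_writes (propagate R) = {''k'', ''i'', ''c'', ''j'', ''e'', ''h'', R, ''par'', ''parc''}"
  "real_writes (propagate R) = {''x'', ''B''}"
  by (auto simp: propagate_def)

lemma writes_select [simp]:
  "nat_writes (select R) = {''k'', ''c'', ''found'', ''bk'', ''bc''}"
  "real_writes (select R) = {''best''}"
  by (auto simp: select_def)

lemma writes_backtrack [simp]:
  "nat_writes backtrack = {''len'', ''ci'', ''cc'', ''l'', ''h'', ''path'', ''e''}"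
  "real_writes backtrack = {}"
  by (auto simp: backtrack_def)

lemma writes_layered [simp]:
  "nat_writes (layered R) = {R, ''k'', ''i'', ''c'', ''j'', ''e'', ''h'', ''par'', ''parc'', ''found'', ''bk'', ''bc'',
      ''len'', ''ci'', ''cc'', ''l'', ''path''}"
  "real_writes (layered R) = {''x'', ''B'', ''best''}"
  by (auto simp: layered_def)

section \<open>Walks with states and correctness of the search\<close>

locale layered_graph =
  fixes n s t :: nat and adj :: "nat \<Rightarrow> nat \<Rightarrow> bool"
    and N :: nat and nx :: "nat \<Rightarrow> nat \<Rightarrow> nat \<Rightarrow> nat"
    and w :: "nat \<Rightarrow> nat \<Rightarrow> nat \<Rightarrow> real" and fin :: "nat \<Rightarrow> real"
  assumes s: "s < n" and t: "t < n" and N: "0 < N"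
begin

text \<open>The state carried along the walk, starting from 0. A value of \<open>N\<close> or more
  means that the walk has been discarded, see \<open>walk\<close>.\<close>

primrec run :: "(nat \<Rightarrow> nat) \<Rightarrow> nat \<Rightarrow> nat" where
  "run p 0 = 0"
| "run p (Suc k) = nx (p k) (run p k) (p (Suc k))"

definition total :: "(nat \<Rightarrow> nat) \<Rightarrow> nat \<Rightarrow> real" where
  "total p L = (\<Sum>k<L. w (p k) (run p k) (p (Suc k)))"

definition objective :: "(nat \<Rightarrow> nat) \<Rightarrow> nat \<Rightarrow> real" where
  "objective p L = total p L + fin (run p L)"

definition walk :: "(nat \<Rightarrow> nat) \<Rightarrow> nat \<Rightarrow> bool" where
  "walk p L \<longleftrightarrow> p 0 = s \<and> (\<forall>k\<le>L. p k < n) \<and> (\<forall>k<L. adj (p k) (p (Suc k))) \<and> (\<forall>k\<le>L. run p k < N)"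

definition st_walk :: "(nat \<Rightarrow> nat) \<Rightarrow> nat \<Rightarrow> bool" where
  "st_walk p L \<longleftrightarrow> walk p L \<and> p L = t \<and> L < n"

definition lex_min :: "(nat \<Rightarrow> nat) \<Rightarrow> nat \<Rightarrow> bool" where
  "lex_min p L \<longleftrightarrow> st_walk p L \<and>
     (\<forall>q M. st_walk q M \<longrightarrow> objective p L < objective q M \<or> objective p L = objective q M \<and> L \<le> M)"

definition encodes :: "store \<Rightarrow> bool" where
  "encodes st \<longleftrightarrow> nats st ''n'' [] = n \<and> nats st ''s'' [] = s \<and> nats st ''t'' [] = t \<and> nats st ''N'' [] = N \<and>
     (\<forall>i<n. \<forall>j<n. 0 < nats st ''adj'' [i, j] \<longleftrightarrow> adj i j) \<and>
     (\<forall>i<n. \<forall>c<N. \<forall>j<n. nats st ''nxt'' [i, c, j] = nx i c j) \<and>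
     (\<forall>i<n. \<forall>c<N. \<forall>j<n. reals st ''w'' [i, c, j] = w i c j) \<and>
     (\<forall>c<N. reals st ''fin'' [c] = fin c)"

lemma encodes_same_except:
  assumes "same_except X Y st st'" "encodes st"
    and "X \<inter> {''n'', ''s'', ''t'', ''N'', ''adj'', ''nxt''} = {}" "Y \<inter> {''w'', ''fin''} = {}"
  shows "encodes st'"
proof -
  have "x \<in> {''n'', ''s'', ''t'', ''N'', ''adj'', ''nxt''} \<Longrightarrow> nats st' x = nats st x"
    "x \<in> {''w'', ''fin''} \<Longrightarrow> reals st' x = reals st x" for x
    using assms(1,3,4) unfolding same_except_def by blast+
  with assms(2) show ?thesis
    unfolding encodes_def by simp
qed

text \<open>An equation and not just an inequality between the entry and that of its parent: the
  layer of the parent is final before the next layer is written. A traced walk thus has exactly the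
  recorded weight.\<close>

definition origin :: "name \<Rightarrow> store \<Rightarrow> nat \<Rightarrow> nat \<Rightarrow> nat \<Rightarrow> bool" where
  "origin R st k i c \<longleftrightarrow> i < n \<and> c < N \<and>
     (case k of 0 \<Rightarrow> i = s \<and> c = 0 \<and> reals st ''B'' [0, i, c] = 0
      | Suc h \<Rightarrow> (\<exists>i' c'. i' = nats st ''par'' [k, i, c] \<and> c' = nats st ''parc'' [k, i, c] \<and>
           0 < nats st R [h, i', c'] \<and> adj i' i \<and> nx i' c' i = c \<and>
           reals st ''B'' [k, i, c] = reals st ''B'' [h, i', c'] + w i' c' i))"

definition relaxed_at :: "name \<Rightarrow> store \<Rightarrow> nat \<times> nat \<times> nat \<times> nat \<Rightarrow> bool" where
  "relaxed_at R st = (\<lambda>(k, i, c, j). 0 < nats st R [k, i, c] \<longrightarrow> adj i j \<longrightarrow> nx i c j < N \<longrightarrow>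
     0 < nats st R [Suc k, j, nx i c j] \<and>
     reals st ''B'' [Suc k, j, nx i c j] \<le> reals st ''B'' [k, i, c] + w i c j)"

text \<open>\<open>origin\<close> gives soundness, \<open>relaxed_at\<close> completeness on the set
  \<open>D\<close> of tuples already relaxed. The bound \<open>h \<le> Suc k\<close> says that the
  writes have not gone beyond the layer after the current one.\<close>

definition table_inv :: "name \<Rightarrow> (nat \<times> nat \<times> nat \<times> nat) set \<Rightarrow> nat \<Rightarrow> store \<Rightarrow> bool" where
  "table_inv R D k st \<longleftrightarrow>
     (\<forall>h i c. 0 < nats st R [h, i, c] \<longrightarrow> h \<le> Suc k \<and> origin R st h i c) \<and>
     0 < nats st R [0, s, 0] \<and> reals st ''B'' [0, s, 0] = 0 \<and> (\<forall>z\<in>D. relaxed_at R st z)"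

lemma table_inv_cong:
  assumes "nats st' R = nats st R" "nats st' ''par'' = nats st ''par''" "nats st' ''parc'' = nats st ''parc''"
    "reals st' ''B'' = reals st ''B''"
  shows "table_inv R D k st' = table_inv R D k st"
  unfolding table_inv_def origin_def relaxed_at_def assms by (rule refl)

text \<open>A write goes to layer \<open>Suc k\<close> and either marks a new entry or lowers an old
  one. Tuples in \<open>D\<close> start in layers up to \<open>k\<close>, so their sources are
  unchanged and their targets at most decrease; they stay relaxed. The leading letter
  \<open>R\<close> of the array name keeps it apart from the names of all other arrays.\<close>

lemma runs_relax:
  assumes enc: "encodes st" and inv: "table_inv (CHR ''R'' # r) D k st"
    and D: "D \<subseteq> {..k} \<times> UNIV"
    and vars: "nats st ''k'' [] = k" "nats st ''i'' [] = i" "nats st ''c'' [] = c" "nats st ''j'' [] = j"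
    and lt: "i < n" "c < N" "j < n"
  shows "runs (relax (CHR ''R'' # r)) st 12 (\<lambda>st'. table_inv (CHR ''R'' # r) (insert (k, i, c, j) D) k st')"
proof -
  let ?R = "CHR ''R'' # r"
  define e where "e = nx i c j"
  define x where "x = reals st ''B'' [k, i, c] + w i c j"
  have nxt: "nats st ''nxt'' [i, c, j] = e" and w: "reals st ''w'' [i, c, j] = w i c j"
    and adj: "0 < nats st ''adj'' [i, j] \<longleftrightarrow> adj i j" and NN: "nats st ''N'' [] = N"
    using enc lt unfolding encodes_def e_def by auto
  have org: "0 < nats st ?R [h, i, c] \<Longrightarrow> h \<le> Suc k \<and> origin ?R st h i c" for h i c
    using inv by (auto simp: table_inv_def)
  have new: "table_inv ?R (insert (k, i, c, j) D) k st'"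
    if nst': "\<And>h i' c'. nats st' ?R [h, i', c'] = (if [h, i', c'] = [Suc k, j, e] then 1 else nats st ?R [h, i', c'])"
      "\<And>h i' c'. nats st' ''par'' [h, i', c'] = (if [h, i', c'] = [Suc k, j, e] then i else nats st ''par'' [h, i', c'])"
      "\<And>h i' c'. nats st' ''parc'' [h, i', c'] = (if [h, i', c'] = [Suc k, j, e] then c else nats st ''parc'' [h, i', c'])"
      "\<And>h i' c'. reals st' ''B'' [h, i', c'] = (if [h, i', c'] = [Suc k, j, e] then x else reals st ''B'' [h, i', c'])"
      and ok: "0 < nats st ?R [k, i, c]" "adj i j" "e < N" "0 < nats st ?R [Suc k, j, e] \<Longrightarrow> x < reals st ''B'' [Suc k, j, e]" for st'
  proof -
    have org': "h \<le> Suc k \<and> origin ?R st' h i' c'" if "0 < nats st' ?R [h, i', c']" for h i' c'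
    proof (cases "[h, i', c'] = [Suc k, j, e]")
      case True
      then show ?thesis
        using lt ok by (auto simp: origin_def nst' x_def e_def)
    next
      case False
      then have "0 < nats st ?R [h, i', c']"
        using that by (simp add: nst' split: if_splits)
      from org[OF this] False show ?thesis
        by (auto simp: origin_def nst' split: nat.splits)
    qed
    have "relaxed_at ?R st' z" if zD: "z \<in> D" for z
    proof -
      obtain k' i' c' j' where z: "z = (k', i', c', j')" "k' \<le> k"
        using D zD by (cases z) auto
      have "relaxed_at ?R st z"
        using inv zD by (auto simp: table_inv_def)
      then show ?thesis
        using z ok(4) by (auto simp: relaxed_at_def nst')
    qed
    moreover have "relaxed_at ?R st' (k, i, c, j)"
      by (simp add: relaxed_at_def nst' x_def e_def)
    ultimately show ?thesis
      using org' inv unfolding table_inv_def by (auto simp: nst')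
  qed
  have cl: "relaxed_at ?R st (k, i, c, j)"
    if "0 < nats st ?R [k, i, c] \<Longrightarrow> adj i j \<Longrightarrow> e < N \<Longrightarrow> 0 < nats st ?R [Suc k, j, e] \<and> \<not> x < reals st ''B'' [Suc k, j, e]"
    using that by (auto simp: relaxed_at_def e_def x_def)
  have old: "table_inv ?R (insert (k, i, c, j) D) k st'"
    if "nats st' ?R = nats st ?R" "nats st' ''par'' = nats st ''par''" "nats st' ''parc'' = nats st ''parc''"
      "reals st' ''B'' = reals st ''B''"
      and "0 < nats st ?R [k, i, c] \<Longrightarrow> adj i j \<Longrightarrow> e < N \<Longrightarrow> 0 < nats st ?R [Suc k, j, e] \<and> \<not> x < reals st ''B'' [Suc k, j, e]" for st'
    using inv cl[OF that(5)] unfolding table_inv_cong[OF that(1-4)] by (simp add: table_inv_def)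
  show ?thesis
    unfolding relax_def
  proof (rule runs_loop_free, goal_cases)
    case 1
    consider "\<not> (0 < nats st ?R [k, i, c] \<and> adj i j \<and> e < N)"
      | "0 < nats st ?R [k, i, c]" "adj i j" "e < N" "0 < nats st ?R [Suc k, j, e]" "\<not> x < reals st ''B'' [Suc k, j, e]"
      | "0 < nats st ?R [k, i, c]" "adj i j" "e < N" "0 < nats st ?R [Suc k, j, e] \<longrightarrow> x < reals st ''B'' [Suc k, j, e]"
      by (cases "0 < nats st ?R [k, i, c] \<and> adj i j \<and> e < N"; cases "0 < nats st ?R [Suc k, j, e] \<longrightarrow> x < reals st ''B'' [Suc k, j, e]") auto
    then show ?case
    proof cases
      case 1
      then show ?thesis
        by (auto simp: vars nxt adj NN intro!: old)
    next
      case 2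
      then show ?thesis
        by (auto simp: vars nxt adj NN w x_def intro!: old)
    next
      case 3
      then show ?thesis
        by (auto simp: vars nxt adj NN w x_def intro!: new)
    qed
  qed simp
qed

lemma encodes_values:
  "encodes st \<Longrightarrow> nats st ''n'' [] = n" "encodes st \<Longrightarrow> nats st ''s'' [] = s"
  "encodes st \<Longrightarrow> nats st ''t'' [] = t" "encodes st \<Longrightarrow> nats st ''N'' [] = N"
  by (simp_all add: encodes_def)

lemma table_inv_set_nat:
  "x \<notin> {R, ''par'', ''parc''} \<Longrightarrow> table_inv R D k (set_nat x v st) = table_inv R D k st"
  by (rule table_inv_cong) auto

lemma table_inv_mono: "table_inv R D k st \<Longrightarrow> D' \<subseteq> D \<Longrightarrow> k \<le> k' \<Longrightarrow> table_inv R D' k' st"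
  unfolding table_inv_def by (meson Suc_le_mono le_trans subsetD)

lemma runs_propagate:
  fixes r
  defines "R \<equiv> CHR ''R'' # r"
  assumes enc: "encodes st" and inv: "table_inv R {} 0 st"
  shows "runs (propagate R) st (28 * (n * (n * (N * n))))
           (table_inv R ({..<n} \<times> {..<n} \<times> {..<N} \<times> {..<n}) n)"
  unfolding propagate_def
proof (rule runs_For[where I = "\<lambda>k. table_inv R ({..<k} \<times> {..<n} \<times> {..<N} \<times> {..<n}) k"
      and T = "24 * (n * (N * n))"], goal_cases)
  case (2 st')
  from encodes_values(1)[OF encodes_same_except[OF 2 enc]] show ?case
    by (simp add: R_def)
next
  case (5 k st1)
  have enc1: "encodes st1"
    using encodes_same_except[OF 5(4) enc] by (simp add: R_def)
  \<comment> \<open>The relaxed tuples form an initial segment in the order of the four loops: all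
    lower layers and a part of layer \<open>k\<close>. The inner loops refine the last block in the
    same way.\<close>
  let ?D = "\<lambda>i. {..<k} \<times> {..<n} \<times> {..<N} \<times> {..<n} \<union> {k} \<times> {..<i} \<times> {..<N} \<times> {..<n}"
  have "runs (For ''i'' (Var ''n'') (For ''c'' (Var ''N'') (For ''j'' (Var ''n'') (relax R)))) st1
     (24 * (n * (N * n))) (table_inv R (?D n) k)"
  proof (rule runs_For[where I = "\<lambda>i. table_inv R (?D i) k" and T = "20 * (N * n)"], goal_cases)
    case (2 st')
    from encodes_values(1)[OF encodes_same_except[OF 2 enc1]] show ?case
      by (simp add: R_def)
  next
    case (5 i st2)
    have enc2: "encodes st2"
      using encodes_same_except[OF 5(4) enc1] by (simp add: R_def)
    have k2: "nats st2 ''k'' [] = k"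
      using same_except_nats[OF 5(4), of "''k''"] \<open>nats st1 ''k'' [] = k\<close> by (simp add: R_def)
    let ?D' = "\<lambda>c. ?D i \<union> {k} \<times> {i} \<times> {..<c} \<times> {..<n}"
    have "runs (For ''c'' (Var ''N'') (For ''j'' (Var ''n'') (relax R))) st2
       (20 * (N * n)) (table_inv R (?D' N) k)"
    proof (rule runs_For[where I = "\<lambda>c. table_inv R (?D' c) k" and T = "16 * (n * 1)"], goal_cases)
      case (2 st')
      from encodes_values(4)[OF encodes_same_except[OF 2 enc2]] show ?case
        by (simp add: R_def)
    next
      case (5 c st3)
      have enc3: "encodes st3"
        using encodes_same_except[OF 5(4) enc2] by (simp add: R_def)
      have k3: "nats st3 ''k'' [] = k" "nats st3 ''i'' [] = i"
        using same_except_nats[OF 5(4), of "''k''"] same_except_nats[OF 5(4), of "''i''"]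
          k2 \<open>nats st2 ''i'' [] = i\<close> by (simp_all add: R_def)
      let ?D'' = "\<lambda>j. ?D' c \<union> {k} \<times> {i} \<times> {c} \<times> {..<j}"
      have "runs (For ''j'' (Var ''n'') (relax R)) st3 (16 * (n * 1)) (table_inv R (?D'' n) k)"
      proof (rule runs_For[where I = "\<lambda>j. table_inv R (?D'' j) k" and T = "12"], goal_cases)
        case (2 st')
        from encodes_values(1)[OF encodes_same_except[OF 2 enc3]] show ?case
          by (simp add: R_def)
      next
        case (5 j st4)
        have enc4: "encodes st4"
          using encodes_same_except[OF 5(4) enc3] by (simp add: R_def)
        have k4: "nats st4 ''k'' [] = k" "nats st4 ''i'' [] = i" "nats st4 ''c'' [] = c"
          using same_except_nats[OF 5(4), of "''k''"] same_except_nats[OF 5(4), of "''i''"]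
            same_except_nats[OF 5(4), of "''c''"] k3 \<open>nats st3 ''c'' [] = c\<close> by (simp_all add: R_def)
        have "runs (relax R) st4 12 (table_inv R (insert (k, i, c, j) (?D'' j)) k)"
          unfolding R_def
          by (rule runs_relax[OF enc4 _ _ k4 5(3) \<open>i < n\<close> \<open>c < N\<close> \<open>j < n\<close>]) (use 5(2) in \<open>auto simp: R_def\<close>)
        then show ?case
          by (rule runs_mono[OF _ order_refl]) (erule table_inv_mono; force simp: less_Suc_eq)
      next
        case 6
        show ?case
          by (rule loop_time[where c = 12]) (use \<open>i < n\<close> in auto)
      qed (use \<open>table_inv R (?D' c) k st3\<close> in \<open>auto simp: R_def table_inv_set_nat\<close>)
      then show ?case
        by (rule runs_mono[OF _ order_refl]) (erule table_inv_mono; force simp: less_Suc_eq)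
    next
      case 6
      show ?case
        by (rule loop_time[where c = 16]) (use \<open>i < n\<close> N in auto)
    qed (use \<open>table_inv R (?D i) k st2\<close> in \<open>auto simp: R_def table_inv_set_nat\<close>)
    then show ?case
      by (rule runs_mono[OF _ order_refl]) (erule table_inv_mono; force simp: less_Suc_eq)
  next
    case 6
    show ?case
      by (rule loop_time[where c = 20]) (use \<open>k < n\<close> N in auto)
  qed (use \<open>table_inv R _ k st1\<close> in \<open>auto simp: R_def table_inv_set_nat\<close>)
  then show ?case
    by (rule runs_mono[OF _ order_refl]) (erule table_inv_mono; force simp: less_Suc_eq)
next
  case 6
  show ?case
    by (rule loop_time[where c = 24]) (use s N in auto)
qed (use inv in \<open>auto simp: R_def table_inv_set_nat\<close>)

text \<open>The bound \<open>h \<le> k\<close> settles ties: a candidate already stored has no more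
  edges than one met in layer \<open>k\<close>.\<close>

definition best_inv :: "(nat \<Rightarrow> nat \<Rightarrow> bool) \<Rightarrow> (nat \<Rightarrow> nat \<Rightarrow> real) \<Rightarrow> (nat \<times> nat) set \<Rightarrow> nat \<Rightarrow> store \<Rightarrow> bool" where
  "best_inv ok val D k st \<longleftrightarrow>
     (nats st ''found'' [] = 0 \<longrightarrow> (\<forall>(h, c)\<in>D. \<not> ok h c)) \<and>
     (0 < nats st ''found'' [] \<longrightarrow>
        (\<exists>h c. nats st ''bk'' [] = h \<and> nats st ''bc'' [] = c \<and> h \<le> k \<and> h < n \<and> c < N \<and> ok h c \<and>
           reals st ''best'' [] = val h c \<and>
           (\<forall>(h', c')\<in>D. ok h' c' \<longrightarrow> val h c < val h' c' \<or> val h c = val h' c' \<and> h \<le> h')))"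

lemma best_inv_set_nat:
  "x \<notin> {''found'', ''bk'', ''bc''} \<Longrightarrow> best_inv ok val D k (set_nat x v st) = best_inv ok val D k st"
  by (auto simp: best_inv_def)

lemma best_inv_mono: "best_inv ok val D k st \<Longrightarrow> D' \<subseteq> D \<Longrightarrow> k \<le> k' \<Longrightarrow> best_inv ok val D' k' st"
  unfolding best_inv_def by (fastforce dest: subsetD)

lemma runs_select:
  fixes r st
  defines "R \<equiv> CHR ''R'' # r"
  defines "ok \<equiv> \<lambda>k c. 0 < nats st R [k, t, c]" and "val \<equiv> \<lambda>k c. reals st ''B'' [k, t, c] + fin c"
  assumes enc: "encodes st" and found: "nats st ''found'' [] = 0"
  shows "runs (select R) st (15 * (n * (N * 1))) (best_inv ok val ({..<n} \<times> {..<N}) n)"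
  unfolding select_def
proof (rule runs_For[where I = "\<lambda>k. best_inv ok val ({..<k} \<times> {..<N}) k" and T = "11 * (N * 1)"], goal_cases)
  case (2 st')
  from encodes_values(1)[OF encodes_same_except[OF 2 enc]] show ?case
    by simp
next
  case (5 k st1)
  have enc1: "encodes st1"
    using encodes_same_except[OF 5(4) enc] by simp
  note fr1 = same_except_nats[OF 5(4)] same_except_reals[OF 5(4)]
  let ?D = "\<lambda>c. {..<k} \<times> {..<N} \<union> {k} \<times> {..<c}"
  let ?body = "Cond (BAnd (NLess (NConst 0) (NCell R [Var ''k'', Var ''t'', Var ''c'']))
               (BNot (BAnd (NLess (NConst 0) (Var ''found''))
                  (BNot (RLess (RAdd (RCell ''B'' [Var ''k'', Var ''t'', Var ''c'']) (RCell ''fin'' [Var ''c'']))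
                               (RCell ''best'' []))))))
          (Seq (NAssign ''found'' [] (NConst 1))
          (Seq (RAssign ''best'' [] (RAdd (RCell ''B'' [Var ''k'', Var ''t'', Var ''c'']) (RCell ''fin'' [Var ''c''])))
          (Seq (NAssign ''bk'' [] (Var ''k''))
               (NAssign ''bc'' [] (Var ''c'')))))
          Skip"
  have "runs (For ''c'' (Var ''N'') ?body) st1 (11 * (N * 1)) (best_inv ok val (?D N) k)"
  proof (rule runs_For[where I = "\<lambda>c. best_inv ok val (?D c) k" and T = 7], goal_cases)
    case (2 st')
    from encodes_values(4)[OF encodes_same_except[OF 2 enc1]] show ?case
      by simp
  next
    case (5 c st2)
    have enc2: "encodes st2"
      using encodes_same_except[OF 5(4) enc1] by simp
    note fr2 = same_except_nats[OF 5(4)] same_except_reals[OF 5(4)]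
    have v: "nats st2 ''k'' [] = k" "nats st2 ''c'' [] = c" "nats st2 ''t'' [] = t"
        "nats st2 R = nats st R" "reals st2 ''B'' = reals st ''B''" "reals st2 ''fin'' [c] = fin c"
      using \<open>nats st1 ''k'' [] = k\<close> \<open>nats st2 ''c'' [] = c\<close> encodes_values(3)[OF enc] enc \<open>c < N\<close>
      by (simp_all add: fr2 fr1 R_def, simp add: encodes_def)
    have *: "?D (Suc c) = insert (k, c) (?D c)"
      by auto
    have inv: "best_inv ok val (?D c) k st2"
      by (rule 5)
    show ?case
      unfolding *
    proof (rule runs_loop_free)
      consider "\<not> ok k c" | "ok k c" "nats st2 ''found'' [] = 0"
        | "ok k c" "0 < nats st2 ''found'' []" "val k c < reals st2 ''best'' []"
        | "ok k c" "0 < nats st2 ''found'' []" "\<not> val k c < reals st2 ''best'' []"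
        by linarith
      then show "loop_free_wp ?body (best_inv ok val (insert (k, c) (?D c)) k) st2"
      proof cases
        case 1
        then have "best_inv ok val (insert (k, c) (?D c)) k st2"
          using inv by (fastforce simp: best_inv_def)
        with 1 show ?thesis
          by (simp add: v ok_def)
      next
        case 2
        with inv \<open>k < n\<close> \<open>c < N\<close> show ?thesis
          by (simp add: v best_inv_def) (fastforce simp: ok_def val_def)
      next
        case 3
        have "val k c < val h' c'" if "(h', c') \<in> ?D c" "ok h' c'" for h' c'
        proof -
          have "reals st2 ''best'' [] \<le> val h' c'"
            using inv 3(2) that unfolding best_inv_def by force
          with 3(3) show ?thesis
            by simp
        qed
        then have "\<forall>(h', c')\<in>insert (k, c) (?D c). ok h' c' \<longrightarrow> val k c < val h' c' \<or> val k c = val h' c' \<and> k \<le> h'"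
          by blast
        with 3 \<open>k < n\<close> \<open>c < N\<close> show ?thesis
          by (simp add: v best_inv_def) (simp add: ok_def val_def)
      next
        case 4
        then have "best_inv ok val (insert (k, c) (?D c)) k st2"
          using inv by (fastforce simp: best_inv_def)
        with 4 show ?thesis
          by (simp add: v ok_def val_def)
      qed
    qed simp
  next
    case 6
    show ?case
      by (rule loop_time[where c = 7]) (use N in auto)
  qed (use 5 in \<open>auto simp: best_inv_set_nat\<close>)
  then show ?case
    by (rule runs_mono[OF _ order_refl]) (erule best_inv_mono; force simp: less_Suc_eq)
next
  case 6
  show ?case
    by (rule loop_time[where c = 11]) (use s N in auto)
qed (use found in \<open>auto simp: best_inv_set_nat best_inv_def\<close>)

primrec trace :: "store \<Rightarrow> nat \<Rightarrow> nat \<Rightarrow> nat \<Rightarrow> nat \<times> nat" where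
  "trace st k c 0 = (t, c)"
| "trace st k c (Suc l) =
     (nats st ''par'' [k - l, fst (trace st k c l), snd (trace st k c l)],
      nats st ''parc'' [k - l, fst (trace st k c l), snd (trace st k c l)])"

lemma runs_backtrack:
  assumes "nats st ''bk'' [] = k" "nats st ''bc'' [] = c" "nats st ''t'' [] = t" "k < n"
  shows "runs backtrack st (13 * (n * 1))
    (\<lambda>st'. nats st' ''len'' [] = Suc k \<and> (\<forall>h\<le>k. nats st' ''path'' [h] = fst (trace st k c (k - h))))"
proof -
  let ?body = "Seq (NAssign ''h'' [] (NSub (Var ''bk'') (Var ''l'')))
         (Seq (NAssign ''path'' [Var ''h''] (Var ''ci''))
         (Seq (NAssign ''e'' [] (NCell ''par'' [Var ''h'', Var ''ci'', Var ''cc'']))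
         (Seq (NAssign ''cc'' [] (NCell ''parc'' [Var ''h'', Var ''ci'', Var ''cc'']))
              (NAssign ''ci'' [] (Var ''e'')))))"
  let ?I = "\<lambda>l st'. (nats st' ''ci'' [], nats st' ''cc'' []) = trace st k c l \<and>
      (\<forall>l'<l. nats st' ''path'' [k - l'] = fst (trace st k c l'))"
  have loop: "runs (For ''l'' (Var ''len'') ?body) st1 (9 * (n * 1))
      (\<lambda>st'. nats st' ''len'' [] = Suc k \<and> (\<forall>h\<le>k. nats st' ''path'' [h] = fst (trace st k c (k - h))))"
    if st1: "nats st1 ''len'' [] = Suc k" "nats st1 ''ci'' [] = t" "nats st1 ''cc'' [] = c" "nats st1 ''bk'' [] = k"
      "nats st1 ''par'' = nats st ''par''" "nats st1 ''parc'' = nats st ''parc''" for st1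
  proof -
    have "runs (For ''l'' (Var ''len'') ?body) st1 (9 * (n * 1)) (?I (Suc k))"
    proof (rule runs_For[where I = ?I and T = 5], goal_cases)
      case (2 st')
      from same_except_nats[OF 2] st1 show ?case
        by simp
    next
      case (5 l st2)
      \<comment> \<open>Truncated subtraction is injective here, so the new entry of the path
        overwrites no earlier one.\<close>
      have *: "k - l' = k - l \<longleftrightarrow> l' = l" if "l' < Suc l" for l'
        using that \<open>l < Suc k\<close> by auto
      have c: "nats st2 ''ci'' [] = fst (trace st k c l)" "nats st2 ''cc'' [] = snd (trace st k c l)"
        using 5(2) by (metis fst_conv, metis snd_conv)
      show ?case
        by (rule runs_loop_free)
           (use 5(2,3) same_except_nats[OF 5(4)] in \<open>auto simp: c * st1 less_Suc_eq\<close>)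
    next
      case 6
      show ?case
        by (rule loop_time[where c = 5]) (use assms in auto)
    qed (use st1 in auto)
    then have "runs (For ''l'' (Var ''len'') ?body) st1 (9 * (n * 1))
      (\<lambda>st'. ?I (Suc k) st' \<and> same_except (nat_writes (For ''l'' (Var ''len'') ?body))
         (real_writes (For ''l'' (Var ''len'') ?body)) st1 st')"
      by (rule runs_frame)
    then show ?thesis
    proof (rule runs_mono[OF _ order_refl], goal_cases)
      case (1 st')
      have "nats st' ''path'' [h] = fst (trace st k c (k - h))" if "h \<le> k" for h
        using 1 that by (metis diff_diff_cancel diff_le_self le_imp_less_Suc)
      with 1 same_except_nats[of _ _ st1 st' "''len''"] st1(1) show ?case
        by auto
    qed
  qed
  have "runs backtrack st (1 + (1 + (1 + 9 * (n * 1))))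
    (\<lambda>st'. nats st' ''len'' [] = Suc k \<and> (\<forall>h\<le>k. nats st' ''path'' [h] = fst (trace st k c (k - h))))"
    unfolding backtrack_def
    by (rule runs_Seq runs_NAssign loop)+ (simp_all add: assms)
  then show ?thesis
    by (rule runs_time) (use s in auto)
qed

text \<open>By \<open>origin\<close>, the parent of a marked entry is marked and one layer lower,
  and layer 0 has only the entry of \<open>s\<close> with state 0. So the parents form a walk from
  \<open>s\<close>, whose weight adds up to the recorded value.\<close>

lemma trace_walk:
  assumes inv: "table_inv R D n st" and reach: "0 < nats st R [k, t, c]"
    and p: "p = (\<lambda>h. fst (trace st k c (k - h)))"
  shows "walk p k" "p k = t" "run p k = c" "total p k = reals st ''B'' [k, t, c]"
proof -
  define q where "q = (\<lambda>h. snd (trace st k c (k - h)))"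
  have org: "0 < nats st R [h, i, c] \<Longrightarrow> origin R st h i c" for h i c
    using inv by (auto simp: table_inv_def)
  have R: "0 < nats st R [k - l, fst (trace st k c l), snd (trace st k c l)]" if "l \<le> k" for l
    using that
  proof (induction l)
    case (Suc l)
    have "k - l = Suc (k - Suc l)"
      using Suc.prems by simp
    with org[OF Suc.IH] Suc.prems show ?case
      by (auto simp: origin_def)
  qed (use reach in simp)
  have R': "0 < nats st R [h, p h, q h]" if "h \<le> k" for h
    using R[of "k - h"] that by (simp add: p q_def)
  have step: "p h = nats st ''par'' [Suc h, p (Suc h), q (Suc h)]" "q h = nats st ''parc'' [Suc h, p (Suc h), q (Suc h)]"
    if "h < k" for h
  proof -
    have "k - h = Suc (k - Suc h)" "k - (k - Suc h) = Suc h"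
      using that by simp_all
    then show "p h = nats st ''par'' [Suc h, p (Suc h), q (Suc h)]"
      "q h = nats st ''parc'' [Suc h, p (Suc h), q (Suc h)]"
      by (simp_all add: p q_def)
  qed
  have edge: "adj (p h) (p (Suc h))" "nx (p h) (q h) (p (Suc h)) = q (Suc h)"
      "reals st ''B'' [Suc h, p (Suc h), q (Suc h)] = reals st ''B'' [h, p h, q h] + w (p h) (q h) (p (Suc h))"
    if "h < k" for h
    using org[OF R'[of "Suc h"]] that by (simp_all add: origin_def step)
  have run: "run p h = q h" "total p h = reals st ''B'' [h, p h, q h]" if "h \<le> k" for h
  proof -
    have "run p h = q h \<and> total p h = reals st ''B'' [h, p h, q h]"
      using that
    proof (induction h)
      case 0
      then show ?case
        using org[OF R'[of 0]] by (auto simp: origin_def total_def)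
    next
      case (Suc h)
      then show ?case
        using edge[of h] by (simp add: total_def)
    qed
    then show "run p h = q h" "total p h = reals st ''B'' [h, p h, q h]"
      by auto
  qed
  have "p h < n" "q h < N" if "h \<le> k" for h
    using org[OF R'[OF that]] by (simp_all add: origin_def)
  moreover have "p 0 = s"
    using org[OF R'[of 0]] by (simp add: origin_def)
  ultimately show "walk p k"
    using edge run by (simp add: walk_def)
  show "p k = t" "run p k = c" "total p k = reals st ''B'' [k, t, c]"
    using run[of k] by (simp_all add: p q_def)
qed

text \<open>The relaxation inequalities telescope along the walk.\<close>

lemma table_complete:
  assumes inv: "table_inv R ({..<n} \<times> {..<n} \<times> {..<N} \<times> {..<n}) n st"
    and "walk p L" "L < n"
  shows "0 < nats st R [L, p L, run p L] \<and> reals st ''B'' [L, p L, run p L] \<le> total p L"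
proof -
  have "0 < nats st R [k, p k, run p k] \<and> reals st ''B'' [k, p k, run p k] \<le> total p k" if "k \<le> L" for k
    using that
  proof (induction k)
    case 0
    then show ?case
      using inv assms(2) by (simp add: table_inv_def walk_def total_def)
  next
    case (Suc k)
    have w: "p k < n" "p (Suc k) < n" "run p k < N" "run p (Suc k) < N" "adj (p k) (p (Suc k))"
      using assms(2) Suc.prems unfolding walk_def by auto
    then have "relaxed_at R st (k, p k, run p k, p (Suc k))"
      using inv Suc.prems assms(3) unfolding table_inv_def by auto
    with w Suc show ?case
      by (auto simp: relaxed_at_def total_def)
  qed
  then show ?thesis
    by simp
qed

text \<open>Tracing back gives a walk with the selected value, and completeness places an entry of
  at most the same value beside every other walk. If there is no walk, \<open>len\<close> must be
  left alone: its initial 0 is then the empty answer.\<close>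

lemma runs_layered:
  fixes r
  defines "R \<equiv> CHR ''R'' # r"
  assumes enc: "encodes st" and fresh: "\<And>h i c. nats st R [h, i, c] = 0"
  shows "runs (layered R) st (64 * (n * (n * (N * n))))
    (\<lambda>st'. if \<exists>q M. st_walk q M
       then \<exists>p L. lex_min p L \<and> 0 < nats st' ''found'' [] \<and> reals st' ''best'' [] = objective p L \<and>
              nats st' ''len'' [] = Suc L \<and> (\<forall>k\<le>L. nats st' ''path'' [k] = p k)
       else nats st' ''found'' [] = 0 \<and> nats st' ''len'' = nats st ''len'')"
    (is "runs _ _ _ ?Q")
proof -
  \<comment> \<open>Five single steps and loops with the constants 28, 15 and 13 make 61, below the
    stated 64.\<close>
  have "runs (layered R) st (1 + (1 + (28 * (n * (n * (N * n))) + (1 + (15 * (n * (N * 1)) + (1 + (13 * (n * 1) + 1))))))) ?Q"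
    unfolding layered_def
  proof (intro runs_Seq runs_NAssign runs_RAssign, goal_cases)
    case 1
    let ?st = "st\<lparr>nats := store_upd (nats st) R [0, s, 0] 1, reals := store_upd (reals st) ''B'' [0, s, 0] 0\<rparr>"
    have e: "st\<lparr>nats := store_upd (nats st) R (map (\<lambda>i. nval i st) [NConst 0, Var ''s'', NConst 0]) (nval (NConst 1) st),
        reals := store_upd (reals (st\<lparr>nats := store_upd (nats st) R (map (\<lambda>i. nval i st) [NConst 0, Var ''s'', NConst 0]) (nval (NConst 1) st)\<rparr>)) ''B''
           (map (\<lambda>i. nval i (st\<lparr>nats := store_upd (nats st) R (map (\<lambda>i. nval i st) [NConst 0, Var ''s'', NConst 0]) (nval (NConst 1) st)\<rparr>))
             [NConst 0, Var ''s'', NConst 0])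
           (rval (RNat (NConst 0)) (st\<lparr>nats := store_upd (nats st) R (map (\<lambda>i. nval i st) [NConst 0, Var ''s'', NConst 0]) (nval (NConst 1) st)\<rparr>))\<rparr> = ?st"
      using encodes_values(2)[OF enc] by (simp add: R_def)
    have enc0: "encodes ?st"
      using enc unfolding encodes_def by (simp add: R_def)
    have inv0: "table_inv R {} 0 ?st"
      using fresh s N by (auto simp: table_inv_def origin_def)
    have "runs (propagate R) ?st (28 * (n * (n * (N * n))))
       (\<lambda>st1. table_inv R ({..<n} \<times> {..<n} \<times> {..<N} \<times> {..<n}) n st1 \<and>
           same_except (nat_writes (propagate R)) (real_writes (propagate R)) ?st st1)"
      using enc0 inv0 unfolding R_def by (intro runs_frame runs_propagate)
    then show ?case
      unfolding e
    proof (rule runs_mono[OF _ order_refl], goal_cases)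
      case (1 st1)
      then have inv: "table_inv R ({..<n} \<times> {..<n} \<times> {..<N} \<times> {..<n}) n st1"
        and fr1: "same_except (nat_writes (propagate R)) (real_writes (propagate R)) ?st st1"
        by auto
      have len1: "nats st1 ''len'' = nats st ''len''"
        using same_except_nats[OF fr1, of "''len''"] by (simp add: R_def)
      let ?st1 = "set_nat ''found'' 0 st1"
      have e1: "st1\<lparr>nats := store_upd (nats st1) ''found'' (map (\<lambda>i. nval i st1) []) (nval (NConst 0) st1)\<rparr> = ?st1"
        by (simp add: set_nat_def)
      have "encodes st1"
        by (rule encodes_same_except[OF fr1 enc0]) (simp_all add: R_def)
      then have enc1: "encodes ?st1"
        by (simp add: encodes_def)
      have inv1: "table_inv R ({..<n} \<times> {..<n} \<times> {..<N} \<times> {..<n}) n ?st1"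
        using inv by (simp add: table_inv_set_nat R_def)
      define ok where "ok = (\<lambda>k c. 0 < nats ?st1 R [k, t, c])"
      define val where "val = (\<lambda>k c. reals ?st1 ''B'' [k, t, c] + fin c)"
      have "runs (select R) ?st1 (15 * (n * (N * 1))) (\<lambda>st2. best_inv ok val ({..<n} \<times> {..<N}) n st2 \<and>
           same_except (nat_writes (select R)) (real_writes (select R)) ?st1 st2)"
        unfolding ok_def val_def R_def by (intro runs_frame runs_select enc1) simp
      then show ?case
        unfolding e1 One_nat_def[symmetric]
      proof (intro runs_Seq runs_NAssign, unfold e1, elim runs_mono[OF _ order_refl], goal_cases)
        case (1 st2)
        then have best: "best_inv ok val ({..<n} \<times> {..<N}) n st2"
          and fr2: "same_except (nat_writes (select R)) (real_writes (select R)) ?st1 st2"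
          by auto
        have len2: "nats st2 ''len'' = nats st ''len''"
          using same_except_nats[OF fr2, of "''len''"] len1 by simp
        have complete: "ok M (run q M) \<and> val M (run q M) \<le> objective q M \<and> run q M < N" if "st_walk q M" for q M
          using table_complete[OF inv1, of q M] that
          by (auto simp: st_walk_def walk_def ok_def val_def objective_def)
        show ?case
        proof (rule runs_Cond)
          assume "bval (NLess (NConst 0) (Var ''found'')) st2"
          then have f: "0 < nats st2 ''found'' []"
            by simp
          then obtain k c where kc: "nats st2 ''bk'' [] = k" "nats st2 ''bc'' [] = c" "k < n" "c < N" "ok k c"
            "reals st2 ''best'' [] = val k c"
            and min: "\<And>h' c'. h' < n \<Longrightarrow> c' < N \<Longrightarrow> ok h' c' \<Longrightarrow> val k c < val h' c' \<or> val k c = val h' c' \<and> k \<le> h'"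
            using best unfolding best_inv_def by auto
          define p where "p = (\<lambda>h. fst (trace ?st1 k c (k - h)))"
          have tr: "trace st2 k c = trace ?st1 k c"
          proof
            show "trace st2 k c l = trace ?st1 k c l" for l
              using same_except_nats[OF fr2, of "''par''"] same_except_nats[OF fr2, of "''parc''"]
              by (induction l) auto
          qed
          note w = trace_walk[OF inv1 _ p_def]
          have p: "st_walk p k" "objective p k = val k c"
            using w kc unfolding ok_def st_walk_def objective_def val_def by auto
          have lm: "lex_min p k"
            unfolding lex_min_def
          proof (intro conjI allI impI p(1))
            fix q M
            assume q: "st_walk q M"
            then have "M < n"
              by (simp add: st_walk_def)
            with min[of M "run q M"] complete[OF q] p(2)
            show "objective p k < objective q M \<or> objective p k = objective q M \<and> k \<le> M"
              by auto
          qed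
          have t2: "nats st2 ''t'' [] = t"
            using encodes_values(3)[OF enc1] same_except_nats[OF fr2, of "''t''"] by simp
          have "runs backtrack st2 (13 * (n * 1)) (\<lambda>st'. (nats st' ''len'' [] = Suc k \<and>
              (\<forall>h\<le>k. nats st' ''path'' [h] = fst (trace st2 k c (k - h)))) \<and>
              same_except (nat_writes backtrack) (real_writes backtrack) st2 st')"
            by (intro runs_frame runs_backtrack kc t2)
          then show "runs backtrack st2 (13 * (n * 1)) ?Q"
          proof (rule runs_mono[OF _ order_refl], goal_cases)
            case (1 st3)
            have "nats st3 ''found'' = nats st2 ''found''" "reals st3 ''best'' = reals st2 ''best''"
              using 1 same_except_nats[of _ _ st2 st3 "''found''"] same_except_reals[of _ _ st2 st3 "''best''"] by auto
            moreover have "\<exists>q M. st_walk q M"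
              using p by blast
            ultimately show ?case
              using 1 lm f kc p by (auto simp: tr p_def)
          qed
        next
          assume "\<not> bval (NLess (NConst 0) (Var ''found'')) st2"
          then have f: "nats st2 ''found'' [] = 0"
            by simp
          with best have "\<not> ok h c" if "h < n" "c < N" for h c
            using that unfolding best_inv_def by auto
          with complete have "\<not> (\<exists>q M. st_walk q M)"
            unfolding st_walk_def by blast
          with f len2 show "runs Skip st2 1 ?Q"
            by (intro runs_Skip) auto
        qed
      qed
    qed
  qed
  moreover have "1 \<le> n * (n * (N * n))"
    using s N by (simp add: Suc_le_eq)
  moreover have "n * N \<le> n * (n * (N * n))" "n \<le> n * (n * (N * n))"
    using s N by (simp_all add: Suc_le_eq)
  ultimately show ?thesis
    by (elim runs_time) linarith
qed

section \<open>Removing a cycle from a walk\<close>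

definition cut :: "nat \<Rightarrow> nat \<Rightarrow> (nat \<Rightarrow> nat) \<Rightarrow> nat \<Rightarrow> nat" where
  "cut i j q k = (if k \<le> i then q k else q (k + (j - i)))"

lemma st_walk_cut:
  assumes "st_walk q M" "i < j" "j \<le> M" "q i = q j"
    and "\<And>k. k \<le> M - (j - i) \<Longrightarrow> run (cut i j q) k < N"
  shows "st_walk (cut i j q) (M - (j - i))"
proof -
  have q: "q 0 = s" "\<And>k. k \<le> M \<Longrightarrow> q k < n" "\<And>k. k < M \<Longrightarrow> adj (q k) (q (Suc k))" "q M = t" "M < n"
    using assms(1) by (auto simp: st_walk_def walk_def)
  have "adj (cut i j q k) (cut i j q (Suc k))" if "k < M - (j - i)" for k
  proof (cases "k = i")
    \<comment> \<open>At the seam the edge leaves \<open>q i = q j\<close>, so it is the edge of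
      \<open>q\<close> at position \<open>j\<close>.\<close>
    case True
    then show ?thesis
      using that q(3)[of j] assms(2-4) by (simp add: cut_def)
  next
    case False
    then show ?thesis
      using that q(3)[of k] q(3)[of "k + (j - i)"] assms(2,3) by (auto simp: cut_def)
  qed
  moreover have "cut i j q (M - (j - i)) = t"
    using q(4) assms(2-4) by (cases "j = M") (auto simp: cut_def)
  ultimately show ?thesis
    using q assms(2,3,5) by (auto simp: st_walk_def walk_def cut_def)
qed

text \<open>The two hypotheses on \<open>cut\<close> are isolated because they hold for different
  reasons in the two searches: nonnegative weights in one, growing vectors in the other.\<close>

lemma lex_min_inj_on:
  assumes "lex_min p L"
    and run: "\<And>q M i j k. st_walk q M \<Longrightarrow> i < j \<Longrightarrow> j \<le> M \<Longrightarrow> q i = q j \<Longrightarrow> k \<le> M - (j - i) \<Longrightarrow>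
        run (cut i j q) k < N"
    and obj: "\<And>q M i j. st_walk q M \<Longrightarrow> i < j \<Longrightarrow> j \<le> M \<Longrightarrow> q i = q j \<Longrightarrow>
        objective (cut i j q) (M - (j - i)) \<le> objective q M"
  shows "inj_on p {..L}"
proof (rule ccontr)
  assume "\<not> inj_on p {..L}"
  then obtain i j where ij: "i < j" "j \<le> L" "p i = p j"
    by (auto simp: inj_on_def) (metis linorder_neqE_nat)
  have "st_walk p L"
    using assms(1) by (simp add: lex_min_def)
  from st_walk_cut[OF this ij run[OF this ij]] obj[OF this ij] assms(1) ij show False
    unfolding lex_min_def by force
qed

end

section \<open>Vectors as numbers and the search over rounded lengths\<close>

definition digit :: "nat \<Rightarrow> nat \<Rightarrow> nat \<Rightarrow> nat" where
  "digit B c a = c div B ^ a mod B"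

lemma digit_sum:
  assumes "\<And>b. b < m \<Longrightarrow> f b < B"
  shows "(\<Sum>b<m. f b * B ^ b) < B ^ m" and "a < m \<Longrightarrow> digit B (\<Sum>b<m. f b * B ^ b) a = f a"
proof -
  have "(\<Sum>b<m. f b * B ^ b) < B ^ m \<and> (\<forall>a<m. digit B (\<Sum>b<m. f b * B ^ b) a = f a)"
    using assms
  proof (induction m)
    case (Suc m)
    let ?s = "\<Sum>b<m. f b * B ^ b"
    have IH: "?s < B ^ m" "\<And>a. a < m \<Longrightarrow> digit B ?s a = f a" and fm: "f m < B"
      using Suc by auto
    have "?s + f m * B ^ m < (f m + 1) * B ^ m"
      using IH(1) by simp
    also have "\<dots> \<le> B * B ^ m"
      using fm by (intro mult_le_mono1) simp
    finally have lt: "?s + f m * B ^ m < B ^ Suc m"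
      by simp
    have "digit B (?s + f m * B ^ m) a = f a" if "a < Suc m" for a
    proof (cases "a = m")
      case True
      then show ?thesis
        using IH(1) fm by (simp add: digit_def)
    next
      case False
      then have a: "a < m"
        using that by simp
      \<comment> \<open>The top term is \<open>B ^ a\<close> times a multiple of \<open>B\<close>,
        so it disappears from the digit at \<open>a\<close> after division and remainder.\<close>
      have eq: "f m * B ^ m = B ^ a * (B * (f m * B ^ (m - Suc a)))"
      proof -
        have "B ^ m = B ^ (a + 1 + (m - Suc a))"
          using a by simp
        then show ?thesis
          by (simp only: power_add) simp
      qed
      have "B ^ a \<noteq> 0"
        using fm by simp
      then have "(?s + f m * B ^ m) div B ^ a = ?s div B ^ a + B * (f m * B ^ (m - Suc a))"
        unfolding eq by (subst div_mult_self2) (simp_all only: not_False_eq_True add.commute)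
      then show ?thesis
        using IH(2)[OF a] by (simp add: digit_def)
    qed
    with lt show ?case
      by simp
  qed simp
  then show "(\<Sum>b<m. f b * B ^ b) < B ^ m" "a < m \<Longrightarrow> digit B (\<Sum>b<m. f b * B ^ b) a = f a"
    by auto
qed

text \<open>A recursion with start value 0, so that it is itself the invariant of the loops that
  compute maxima.\<close>

primrec max_upto :: "(nat \<Rightarrow> nat) \<Rightarrow> nat \<Rightarrow> nat" where
  "max_upto f 0 = 0"
| "max_upto f (Suc m) = max (max_upto f m) (f m)"

lemma max_upto_ge: "a < m \<Longrightarrow> f a \<le> max_upto f m"
  by (induction m) (auto simp: less_Suc_eq max_def)

lemma max_upto_attained: "0 < m \<Longrightarrow> \<exists>a<m. max_upto f m = f a"
proof (induction m)
  case (Suc m)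
  then show ?case
    by (cases "m = 0") (auto simp: max_def less_Suc_eq)
qed simp

lemma max_upto_le: "(\<And>a. a < m \<Longrightarrow> f a \<le> u) \<Longrightarrow> max_upto f m \<le> u"
  by (induction m) auto

text \<open>A state \<open>c < B ^ \<sigma>\<close> at vertex \<open>i\<close> has as its \<open>a\<close>-th digit the largest rounded length of the walk
  so far over all choices of positions that end in position \<open>a\<close> of \<open>i\<close>.\<close>

locale rounded_graph =
  fixes n s t :: nat and adj :: "nat \<Rightarrow> nat \<Rightarrow> bool" and B \<sigma> :: nat
    and m :: "nat \<Rightarrow> nat" and rd :: "nat \<Rightarrow> nat \<Rightarrow> nat \<Rightarrow> nat \<Rightarrow> nat"
  assumes s': "s < n" and t': "t < n" and B: "0 < B" and m: "\<And>i. i < n \<Longrightarrow> 0 < m i \<and> m i \<le> \<sigma>"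
begin

definition mx :: "nat \<Rightarrow> nat \<Rightarrow> nat \<Rightarrow> nat \<Rightarrow> nat" where
  "mx i c j b = max_upto (\<lambda>a. digit B c a + rd i a j b) (m i)"

text \<open>A single overflowing entry pushes the sum to \<open>B ^ \<sigma>\<close> or more, outside the range of valid states.\<close>

definition next_state :: "nat \<Rightarrow> nat \<Rightarrow> nat \<Rightarrow> nat" where
  "next_state i c j = (\<Sum>b<m j. if mx i c j b < B then mx i c j b * B ^ b else B ^ \<sigma>)"

text \<open>The whole cost sits in the state: edges are free and a state at the destination is worth
  its largest digit.\<close>

sublocale layered_graph n s t adj "B ^ \<sigma>" next_state "\<lambda>_ _ _. 0" "\<lambda>c. real (max_upto (digit B c) (m t))"
  by unfold_locales (use s' t' B in auto)

lemma next_state_valid_iff: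
  assumes "j < n"
  shows "next_state i c j < B ^ \<sigma> \<longleftrightarrow> (\<forall>b<m j. mx i c j b < B)"
proof
  assume lt: "next_state i c j < B ^ \<sigma>"
  show "\<forall>b<m j. mx i c j b < B"
  proof (rule ccontr)
    assume "\<not> (\<forall>b<m j. mx i c j b < B)"
    then obtain b where b: "b < m j" "\<not> mx i c j b < B"
      by blast
    then have "B ^ \<sigma> = (if mx i c j b < B then mx i c j b * B ^ b else B ^ \<sigma>)"
      by simp
    also have "\<dots> \<le> next_state i c j"
      unfolding next_state_def using b(1) by (intro member_le_sum) auto
    finally show False
      using lt by simp
  qed
next
  assume *: "\<forall>b<m j. mx i c j b < B"
  then have "next_state i c j = (\<Sum>b<m j. mx i c j b * B ^ b)"
    by (simp add: next_state_def)
  also have "\<dots> < B ^ m j"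
    using * by (intro digit_sum) auto
  also have "\<dots> \<le> B ^ \<sigma>"
    using m[OF assms] B by (intro power_increasing) auto
  finally show "next_state i c j < B ^ \<sigma>" .
qed

lemma digit_next_state:
  assumes "j < n" "next_state i c j < B ^ \<sigma>" "b < m j"
  shows "digit B (next_state i c j) b = mx i c j b" "mx i c j b < B"
proof -
  have *: "\<forall>b<m j. mx i c j b < B"
    using assms next_state_valid_iff by blast
  then have "next_state i c j = (\<Sum>b<m j. mx i c j b * B ^ b)"
    by (simp add: next_state_def)
  then show "digit B (next_state i c j) b = mx i c j b" "mx i c j b < B"
    using digit_sum(2)[of "m j" "mx i c j" B b] * assms(3) by auto
qed

lemma digit_run_Suc:
  assumes "walk p L" "k < L" "b < m (p (Suc k))"
  shows "digit B (run p (Suc k)) b = mx (p k) (run p k) (p (Suc k)) b"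
proof -
  have "p (Suc k) < n" "run p (Suc k) < B ^ \<sigma>"
    using assms(1,2) by (auto simp: walk_def simp del: run.simps)
  then show ?thesis
    using digit_next_state(1)[OF _ _ assms(3)] by simp
qed

text \<open>Indexed by places of the walk and not by vertices: a repeated vertex may use several of
  its positions. Only for injective walks does a choice come from a scenario.\<close>

definition choice :: "(nat \<Rightarrow> nat) \<Rightarrow> nat \<Rightarrow> (nat \<Rightarrow> nat) \<Rightarrow> bool" where
  "choice p L x \<longleftrightarrow> (\<forall>k\<le>L. x k < m (p k))"

definition rounded_length :: "(nat \<Rightarrow> nat) \<Rightarrow> nat \<Rightarrow> (nat \<Rightarrow> nat) \<Rightarrow> nat" where
  "rounded_length p L x = (\<Sum>k<L. rd (p k) (x k) (p (Suc k)) (x (Suc k)))"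

lemma rounded_length_le_digit:
  assumes "walk p L" "choice p L x" "k \<le> L"
  shows "rounded_length p k x \<le> digit B (run p k) (x k)"
  using assms(3)
proof (induction k)
  case (Suc k)
  have x: "x k < m (p k)" "x (Suc k) < m (p (Suc k))"
    using assms(2) Suc.prems by (auto simp: choice_def)
  have "rounded_length p (Suc k) x \<le> digit B (run p k) (x k) + rd (p k) (x k) (p (Suc k)) (x (Suc k))"
    using Suc by (simp add: rounded_length_def)
  also have "\<dots> \<le> mx (p k) (run p k) (p (Suc k)) (x (Suc k))"
    unfolding mx_def using max_upto_ge[OF x(1), of "\<lambda>a. digit B (run p k) a + rd (p k) a (p (Suc k)) (x (Suc k))"] by simp
  also have "\<dots> = digit B (run p (Suc k)) (x (Suc k))"
    using digit_run_Suc[OF assms(1) _ x(2)] Suc.prems by simp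
  finally show ?case .
qed (simp add: rounded_length_def)

lemma digit_lt: "digit B c a < B"
  using B by (simp add: digit_def)

lemma rounded_length_le_objective:
  assumes "st_walk p L" "choice p L x"
  shows "rounded_length p L x \<le> objective p L" "rounded_length p L x < B"
proof -
  have w: "walk p L" and "p L = t"
    using assms(1) by (auto simp: st_walk_def)
  then have "x L < m t"
    using assms(2) by (auto simp: choice_def)
  from rounded_length_le_digit[OF w assms(2) order_refl] max_upto_ge[OF this, of "digit B (run p L)"]
  show "rounded_length p L x \<le> objective p L"
    by (simp add: objective_def total_def)
  show "rounded_length p L x < B"
    using rounded_length_le_digit[OF w assms(2) order_refl] digit_lt le_less_trans by blast
qed

lemma rounded_length_cong:
  "(\<And>k. k \<le> L \<Longrightarrow> x k = y k) \<Longrightarrow> rounded_length p L x = rounded_length p L y"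
  by (simp add: rounded_length_def)

lemma rounded_length_mono: "k \<le> L \<Longrightarrow> rounded_length p k x \<le> rounded_length p L x"
  unfolding rounded_length_def by (intro sum_mono2) auto

text \<open>Every digit is attained by a choice along the prefix, because each maximum in the
  recursion is attained. If all choices stay below \<open>B\<close>, then so does every digit, no
  state overflows, and the largest final digit is the length of a choice.\<close>

lemma st_walk_if_short:
  assumes p: "p 0 = s" "\<And>k. k \<le> L \<Longrightarrow> p k < n" "\<And>k. k < L \<Longrightarrow> adj (p k) (p (Suc k))" "p L = t" "L < n"
    and short: "\<And>x. choice p L x \<Longrightarrow> rounded_length p L x < B"
  shows "st_walk p L" and "\<exists>x. choice p L x \<and> objective p L = rounded_length p L x"
proof -
  have short': "rounded_length p k x < B" if "choice p k x" "k \<le> L" for k x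
  proof -
    \<comment> \<open>Position 0 exists at every vertex and completes a choice on the prefix; the
      rounded length can only grow beyond the prefix.\<close>
    let ?y = "\<lambda>h. if h \<le> k then x h else 0"
    have "choice p L ?y"
      using that p(2) m by (auto simp: choice_def)
    from short[OF this] rounded_length_mono[OF that(2), of p ?y]
    show ?thesis
      using rounded_length_cong[of k x ?y p] by simp
  qed
  have main: "run p k < B ^ \<sigma> \<and> (\<forall>b<m (p k). \<exists>x. choice p k x \<and> x k = b \<and> rounded_length p k x = digit B (run p k) b)"
    if "k \<le> L" for k
    using that
  proof (induction k)
    case 0
    have "\<exists>x. choice p 0 x \<and> x 0 = b \<and> rounded_length p 0 x = digit B (run p 0) b" if "b < m (p 0)" for b
      using that by (intro exI[of _ "\<lambda>_. b"]) (simp add: choice_def rounded_length_def digit_def)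
    then show ?case
      using B by simp
  next
    case (Suc k)
    have pk: "p k < n" "p (Suc k) < n"
      using p(2) Suc.prems by auto
    have ex: "\<exists>x. choice p (Suc k) x \<and> x (Suc k) = b \<and> rounded_length p (Suc k) x = mx (p k) (run p k) (p (Suc k)) b"
      if b: "b < m (p (Suc k))" for b
    proof -
      obtain a where a: "a < m (p k)" "mx (p k) (run p k) (p (Suc k)) b = digit B (run p k) a + rd (p k) a (p (Suc k)) b"
        unfolding mx_def using max_upto_attained[of "m (p k)"] m[OF pk(1)] by blast
      then obtain x where x: "choice p k x" "x k = a" "rounded_length p k x = digit B (run p k) a"
        using Suc by auto
      let ?y = "x(Suc k := b)"
      have "choice p (Suc k) ?y"
        using x(1) b by (auto simp: choice_def)
      moreover have "rounded_length p (Suc k) ?y = rounded_length p k ?y + rd (p k) a (p (Suc k)) b"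
        using x(2) by (simp add: rounded_length_def)
      moreover have "rounded_length p k ?y = rounded_length p k x"
        by (rule rounded_length_cong) simp
      ultimately show ?thesis
        using a x(3) by (intro exI[of _ ?y]) simp
    qed
    have "mx (p k) (run p k) (p (Suc k)) b < B" if "b < m (p (Suc k))" for b
      using ex[OF that] short'[OF _ Suc.prems] by metis
    then have valid: "run p (Suc k) < B ^ \<sigma>"
      using next_state_valid_iff[OF pk(2)] by simp
    with ex digit_next_state(1)[OF pk(2), of "p k" "run p k"] show ?case
      by simp
  qed
  then show st: "st_walk p L"
    using p by (simp add: st_walk_def walk_def)
  obtain a where a: "a < m t" "max_upto (digit B (run p L)) (m t) = digit B (run p L) a"
    using max_upto_attained m[OF t'] by blast
  then obtain x where "choice p L x" "rounded_length p L x = digit B (run p L) a"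
    using main[of L] p(4) by auto
  then show "\<exists>x. choice p L x \<and> objective p L = rounded_length p L x"
    using a by (auto simp: objective_def total_def)
qed

text \<open>An entry at the next vertex is a maximum over all previous entries with something
  nonnegative added. One step therefore lifts every entry above every earlier one, even for
  unrelated positions \<open>a\<close> and \<open>b\<close>; this is what makes cycles
  removable.\<close>

lemma digit_run_mono:
  assumes "walk p L" "j \<le> L" "i < j" "a < m (p i)" "b < m (p j)"
  shows "digit B (run p i) a \<le> digit B (run p j) b"
  using assms(2,3,5)
proof (induction j arbitrary: b)
  case (Suc j)
  have step: "digit B (run p j) a' \<le> digit B (run p (Suc j)) b" if "a' < m (p j)" for a'
    using max_upto_ge[OF that, of "\<lambda>a. digit B (run p j) a + rd (p j) a (p (Suc j)) b"]
      digit_run_Suc[OF assms(1) _ Suc.prems(3)] Suc.prems(1) unfolding mx_def by simp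
  show ?case
  proof (cases "i = j")
    case True
    then show ?thesis
      using step[of a] assms(4) by simp
  next
    case False
    \<comment> \<open>Position 0 of the intermediate vertex links the two inequalities.\<close>
    have "0 < m (p j)"
      using m[of "p j"] assms(1) Suc.prems(1) by (auto simp: walk_def)
    with Suc.IH[of 0] step[of 0] False Suc.prems show ?thesis
      by simp
  qed
qed simp

text \<open>When the walk returns to a vertex, the vector of its first visit is dominated entry by
  entry by that of the second. The update is monotone in the vector, so the domination persists
  behind the seam, and digits bounded by valid digits cannot overflow.\<close>

lemma cut_run:
  assumes "st_walk q M" "i < j" "j \<le> M" "q i = q j"
  shows "k \<le> M - (j - i) \<Longrightarrow> run (cut i j q) k < B ^ \<sigma>"
    and "objective (cut i j q) (M - (j - i)) \<le> objective q M"
proof -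
  let ?p = "cut i j q"
  have w: "walk q M" and qM: "q M = t"
    using assms(1) by (auto simp: st_walk_def)
  have eq: "run ?p k = run q k" if "k \<le> i" for k
    using that by (induction k) (auto simp: cut_def)
  have shift: "?p (i + d) = q (j + d)" for d
    using assms(2,4) by (cases "d = 0") (auto simp: cut_def add.commute)
  have qn: "q k < n" "run q k < B ^ \<sigma>" if "k \<le> M" for k
    using w that by (auto simp: walk_def)
  have late: "run ?p (i + d) < B ^ \<sigma> \<and>
      (\<forall>a<m (q (j + d)). digit B (run ?p (i + d)) a \<le> digit B (run q (j + d)) a)" if "j + d \<le> M" for d
    using that
  proof (induction d)
    case 0
    then show ?case
      using eq[of i] qn[of i] digit_run_mono[OF w assms(3,2)] assms by auto
  next
    case (Suc d)
    have IH: "run ?p (i + d) < B ^ \<sigma>"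
      "\<And>a. a < m (q (j + d)) \<Longrightarrow> digit B (run ?p (i + d)) a \<le> digit B (run q (j + d)) a"
      using Suc by auto
    have qS: "q (Suc (j + d)) < n"
      using qn Suc.prems by simp
    have pS: "?p (Suc (i + d)) = q (Suc (j + d))"
      using shift[of "Suc d"] by simp
    have le: "mx (q (j + d)) (run ?p (i + d)) (q (Suc (j + d))) b \<le> digit B (run q (Suc (j + d))) b"
      if b: "b < m (q (Suc (j + d)))" for b
      unfolding mx_def
    proof (rule max_upto_le)
      fix a
      assume a: "a < m (q (j + d))"
      have "digit B (run q (j + d)) a + rd (q (j + d)) a (q (Suc (j + d))) b \<le> digit B (run q (Suc (j + d))) b"
        using digit_run_Suc[OF w _ b] Suc.prems
          max_upto_ge[OF a, of "\<lambda>a. digit B (run q (j + d)) a + rd (q (j + d)) a (q (Suc (j + d))) b"]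
        by (simp add: mx_def)
      with IH(2)[OF a] show "digit B (run ?p (i + d)) a + rd (q (j + d)) a (q (Suc (j + d))) b
          \<le> digit B (run q (Suc (j + d))) b"
        by simp
    qed
    then have "next_state (q (j + d)) (run ?p (i + d)) (q (Suc (j + d))) < B ^ \<sigma>"
      using next_state_valid_iff[OF qS] digit_lt le_less_trans by blast
    with digit_next_state(1)[OF qS this] le show ?case
      by (simp add: shift pS)
  qed
  show "run ?p k < B ^ \<sigma>" if "k \<le> M - (j - i)"
  proof (cases "k \<le> i")
    case True
    then show ?thesis
      using eq qn assms(2,3) by simp
  next
    case False
    then show ?thesis
      using late[of "k - i"] that assms(2,3) by simp
  qed
  have "M - (j - i) = i + (M - j)"
    using assms(2,3) by simp
  with late[of "M - j"] qM assms(3)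
  have "digit B (run ?p (M - (j - i))) a \<le> max_upto (digit B (run q M)) (m t)" if "a < m t" for a
    using max_upto_ge[OF that, of "digit B (run q M)"] that by (fastforce intro: order_trans)
  then show "objective ?p (M - (j - i)) \<le> objective q M"
    by (simp add: objective_def total_def max_upto_le)
qed

lemma lex_min_inj: "lex_min p L \<Longrightarrow> inj_on p {..L}"
  by (rule lex_min_inj_on[OF _ cut_run])

end

section \<open>Shortest walks for fixed edge weights\<close>

locale weighted_graph =
  fixes n s t :: nat and adj :: "nat \<Rightarrow> nat \<Rightarrow> bool" and wt :: "nat \<Rightarrow> nat \<Rightarrow> real"
  assumes s': "s < n" and t': "t < n" and wt: "\<And>i j. i < n \<Longrightarrow> j < n \<Longrightarrow> 0 \<le> wt i j"
begin

sublocale layered_graph n s t adj "Suc 0" "\<lambda>_ _ _. 0" "\<lambda>i _ j. wt i j" "\<lambda>_. 0"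
  by unfold_locales (use s' t' in auto)

lemma run_eq_0 [simp]: "run p k = 0"
  by (cases k) auto

lemma objective_eq: "objective p L = (\<Sum>k<L. wt (p k) (p (Suc k)))"
  by (simp add: objective_def total_def)

lemma st_walk_iff:
  "st_walk p L \<longleftrightarrow> p 0 = s \<and> (\<forall>k\<le>L. p k < n) \<and> (\<forall>k<L. adj (p k) (p (Suc k))) \<and> p L = t \<and> L < n"
  by (auto simp: st_walk_def walk_def)

lemma objective_cut:
  assumes "st_walk q M" "i < j" "j \<le> M" "q i = q j"
  shows "objective (cut i j q) (M - (j - i)) \<le> objective q M"
proof -
  \<comment> \<open>The index in \<open>q\<close> of the \<open>k\<close>-th remaining edge. The
    comparison is strict, unlike in \<open>cut\<close>, since the edge at \<open>k = i\<close> is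
    the one that leaves \<open>q j\<close>.\<close>
  let ?f = "\<lambda>k. if k < i then k else k + (j - i)"
  have "objective (cut i j q) (M - (j - i)) = (\<Sum>k<M - (j - i). wt (q (?f k)) (q (Suc (?f k))))"
    unfolding objective_eq using assms(2,4) by (intro sum.cong refl) (auto simp: cut_def not_less le_less)
  also have "\<dots> = (\<Sum>k\<in>?f ` {..<M - (j - i)}. wt (q k) (q (Suc k)))"
    by (subst sum.reindex) (auto simp: inj_on_def split: if_splits)
  also have "\<dots> \<le> (\<Sum>k<M. wt (q k) (q (Suc k)))"
    using assms(1-3) wt by (intro sum_mono2) (auto simp: st_walk_iff)
  finally show ?thesis
    by (simp add: objective_eq)
qed

lemma lex_min_inj: "lex_min p L \<Longrightarrow> inj_on p {..L}"
  by (rule lex_min_inj_on[OF _ _ objective_cut]) auto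

end

subsection \<open>The approximation guarantees\<close>

locale rsp =
  fixes I :: "'m robust_sp" and pt :: "nat \<Rightarrow> nat \<Rightarrow> 'm" and \<epsilon> :: real
  assumes wf: "wf_instance I" and enum: "enumerates I pt" and eps: "0 < \<epsilon>"
begin

abbreviation n where "n \<equiv> nverts I"
abbreviation s where "s \<equiv> src I"
abbreviation t where "t \<equiv> dst I"
abbreviation \<sigma> where "\<sigma> \<equiv> max_positions I"
abbreviation adj where "adj i j \<equiv> {i, j} \<in> edges I"
abbreviation m where "m i \<equiv> card (positions I i)"
abbreviation d where "d i a j b \<equiv> mdist (ambient I) (pt i a) (pt j b)"

lemma s: "s < n" and t: "t < n"
  using wf by (auto simp: wf_instance_def)

lemma m: "i < n \<Longrightarrow> 0 < m i" "i < n \<Longrightarrow> m i \<le> \<sigma>"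
proof -
  assume i: "i < n"
  then show "0 < m i"
    using wf by (auto simp: wf_instance_def card_gt_0_iff)
  show "m i \<le> \<sigma>"
    unfolding max_positions_def using i by (intro Max_ge) auto
qed

text \<open>Paths in the form that the search produces; \<open>vertices\<close> translates them into
  the lists of the problem.\<close>

definition simple :: "(nat \<Rightarrow> nat) \<Rightarrow> nat \<Rightarrow> bool" where
  "simple p L \<longleftrightarrow> p 0 = s \<and> (\<forall>k\<le>L. p k < n) \<and> (\<forall>k<L. adj (p k) (p (Suc k))) \<and> p L = t \<and> inj_on p {..L}"

definition vertices :: "(nat \<Rightarrow> nat) \<Rightarrow> nat \<Rightarrow> nat list" where
  "vertices p L = map p [0..<Suc L]"

lemma length_vertices [simp]: "length (vertices p L) = Suc L"
  and nth_vertices [simp]: "k \<le> L \<Longrightarrow> vertices p L ! k = p k"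
  by (simp_all add: vertices_def del: upt_Suc)

lemma simple_length: "simple p L \<Longrightarrow> L < n"
  using card_inj_on_le[of p "{..L}" "{..<n}"] by (auto simp: simple_def image_subset_iff)

lemma st_path_vertices: "simple p L \<Longrightarrow> st_path I (vertices p L)"
proof -
  assume p: "simple p L"
  have "hd (vertices p L) = s" "last (vertices p L) = t"
    using p hd_conv_nth[of "vertices p L"] last_conv_nth[of "vertices p L"] length_vertices[of p L]
    by (auto simp: simple_def simp flip: length_greater_0_conv)
  moreover have "set (vertices p L) \<subseteq> {..<n}"
    using p by (auto simp: vertices_def simple_def simp del: upt_Suc)
  moreover have "distinct (vertices p L)"
    using p by (auto simp: vertices_def simple_def distinct_map atLeast0_lessThan_Suc
        atLeast0LessThan lessThan_Suc_atMost simp del: upt_Suc)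
  ultimately show ?thesis
    using p by (auto simp: st_path_def simple_def vertices_def simp del: upt_Suc)
qed

lemma st_path_obtain:
  assumes "st_path I P"
  obtains p L where "simple p L" "P = vertices p L"
proof
  define L where "L = length P - 1"
  have P: "P \<noteq> []" "hd P = s" "last P = t" "set P \<subseteq> {..<n}" "distinct P"
    "\<And>k. Suc k < length P \<Longrightarrow> {P ! k, P ! Suc k} \<in> edges I"
    using assms by (auto simp: st_path_def)
  have len: "length P = Suc L"
    using P(1) by (simp add: L_def)
  show "simple ((!) P) L"
    unfolding simple_def
  proof (intro conjI allI impI)
    show "P ! 0 = s" "P ! L = t"
      using P by (simp_all add: hd_conv_nth last_conv_nth L_def)
    show "P ! k < n" if "k \<le> L" for k
      using P(4) len that by (metis le_imp_less_Suc lessThan_iff nth_mem subsetD)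
    show "inj_on ((!) P) {..L}"
      using P(5) len by (auto simp: inj_on_def nth_eq_iff_index_eq)
  qed (use P(6) len in auto)
  show "P = vertices ((!) P) L"
    using len by (metis map_nth vertices_def)
qed

definition choice :: "(nat \<Rightarrow> nat) \<Rightarrow> nat \<Rightarrow> (nat \<Rightarrow> nat) \<Rightarrow> bool" where
  "choice p L x \<longleftrightarrow> (\<forall>k\<le>L. x k < m (p k))"

definition real_length :: "(nat \<Rightarrow> nat) \<Rightarrow> nat \<Rightarrow> (nat \<Rightarrow> nat) \<Rightarrow> real" where
  "real_length p L x = (\<Sum>k<L. d (p k) (x k) (p (Suc k)) (x (Suc k)))"

lemma path_length_vertices:
  "path_length I u (vertices p L) = (\<Sum>k<L. mdist (ambient I) (u (p k)) (u (p (Suc k))))"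
  by (simp add: path_length_def)

lemma pt_bij: "i < n \<Longrightarrow> bij_betw (pt i) {..<m i} (positions I i)"
  using enum by (auto simp: enumerates_def)

text \<open>A simple path meets each vertex once, so a choice of positions along it extends to a
  scenario. Together with \<open>cost_attained\<close> this replaces scenarios by choices.\<close>

lemma real_length_le_cost:
  assumes "simple p L" "choice p L x"
  shows "real_length p L x \<le> cost I (vertices p L)"
proof -
  \<comment> \<open>The inverse of \<open>p\<close> recovers the place of a vertex on the path;
    vertices off the path take position 0.\<close>
  define u where "u = (\<lambda>i\<in>{..<n}. pt i (if i \<in> p ` {..L} then x (the_inv_into {..L} p i) else 0))"
  have p: "\<And>k. k \<le> L \<Longrightarrow> p k < n" "inj_on p {..L}"
    using assms(1) by (auto simp: simple_def)
  have "u \<in> scenarios I"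
    unfolding scenarios_def
  proof (rule PiE_I)
    fix i
    assume "i \<in> {..<n}"
    then have i: "i < n"
      by simp
    have "(if i \<in> p ` {..L} then x (the_inv_into {..L} p i) else 0) < m i"
      using assms(2) m(1)[OF i] p(2) by (auto simp: choice_def the_inv_into_f_f)
    then show "u i \<in> positions I i"
      using bij_betwE[OF pt_bij[OF i]] i by (auto simp: u_def)
  qed (simp add: u_def)
  moreover have u: "u (p k) = pt (p k) (x k)" if "k \<le> L" for k
    using p that by (simp add: u_def the_inv_into_f_f)
  have "path_length I u (vertices p L) = real_length p L x"
    unfolding path_length_vertices real_length_def by (intro sum.cong) (simp_all add: u)
  ultimately show ?thesis
    unfolding cost_def using finite_scenarios[OF wf] by (metis Max_ge finite_imageI imageI)
qed

text \<open>Restrict a worst scenario to the path and take the indices of its positions.\<close>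

lemma cost_attained:
  assumes "simple p L"
  shows "\<exists>x. choice p L x \<and> cost I (vertices p L) = real_length p L x"
proof -
  have "cost I (vertices p L) \<in> (\<lambda>u. path_length I u (vertices p L)) ` scenarios I"
    unfolding cost_def using finite_scenarios[OF wf] scenarios_nonempty[OF wf] by (intro Max_in) auto
  then obtain u where u: "u \<in> scenarios I" "cost I (vertices p L) = path_length I u (vertices p L)"
    by auto
  define x where "x = (\<lambda>k. the_inv_into {..<m (p k)} (pt (p k)) (u (p k)))"
  have x: "x k < m (p k)" "pt (p k) (x k) = u (p k)" if "k \<le> L" for k
  proof -
    have pk: "p k < n"
      using assms that by (auto simp: simple_def)
    then have "u (p k) \<in> positions I (p k)"
      using u(1) by (auto simp: scenarios_def)
    with pt_bij[OF pk] show "x k < m (p k)" "pt (p k) (x k) = u (p k)"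
      unfolding x_def bij_betw_def
      by (metis lessThan_iff the_inv_into_into subset_refl, metis f_the_inv_into_f)
  qed
  then have "choice p L x"
    by (simp add: choice_def)
  moreover have "path_length I u (vertices p L) = real_length p L x"
    unfolding path_length_vertices real_length_def by (intro sum.cong) (simp_all add: x)
  ultimately show ?thesis
    using u(2) by auto
qed

lemma cost_nonneg: "simple p L \<Longrightarrow> 0 \<le> cost I (vertices p L)"
  using cost_attained by (fastforce simp: real_length_def intro: sum_nonneg)

lemma correct_answerI:
  assumes "simple p L" "\<And>q M. simple q M \<Longrightarrow> cost I (vertices p L) \<le> (1 + \<epsilon>) * cost I (vertices q M)"
  shows "correct_answer I \<epsilon> (vertices p L)"
proof -
  have ex: "\<exists>Q. st_path I Q"
    using st_path_vertices[OF assms(1)] by blast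
  then have "opt I \<in> cost I ` {P. st_path I P}"
    unfolding opt_def using finite_st_paths by (intro Min_in) auto
  then obtain Q where "st_path I Q" "opt I = cost I Q"
    by auto
  then obtain q M where "simple q M" "opt I = cost I (vertices q M)"
    using st_path_obtain by metis
  with assms ex show ?thesis
    by (simp add: correct_answer_def approx_solution_def st_path_vertices)
qed

end

section \<open>Largest edge lengths and the error of rounding\<close>

locale rsp_weighted = rsp +
  fixes wt :: "nat \<Rightarrow> nat \<Rightarrow> real"
  assumes wt_ge: "\<And>i j a b. i < n \<Longrightarrow> j < n \<Longrightarrow> a < m i \<Longrightarrow> b < m j \<Longrightarrow> d i a j b \<le> wt i j"
    and wt_attained: "\<And>i j. i < n \<Longrightarrow> j < n \<Longrightarrow> \<exists>a b. a < m i \<and> b < m j \<and> wt i j = d i a j b"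
begin

lemma wt_nonneg: "i < n \<Longrightarrow> j < n \<Longrightarrow> 0 \<le> wt i j"
  using wt_attained by fastforce

definition upper :: "(nat \<Rightarrow> nat) \<Rightarrow> nat \<Rightarrow> real" where
  "upper p L = (\<Sum>k<L. wt (p k) (p (Suc k)))"

lemma cost_le_upper:
  assumes "simple p L"
  shows "cost I (vertices p L) \<le> upper p L"
proof -
  obtain x where x: "choice p L x" "cost I (vertices p L) = real_length p L x"
    using cost_attained[OF assms] by blast
  show ?thesis
    unfolding x(2) real_length_def upper_def
    using assms x(1) by (intro sum_mono wt_ge) (auto simp: simple_def choice_def)
qed

text \<open>The edges of even index can all attain their maximal length in one scenario, and so can the
  edges of odd index.\<close>

lemma upper_le_cost:
  assumes "simple p L"
  shows "upper p L \<le> 2 * cost I (vertices p L)"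
proof -
  have pn: "p k < n" if "k \<le> L" for k
    using assms that by (auto simp: simple_def)
  have "\<forall>k. \<exists>a b. k < L \<longrightarrow> a < m (p k) \<and> b < m (p (Suc k)) \<and> wt (p k) (p (Suc k)) = d (p k) a (p (Suc k)) b"
    using wt_attained pn by (meson Suc_leI less_imp_le)
  then obtain \<alpha> \<beta> where ab: "\<And>k. k < L \<Longrightarrow> \<alpha> k < m (p k) \<and> \<beta> k < m (p (Suc k)) \<and>
      wt (p k) (p (Suc k)) = d (p k) (\<alpha> k) (p (Suc k)) (\<beta> k)"
    by metis
  have half: "(\<Sum>k | k < L \<and> even (k + e). wt (p k) (p (Suc k))) \<le> cost I (vertices p L)" for e :: nat
  proof -
    \<comment> \<open>The selected edges start at the places \<open>k\<close> with
      \<open>k + e\<close> even. Such a place takes the left end of its edge, the others the right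
      end of the edge before; no place serves two selected edges. The value 0 is used where no
      selected edge is incident.\<close>
    define x where "x = (\<lambda>k. if even (k + e) then (if k < L then \<alpha> k else 0) else (if k = 0 then 0 else \<beta> (k - 1)))"
    have "choice p L x"
      unfolding choice_def
    proof (intro allI impI)
      fix k
      assume "k \<le> L"
      then show "x k < m (p k)"
        using ab[of k] ab[of "k - 1"] m(1)[OF pn[of k]] by (cases k) (auto simp: x_def)
    qed
    have "(\<Sum>k | k < L \<and> even (k + e). wt (p k) (p (Suc k)))
        = (\<Sum>k | k < L \<and> even (k + e). d (p k) (x k) (p (Suc k)) (x (Suc k)))"
      using ab by (intro sum.cong) (auto simp: x_def)
    also have "\<dots> \<le> real_length p L x"
      unfolding real_length_def by (intro sum_mono2) auto
    also have "\<dots> \<le> cost I (vertices p L)"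
      using assms \<open>choice p L x\<close> by (rule real_length_le_cost)
    finally show ?thesis .
  qed
  have "upper p L = (\<Sum>k\<in>{k. k < L \<and> even (k + 0)} \<union> {k. k < L \<and> even (k + 1)}. wt (p k) (p (Suc k)))"
    unfolding upper_def by (rule sum.cong) auto
  also have "\<dots> = (\<Sum>k | k < L \<and> even (k + 0). wt (p k) (p (Suc k))) + (\<Sum>k | k < L \<and> even (k + 1). wt (p k) (p (Suc k)))"
    by (rule sum.union_disjoint) auto
  also have "\<dots> \<le> 2 * cost I (vertices p L)"
    using half[of 0] half[of 1] by simp
  finally show ?thesis .
qed

sublocale wg: weighted_graph n s t adj wt
  by unfold_locales (use s t wt_nonneg in auto)

lemma simple_st_walk: "simple p L \<Longrightarrow> wg.st_walk p L"
  using simple_length by (auto simp: simple_def wg.st_walk_iff)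

lemma lex_min_simple: "wg.lex_min p L \<Longrightarrow> simple p L"
  using wg.lex_min_inj by (auto simp: wg.lex_min_def wg.st_walk_iff simple_def)

lemma lex_min_upper:
  assumes "wg.lex_min p L" "simple q M"
  shows "upper p L \<le> upper q M"
  using assms simple_st_walk[OF assms(2)] by (force simp: wg.lex_min_def wg.objective_eq upper_def)

lemma lex_min_le_2_cost:
  assumes "wg.lex_min p L" "simple q M"
  shows "upper p L \<le> 2 * cost I (vertices q M)"
  using lex_min_upper[OF assms] upper_le_cost[OF assms(2)] by simp

lemma lex_min_correct:
  assumes p: "wg.lex_min p L" and "1 \<le> \<epsilon> \<or> n \<le> 2 \<or> upper p L \<le> 0"
  shows "correct_answer I \<epsilon> (vertices p L)"
proof (rule correct_answerI[OF lex_min_simple[OF p]])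
  fix q M
  assume q: "simple q M"
  have sp: "simple p L"
    by (rule lex_min_simple[OF p])
  have le: "cost I (vertices p L) \<le> 2 * cost I (vertices q M)"
    using cost_le_upper[OF sp] lex_min_le_2_cost[OF p q] by simp
  have mono: "c * cost I (vertices q M) \<le> (1 + \<epsilon>) * cost I (vertices q M)" if "c \<le> 1 + \<epsilon>" for c
    using that cost_nonneg[OF q] by (rule mult_right_mono)
  show "cost I (vertices p L) \<le> (1 + \<epsilon>) * cost I (vertices q M)"
    using assms(2)
  proof (elim disjE)
    assume "1 \<le> \<epsilon>"
    then show ?thesis
      using le mono[of 2] by simp
  next
    assume "upper p L \<le> 0"
    then show ?thesis
      using cost_le_upper[OF sp] mono[of 0] eps by simp
  next
    assume "n \<le> 2"
    then have "L \<le> 1" "M \<le> 1"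
      using simple_length[OF sp] simple_length[OF q] by auto
    have pq: "p 0 = s" "p L = t" "q 0 = s" "q M = t" "inj_on p {..L}" "inj_on q {..M}"
      using sp q by (auto simp: simple_def)
    \<comment> \<open>Injectivity separates the two ends of a path that has an edge, so its number
      of edges, 0 or 1, is determined by \<open>s\<close> and \<open>t\<close>.\<close>
    have "L = 0 \<longleftrightarrow> s = t" "M = 0 \<longleftrightarrow> s = t"
      using pq inj_onD[OF pq(5), of 0 L] inj_onD[OF pq(6), of 0 M] by auto
    then have "L = M"
      using \<open>L \<le> 1\<close> \<open>M \<le> 1\<close> by linarith
    moreover have "p k = q k" if "k \<le> L" for k
      using that \<open>L \<le> 1\<close> \<open>L = M\<close> pq by (cases "k = 0") (auto simp: le_Suc_eq)
    ultimately have "vertices p L = vertices q M"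
      by (auto simp: vertices_def)
    then show ?thesis
      using mono[of 1] eps by simp
  qed
qed

end

text \<open>The upper estimate of a distance is demanded only below \<open>B\<close>, because
  rounding by counting is capped there. This is enough: an edge used with the value \<open>B\<close>
  pushes the vector out of range.\<close>

locale rsp_rounded = rsp_weighted +
  fixes p1 :: "nat \<Rightarrow> nat" and L1 :: nat and B :: nat and \<delta> :: real
    and rd :: "nat \<Rightarrow> nat \<Rightarrow> nat \<Rightarrow> nat \<Rightarrow> nat"
  assumes p1: "wg.lex_min p1 L1" and upper_pos: "0 < upper p1 L1"
    and delta: "\<delta> = \<epsilon> * upper p1 L1 / (2 * real n)"
    and B_gt: "2 * real n < real B * \<epsilon>"
    and rd_le: "\<And>i a j b. i < n \<Longrightarrow> a < m i \<Longrightarrow> j < n \<Longrightarrow> b < m j \<Longrightarrow> real (rd i a j b) * \<delta> \<le> d i a j b"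
    and rd_gt: "\<And>i a j b. i < n \<Longrightarrow> a < m i \<Longrightarrow> j < n \<Longrightarrow> b < m j \<Longrightarrow> rd i a j b < B \<Longrightarrow>
        d i a j b \<le> (real (rd i a j b) + 1) * \<delta>"
begin

lemma B_pos: "0 < B"
  using B_gt s eps by (cases B) auto

lemma n_pos: "0 < real n"
  using s by simp

lemma delta_pos: "0 < \<delta>"
  using delta eps upper_pos n_pos by simp

sublocale rg: rounded_graph n s t adj B \<sigma> m rd
  by unfold_locales (use s t B_pos m in auto)

lemma rounded_le_real:
  assumes "simple q M" "choice q M x"
  shows "real (rg.rounded_length q M x) * \<delta> \<le> real_length q M x"
  unfolding rg.rounded_length_def real_length_def of_nat_sum sum_distrib_right
  using assms by (intro sum_mono rd_le) (auto simp: simple_def choice_def)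

text \<open>Rounding down gives rounded lengths of at most
  \<open>upper p1 L1 / \<delta> = 2 * n / \<epsilon> < B\<close>, so no vector of such a path is
  discarded. The path \<open>p1\<close> is itself of this kind, which guarantees that the second
  search finds something.\<close>

lemma cheap_path_survives:
  assumes q: "simple q M" and cheap: "cost I (vertices q M) \<le> upper p1 L1"
  shows "rg.st_walk q M" "rg.objective q M * \<delta> \<le> cost I (vertices q M)"
proof -
  have le: "real (rg.rounded_length q M x) * \<delta> \<le> cost I (vertices q M)" if "choice q M x" for x
    using rounded_le_real[OF q that] real_length_le_cost[OF q that] by simp
  have "rg.rounded_length q M x < B" if x: "choice q M x" for x
  proof -
    have "real (rg.rounded_length q M x) * \<delta> \<le> upper p1 L1"
      using le[OF x] cheap by simp
    also have "\<dots> = 2 * real n / \<epsilon> * \<delta>"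
      using eps n_pos by (simp add: delta)
    also have "\<dots> < real B * \<delta>"
      using B_gt eps delta_pos by (simp add: pos_divide_less_eq)
    finally show ?thesis
      using delta_pos by simp
  qed
  then have short: "\<And>x. rg.choice q M x \<Longrightarrow> rg.rounded_length q M x < B"
    by (simp add: rg.choice_def choice_def)
  have qq: "q 0 = s" "\<And>k. k \<le> M \<Longrightarrow> q k < n" "\<And>k. k < M \<Longrightarrow> adj (q k) (q (Suc k))" "q M = t" "M < n"
    using q simple_length[OF q] by (auto simp: simple_def)
  note * = rg.st_walk_if_short[of q M, OF qq short]
  show "rg.st_walk q M"
    by (rule *(1))
  obtain x where "rg.choice q M x" "rg.objective q M = rg.rounded_length q M x"
    using *(2) by blast
  then show "rg.objective q M * \<delta> \<le> cost I (vertices q M)"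
    using le[of x] by (simp add: rg.choice_def choice_def)
qed

lemma lex_min_rounded_simple: "rg.lex_min p L \<Longrightarrow> simple p L"
  using rg.lex_min_inj[of p L] by (auto simp: rg.lex_min_def rg.st_walk_def rg.walk_def simple_def)

lemma cost_le_objective:
  assumes p: "rg.lex_min p L"
  shows "cost I (vertices p L) \<le> (rg.objective p L + real n) * \<delta>"
proof -
  have sp: "simple p L" and st: "rg.st_walk p L"
    using p lex_min_rounded_simple by (auto simp: rg.lex_min_def)
  obtain x where x: "choice p L x" "cost I (vertices p L) = real_length p L x"
    using cost_attained[OF sp] by blast
  then have x': "rg.choice p L x"
    by (simp add: rg.choice_def choice_def)
  \<comment> \<open>A single edge is a summand of a rounded length below \<open>B\<close>, so the
    cap was not reached and the upper estimate applies.\<close>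
  have "rd (p k) (x k) (p (Suc k)) (x (Suc k)) < B" if "k < L" for k
  proof -
    have "rd (p k) (x k) (p (Suc k)) (x (Suc k)) \<le> rg.rounded_length p L x"
      unfolding rg.rounded_length_def using that by (intro member_le_sum[of k "{..<L}" "\<lambda>k. rd (p k) (x k) (p (Suc k)) (x (Suc k))"]) auto
    with rg.rounded_length_le_objective(2)[OF st x'] show ?thesis
      by simp
  qed
  then have "real_length p L x \<le> (\<Sum>k<L. (real (rd (p k) (x k) (p (Suc k)) (x (Suc k))) + 1) * \<delta>)"
    unfolding real_length_def using sp x(1) by (intro sum_mono rd_gt) (auto simp: simple_def choice_def)
  also have "\<dots> = (real (rg.rounded_length p L x) + real L) * \<delta>"
    by (simp add: rg.rounded_length_def sum.distrib flip: sum_distrib_right)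
  also have "\<dots> \<le> (rg.objective p L + real n) * \<delta>"
    using rg.rounded_length_le_objective(1)[OF st x'] simple_length[OF sp] delta_pos
    by (intro mult_right_mono) auto
  finally show ?thesis
    using x(2) by simp
qed

lemma exists_rounded_walk: "\<exists>q M. rg.st_walk q M"
  using cheap_path_survives(1)[OF lex_min_simple[OF p1]] cost_le_upper[OF lex_min_simple[OF p1]] by blast

lemma lex_min_rounded_correct:
  assumes p: "rg.lex_min p L"
  shows "correct_answer I \<epsilon> (vertices p L)"
proof (rule correct_answerI[OF lex_min_rounded_simple[OF p]])
  have key: "cost I (vertices p L) \<le> (1 + \<epsilon>) * cost I (vertices q M)"
    if q: "simple q M" and cheap: "cost I (vertices q M) \<le> upper p1 L1" for q M
  proof -
    have "rg.objective p L \<le> rg.objective q M"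
      using p cheap_path_survives(1)[OF q cheap] by (force simp: rg.lex_min_def)
    then have "cost I (vertices p L) \<le> (rg.objective q M + real n) * \<delta>"
      using cost_le_objective[OF p] delta_pos by (smt (verit) mult_right_mono)
    also have "\<dots> \<le> cost I (vertices q M) + real n * \<delta>"
      using cheap_path_survives(2)[OF q cheap] by (simp add: distrib_right)
    \<comment> \<open>Here the 2 in \<open>\<delta>\<close> is spent: half of
      \<open>upper p1 L1\<close> is at most the cost of any simple path.\<close>
    also have "real n * \<delta> = \<epsilon> * (upper p1 L1 / 2)"
      using n_pos by (simp add: delta)
    also have "\<dots> \<le> \<epsilon> * cost I (vertices q M)"
      using lex_min_le_2_cost[OF p1 q] eps by (intro mult_left_mono) auto
    finally show ?thesis
      by (simp add: distrib_right)
  qed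
  fix q M
  assume q: "simple q M"
  show "cost I (vertices p L) \<le> (1 + \<epsilon>) * cost I (vertices q M)"
  proof (cases "cost I (vertices q M) \<le> upper p1 L1")
    case True
    with key q show ?thesis
      by blast
  next
    case False
    \<comment> \<open>A path costing more than \<open>upper p1 L1\<close> may be missing from the
      search, but \<open>p1\<close> is cheaper than it and is never discarded.\<close>
    have "cost I (vertices p1 L1) \<le> upper p1 L1"
      by (rule cost_le_upper[OF lex_min_simple[OF p1]])
    with key[OF lex_min_simple[OF p1]]
    have "cost I (vertices p L) \<le> (1 + \<epsilon>) * cost I (vertices p1 L1)"
      by simp
    also have "\<dots> \<le> (1 + \<epsilon>) * cost I (vertices q M)"
      using False \<open>cost I (vertices p1 L1) \<le> upper p1 L1\<close> eps by (intro mult_left_mono) auto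
    finally show ?thesis .
  qed
qed

end

subsection \<open>Computing the tables\<close>

text \<open>The invariant depends on the set of table entries already filled; each pass adds the
  block \<open>S i\<close>. Nested loops over a table then only form unions.\<close>

lemma runs_For_table:
  assumes "x \<notin> nat_writes p"
    and "\<And>st'. same_except (insert x (nat_writes p)) (real_writes p) st st' \<Longrightarrow> nval e st' = m"
    and "\<And>D st' v. J D st' \<Longrightarrow> J D (set_nat x v st')"
    and "J D st"
    and step: "\<And>i D st'. i < m \<Longrightarrow> J D st' \<Longrightarrow> nats st' x [] = i \<Longrightarrow>
          same_except (insert x (nat_writes p)) (real_writes p) st st' \<Longrightarrow> runs p st' T (J (D \<union> S i))"
    and "2 + m * (T + 2) \<le> T'"
  shows "runs (For x e p) st T' (J (D \<union> (\<Union>i<m. S i)))"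
proof (rule runs_For[where I = "\<lambda>i. J (D \<union> (\<Union>i'<i. S i'))"])
  fix i st'
  assume "i < m" "J (D \<union> (\<Union>i'<i. S i')) st'" "nats st' x [] = i"
    "same_except (insert x (nat_writes p)) (real_writes p) st st'"
  from step[OF this] show "runs p st' T (J (D \<union> (\<Union>i'<Suc i. S i')))"
    by (simp add: lessThan_Suc Un_commute Un_left_commute)
qed (use assms in auto)

section \<open>Programs for the tables\<close>

definition count_positions :: com where
  "count_positions = For ''i'' (Var ''n'')
     (Cond (NLess (Var ''sig'') (NCell ''card'' [Var ''i'']))
        (NAssign ''sig'' [] (NCell ''card'' [Var ''i''])) Skip)"

text \<open>The middle index 0 of \<open>w\<close> is the single state of the first search, so the
  weights are stored where that search reads them.\<close>

definition max_dist :: com where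
  "max_dist = Seq (RAssign ''x'' [] (RNat (NConst 0)))
     (Seq (For ''a'' (NCell ''card'' [Var ''i'']) (For ''b'' (NCell ''card'' [Var ''j''])
        (Cond (RLess (RCell ''x'' []) (RCell ''dist'' [Var ''i'', Var ''a'', Var ''j'', Var ''b'']))
           (RAssign ''x'' [] (RCell ''dist'' [Var ''i'', Var ''a'', Var ''j'', Var ''b'']))
           Skip)))
        (RAssign ''w'' [Var ''i'', NConst 0, Var ''j''] (RCell ''x'' [])))"

definition weights :: com where
  "weights = For ''i'' (Var ''n'') (For ''j'' (Var ''n'') max_dist)"

text \<open>Replaces the floor of 2n/\<epsilon>, which the machine cannot compute directly: the test
  compares 2n with a multiple of \<epsilon> until the multiple exceeds it.\<close>

definition compute_base :: com where
  "compute_base = Seq (NAssign ''base'' [] (NConst 1))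
     (While (BNot (RLess (RNat (NAdd (Var ''n'') (Var ''n''))) (RMul (RNat (Var ''base'')) (RCell ''eps'' []))))
        (NAssign ''base'' [] (NAdd (Var ''base'') (NConst 1))))"

text \<open>While level \<open>a\<close> is filled, \<open>N\<close> holds the \<open>a\<close>-th
  power of the base. Adding it once per value gives all multiples and leaves the next power in
  \<open>e\<close>; in the end \<open>N\<close> is the number of states.\<close>

definition powers :: com where
  "powers = Seq (NAssign ''N'' [] (NConst 1))
     (For ''a'' (Var ''sig'')
       (Seq (NAssign ''e'' [] (NConst 0))
       (Seq (For ''v'' (Var ''base'')
              (Seq (NAssign ''pw'' [Var ''a'', Var ''v''] (Var ''e''))
                   (NAssign ''e'' [] (NAdd (Var ''e'') (Var ''N'')))))
            (NAssign ''N'' [] (Var ''e'')))))"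

text \<open>The cells \<open>q\<close> and \<open>r\<close> follow quotient and remainder of
  \<open>c\<close> by the base like a counter with carry. The digits of \<open>c\<close> are
  \<open>r\<close> and then those of \<open>q\<close>, which can be copied from its row of the
  table.\<close>

definition digits :: com where
  "digits = Seq (NAssign ''q'' [] (NConst 0)) (Seq (NAssign ''r'' [] (NConst 0))
     (For ''c'' (Var ''N'')
       (Seq (NAssign ''dig'' [Var ''c'', NConst 0] (Var ''r''))
       (Seq (For ''a'' (Var ''sig'')
              (NAssign ''dig'' [Var ''c'', NAdd (Var ''a'') (NConst 1)] (NCell ''dig'' [Var ''q'', Var ''a''])))
       (Seq (NAssign ''r'' [] (NAdd (Var ''r'') (NConst 1)))
            (Cond (NLess (Var ''r'') (Var ''base'')) Skip
               (Seq (NAssign ''r'' [] (NConst 0)) (NAssign ''q'' [] (NAdd (Var ''q'') (NConst 1))))))))))"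

text \<open>The minimum of \<open>base\<close> and the floor of the distance divided by
  \<open>delta\<close>. Without the cap the number of passes would depend on the ratio of the
  distances.\<close>

definition round_dist :: com where
  "round_dist = Seq (NAssign ''y'' [] (NConst 0))
     (Seq (While (BAnd (NLess (Var ''y'') (Var ''base''))
                  (BNot (RLess (RCell ''dist'' [Var ''i'', Var ''a'', Var ''j'', Var ''b''])
                     (RMul (RNat (NAdd (Var ''y'') (NConst 1))) (RCell ''delta'' [])))))
             (NAssign ''y'' [] (NAdd (Var ''y'') (NConst 1))))
          (NAssign ''rd'' [Var ''i'', Var ''a'', Var ''j'', Var ''b''] (Var ''y'')))"

definition round_all :: com where
  "round_all =
     For ''i'' (Var ''n'') (For ''a'' (NCell ''card'' [Var ''i''])
       (For ''j'' (Var ''n'') (For ''b'' (NCell ''card'' [Var ''j'']) round_dist)))"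

definition max_length :: com where
  "max_length = Seq (NAssign ''mm'' [] (NConst 0))
     (For ''a'' (NCell ''card'' [Var ''i''])
       (Seq (NAssign ''y'' [] (NAdd (NCell ''dig'' [Var ''c'', Var ''a'']) (NCell ''rd'' [Var ''i'', Var ''a'', Var ''j'', Var ''b''])))
            (Cond (NLess (Var ''mm'') (Var ''y'')) (NAssign ''mm'' [] (Var ''y'')) Skip)))"

text \<open>The weights are cleared as well, because the first search left its edge weights under
  state 0.\<close>

definition next_code :: com where
  "next_code = Seq (NAssign ''e'' [] (NConst 0))
     (Seq (For ''b'' (NCell ''card'' [Var ''j''])
            (Seq max_length
               (Cond (NLess (Var ''mm'') (Var ''base''))
                  (NAssign ''e'' [] (NAdd (Var ''e'') (NCell ''pw'' [Var ''b'', Var ''mm''])))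
                  (NAssign ''e'' [] (NAdd (Var ''e'') (Var ''N''))))))
     (Seq (NAssign ''nxt'' [Var ''i'', Var ''c'', Var ''j''] (Var ''e''))
          (RAssign ''w'' [Var ''i'', Var ''c'', Var ''j''] (RNat (NConst 0)))))"

definition next_codes :: com where
  "next_codes = For ''i'' (Var ''n'') (For ''c'' (Var ''N'') (For ''j'' (Var ''n'') next_code))"

definition final_values :: com where
  "final_values = For ''c'' (Var ''N'')
     (Seq (NAssign ''mm'' [] (NConst 0))
     (Seq (For ''a'' (NCell ''card'' [Var ''t''])
            (Cond (NLess (Var ''mm'') (NCell ''dig'' [Var ''c'', Var ''a'']))
               (NAssign ''mm'' [] (NCell ''dig'' [Var ''c'', Var ''a''])) Skip))
          (RAssign ''fin'' [Var ''c''] (RNat (Var ''mm'')))))"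

lemma writes_tables [simp]:
  "nat_writes count_positions = {''i'', ''sig''}" "real_writes count_positions = {}"
  "nat_writes max_dist = {''a'', ''b''}" "real_writes max_dist = {''x'', ''w''}"
  "nat_writes weights = {''i'', ''j'', ''a'', ''b''}" "real_writes weights = {''x'', ''w''}"
  "nat_writes compute_base = {''base''}" "real_writes compute_base = {}"
  "nat_writes powers = {''N'', ''a'', ''e'', ''v'', ''pw''}" "real_writes powers = {}"
  "nat_writes digits = {''q'', ''r'', ''c'', ''a'', ''dig''}" "real_writes digits = {}"
  "nat_writes round_dist = {''y'', ''rd''}" "real_writes round_dist = {}"
  "nat_writes round_all = {''i'', ''a'', ''j'', ''b'', ''y'', ''rd''}" "real_writes round_all = {}"
  "nat_writes max_length = {''mm'', ''a'', ''y''}" "real_writes max_length = {}"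
  "nat_writes next_code = {''e'', ''b'', ''mm'', ''a'', ''y'', ''nxt''}" "real_writes next_code = {''w''}"
  "nat_writes next_codes = {''i'', ''c'', ''j'', ''e'', ''b'', ''mm'', ''a'', ''y'', ''nxt''}" "real_writes next_codes = {''w''}"
  "nat_writes final_values = {''c'', ''mm'', ''a''}" "real_writes final_values = {''fin''}"
  by (auto simp: count_positions_def max_dist_def weights_def compute_base_def powers_def digits_def
      round_dist_def round_all_def max_length_def next_code_def next_codes_def final_values_def)

section \<open>Correctness and running time of these programs\<close>

context rsp
begin

definition holds_input :: "store \<Rightarrow> bool" where
  "holds_input st \<longleftrightarrow> nats st ''n'' [] = n \<and> nats st ''s'' [] = s \<and> nats st ''t'' [] = t \<and>
     (\<forall>i j. 0 < nats st ''adj'' [i, j] \<longleftrightarrow> adj i j) \<and> (\<forall>i<n. nats st ''card'' [i] = m i) \<and>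
     reals st ''eps'' [] = \<epsilon> \<and>
     (\<forall>i<n. \<forall>a<m i. \<forall>j<n. \<forall>b<m j. reals st ''dist'' [i, a, j, b] = d i a j b)"

lemma holds_input_same_except:
  assumes "same_except X Y st st'" "holds_input st"
    and "X \<inter> {''n'', ''s'', ''t'', ''adj'', ''card''} = {}" "Y \<inter> {''eps'', ''dist''} = {}"
  shows "holds_input st'"
proof -
  have "x \<in> {''n'', ''s'', ''t'', ''adj'', ''card''} \<Longrightarrow> nats st' x = nats st x"
    "x \<in> {''eps'', ''dist''} \<Longrightarrow> reals st' x = reals st x" for x
    using assms(1,3,4) unfolding same_except_def by blast+
  with assms(2) show ?thesis
    unfolding holds_input_def by simp
qed

lemma input_values:
  assumes "holds_input st"
  shows "nats st ''n'' [] = n" "nats st ''s'' [] = s" "nats st ''t'' [] = t" "i < n \<Longrightarrow> nats st ''card'' [i] = m i"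
    "reals st ''eps'' [] = \<epsilon>"
    "i < n \<Longrightarrow> a < m i \<Longrightarrow> j < n \<Longrightarrow> b < m j \<Longrightarrow> reals st ''dist'' [i, a, j, b] = d i a j b"
  using assms by (auto simp: holds_input_def)

lemma pos: "1 \<le> n" "1 \<le> \<sigma>"
  using s m[OF s] by auto

lemma runs_count_positions:
  assumes inp: "holds_input st" and "nats st ''sig'' [] = 0"
  shows "runs count_positions st (7 * (n * 1)) (\<lambda>st'. nats st' ''sig'' [] = \<sigma>)"
proof -
  let ?I = "\<lambda>i st'. (\<forall>i'<i. m i' \<le> nats st' ''sig'' []) \<and> nats st' ''sig'' [] \<le> \<sigma>"
  have "runs count_positions st (7 * (n * 1)) (?I n)"
    unfolding count_positions_def
  proof (rule runs_For[where I = ?I and T = 3], goal_cases)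
    case (2 st')
    then show ?case
      using same_except_nats[OF 2] input_values(1)[OF inp] by simp
  next
    case (5 i st')
    have v: "nats st' ''card'' [i] = m i"
      using same_except_nats[OF 5(4)] input_values(4)[OF inp 5(1)] by simp
    show ?case
      by (rule runs_loop_free) (use 5(2,3) m[OF 5(1)] in \<open>auto simp: v less_Suc_eq\<close>)
  next
    case 6
    show ?case
      by (rule loop_time[where c = 3]) (use pos in auto)
  qed (use assms in auto)
  then show ?thesis
  proof (rule runs_mono[OF _ order_refl], goal_cases)
    case (1 st')
    have "\<sigma> \<le> nats st' ''sig'' []"
      unfolding max_positions_def using 1 pos by (intro Max.boundedI) (auto simp: lessThan_empty_iff)
    with 1 show ?case
      by simp
  qed
qed

definition is_max_dist :: "nat \<Rightarrow> nat \<Rightarrow> real \<Rightarrow> bool" where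
  "is_max_dist i j v \<longleftrightarrow> (\<forall>a<m i. \<forall>b<m j. d i a j b \<le> v) \<and> (\<exists>a b. a < m i \<and> b < m j \<and> v = d i a j b)"

lemma runs_max_dist:
  assumes inp: "holds_input st" and ij: "nats st ''i'' [] = i" "nats st ''j'' [] = j" "i < n" "j < n"
  shows "runs max_dist st (13 * (\<sigma> * (\<sigma> * 1)))
    (\<lambda>st'. \<exists>v. is_max_dist i j v \<and> reals st' ''w'' = (reals st ''w'')([i, 0, j] := v))"
proof -
  define J where "J = (\<lambda>D (st' :: store). 0 \<le> reals st' ''x'' [] \<and> (\<forall>(a, b)\<in>D. d i a j b \<le> reals st' ''x'' []) \<and>
     (reals st' ''x'' [] = 0 \<or> (\<exists>a b. a < m i \<and> b < m j \<and> reals st' ''x'' [] = d i a j b)))"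
  let ?st = "st\<lparr>reals := store_upd (reals st) ''x'' [] 0\<rparr>"
  let ?b = "Cond (RLess (RCell ''x'' []) (RCell ''dist'' [Var ''i'', Var ''a'', Var ''j'', Var ''b'']))
           (RAssign ''x'' [] (RCell ''dist'' [Var ''i'', Var ''a'', Var ''j'', Var ''b''])) Skip"
  let ?p = "For ''a'' (NCell ''card'' [Var ''i'']) (For ''b'' (NCell ''card'' [Var ''j'']) ?b)"
  have v0: "nats ?st ''card'' [i] = m i" "nats ?st ''card'' [j] = m j"
      "nats ?st ''i'' [] = i" "nats ?st ''j'' [] = j"
    using input_values(4)[OF inp] ij by simp_all
  have dist: "reals ?st ''dist'' [i, a, j, b] = d i a j b" if "a < m i" "b < m j" for a b
    using input_values(6)[OF inp] ij that by simp
  have "runs ?p ?st (11 * (\<sigma> * (\<sigma> * 1))) (J ({} \<union> (\<Union>a<m i. \<Union>b<m j. {(a, b)})))"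
  proof (rule runs_For_table[where T = "7 * (\<sigma> * 1)"], goal_cases)
    case (2 st')
    then show ?case
      using same_except_nats[OF 2] v0 by simp
  next
    case (5 a D st1)
    note f1 = same_except_nats[OF 5(4)] same_except_reals[OF 5(4)]
    show ?case
    proof (rule runs_For_table[where T = 3], goal_cases)
      case (2 st')
      then show ?case
        using same_except_nats[OF 2] f1 v0 by simp
    next
      case (5 b D st2)
      have v: "nats st2 ''i'' [] = i" "nats st2 ''j'' [] = j" "nats st2 ''a'' [] = a" "nats st2 ''b'' [] = b"
          "reals st2 ''dist'' [i, a, j, b] = d i a j b"
        using same_except_nats[OF 5(4)] same_except_reals[OF 5(4)] f1 v0 dist[OF \<open>a < m i\<close> \<open>b < m j\<close>]
          \<open>nats st1 ''a'' [] = a\<close> \<open>nats st2 ''b'' [] = b\<close> by simp_all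
      show ?case
        by (rule runs_loop_free)
          (use 5(1,2) \<open>a < m i\<close> in \<open>fastforce simp: J_def v\<close>, simp)
    next
      case 6
      show ?case
        by (rule loop_time[where c = 3]) (use m[OF ij(4)] pos in auto)
    qed (use 5 in \<open>auto simp: J_def\<close>)
  next
    case 6
    show ?case
      by (rule loop_time[where c = 7]) (use m[OF ij(3)] pos in auto)
  qed (auto simp: J_def)
  then have "runs (Seq ?p (RAssign ''w'' [Var ''i'', NConst 0, Var ''j''] (RCell ''x'' []))) ?st
     (11 * (\<sigma> * (\<sigma> * 1)) + 1) (\<lambda>st'. \<exists>v. is_max_dist i j v \<and> reals st' ''w'' = (reals st ''w'')([i, 0, j] := v))"
  proof (rule runs_Seq_frame)
    fix st1
    assume J: "J ({} \<union> (\<Union>a<m i. \<Union>b<m j. {(a, b)})) st1" and fr: "same_except (nat_writes ?p) (real_writes ?p) ?st st1"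
    have le: "d i a j b \<le> reals st1 ''x'' []" if "a < m i" "b < m j" for a b
      using J that by (auto simp: J_def)
    have "\<exists>a b. a < m i \<and> b < m j \<and> reals st1 ''x'' [] = d i a j b"
    proof (cases "reals st1 ''x'' [] = 0")
      \<comment> \<open>The cell may still hold its initial 0. Then all distances vanish and
        position 0 of both vertices attains the maximum.\<close>
      case True
      have "d i 0 j 0 = 0"
        using le[of 0 0] m(1)[OF ij(3)] m(1)[OF ij(4)] True by (metis antisym mdist_nonneg)
      with True show ?thesis
        using m(1)[OF ij(3)] m(1)[OF ij(4)] by metis
    qed (use J in \<open>auto simp: J_def\<close>)
    with le have "is_max_dist i j (reals st1 ''x'' [])"
      by (auto simp: is_max_dist_def)
    then show "runs (RAssign ''w'' [Var ''i'', NConst 0, Var ''j''] (RCell ''x'' [])) st1 1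
        (\<lambda>st'. \<exists>v. is_max_dist i j v \<and> reals st' ''w'' = (reals st ''w'')([i, 0, j] := v))"
      using same_except_nats[OF fr] same_except_reals[OF fr] v0
      by (intro runs_NAssign runs_RAssign exI[of _ "reals st1 ''x'' []"]) (auto simp: store_upd_def)
  qed
  then have "runs max_dist st (1 + (11 * (\<sigma> * (\<sigma> * 1)) + 1))
     (\<lambda>st'. \<exists>v. is_max_dist i j v \<and> reals st' ''w'' = (reals st ''w'')([i, 0, j] := v))"
    unfolding max_dist_def by - (rule runs_Seq, rule runs_RAssign, simp)
  then show ?thesis
    by (rule runs_time) (use pos in simp)
qed

lemma runs_weights:
  assumes inp: "holds_input st"
  shows "runs weights st (21 * (n * (n * (\<sigma> * (\<sigma> * 1)))))
     (\<lambda>st'. \<forall>i<n. \<forall>j<n. is_max_dist i j (reals st' ''w'' [i, 0, j]))"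
proof -
  define J where "J = (\<lambda>D (st' :: store). \<forall>(i, j)\<in>D. is_max_dist i j (reals st' ''w'' [i, 0, j]))"
  have "runs weights st (21 * (n * (n * (\<sigma> * (\<sigma> * 1))))) (J ({} \<union> (\<Union>i<n. \<Union>j<n. {(i, j)})))"
    unfolding weights_def
  proof (rule runs_For_table[where T = "17 * (n * (\<sigma> * (\<sigma> * 1)))"], goal_cases)
    case (2 st')
    then show ?case
      using input_values(1)[OF holds_input_same_except[OF 2 inp]] by simp
  next
    case (5 i D st1)
    have inp1: "holds_input st1"
      using holds_input_same_except[OF 5(4) inp] by simp
    show ?case
    proof (rule runs_For_table[where T = "13 * (\<sigma> * (\<sigma> * 1))"], goal_cases)
      case (2 st')
      then show ?case
        using input_values(1)[OF holds_input_same_except[OF 2 inp1]] by simp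
    next
      case (5 j D st2)
      have inp2: "holds_input st2"
        using holds_input_same_except[OF 5(4) inp1] by simp
      have i: "nats st2 ''i'' [] = i"
        using same_except_nats[OF 5(4), of "''i''"] \<open>nats st1 ''i'' [] = i\<close> by simp
      from runs_max_dist[OF inp2 i 5(3) \<open>i < n\<close> \<open>j < n\<close>] show ?case
        by (rule runs_mono[OF _ order_refl]) (use 5(2) in \<open>auto simp: J_def\<close>)
    next
      case 6
      show ?case
        by (rule loop_time[where c = 13]) (use pos in auto)
    qed (use 5 in \<open>auto simp: J_def\<close>)
  next
    case 6
    show ?case
      by (rule loop_time[where c = 17]) (use pos in auto)
  qed (auto simp: J_def)
  then show ?thesis
    by (rule runs_mono[OF _ order_refl]) (auto simp: J_def)
qed

definition base :: nat where
  "base = nat \<lfloor>2 * real n / \<epsilon>\<rfloor> + 1"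

lemma base_gt: "2 * real n < real base * \<epsilon>"
proof -
  have "2 * real n / \<epsilon> < real base"
    unfolding base_def using eps by (simp add: of_nat_nat) linarith
  then show ?thesis
    using eps by (simp add: pos_divide_less_eq)
qed

lemma base_le: "real base \<le> 2 * real n / \<epsilon> + 1"
  unfolding base_def using eps by (simp add: of_nat_nat)

lemma base_pos: "1 \<le> base"
  by (simp add: base_def)

lemma runs_compute_base:
  assumes inp: "holds_input st"
  shows "runs compute_base st (4 * base) (\<lambda>st'. nats st' ''base'' [] = base)"
proof -
  let ?b = "BNot (RLess (RNat (NAdd (Var ''n'') (Var ''n''))) (RMul (RNat (Var ''base'')) (RCell ''eps'' [])))"
  let ?p = "NAssign ''base'' [] (NAdd (Var ''base'') (NConst 1))"
  let ?I = "\<lambda>i st'. nats st' ''base'' [] = Suc i \<and> i < base \<and> nats st' ''n'' [] = n \<and> reals st' ''eps'' [] = \<epsilon>"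
  have "runs (While ?b ?p) (set_nat ''base'' 1 st) (1 + (base - 1) * (1 + 1)) (\<lambda>st'. (\<exists>i. ?I i st') \<and> \<not> bval ?b st')"
  proof (rule runs_While)
    show "?I 0 (set_nat ''base'' 1 st)"
      using input_values[OF inp] base_pos by simp
    fix i st'
    assume I: "?I i st'" and b: "bval ?b st'"
    then have "real (Suc i) * \<epsilon> \<le> 2 * real n"
      by simp
    then have "real (Suc i) * \<epsilon> < real base * \<epsilon>"
      using base_gt by linarith
    then have "Suc i < base"
      using eps by simp
    with I show "i < base - 1 \<and> runs ?p st' 1 (?I (Suc i))"
      by (auto intro!: runs_loop_free)
  qed
  then have "runs (While ?b ?p) (set_nat ''base'' 1 st) (1 + (base - 1) * (1 + 1)) (\<lambda>st'. nats st' ''base'' [] = base)"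
  proof (rule runs_mono[OF _ order_refl], goal_cases)
    case (1 st')
    then obtain i where i: "nats st' ''base'' [] = Suc i" "i < base" "2 * real n < real (Suc i) * \<epsilon>"
      by auto
    \<comment> \<open>The final value passes a test that \<open>base - 1\<close> fails, so it is at
      least \<open>base\<close>.\<close>
    have "real (base - 1) \<le> 2 * real n / \<epsilon>"
      using base_le base_pos by simp
    also have "\<dots> < real (Suc i)"
      using i(3) eps by (simp add: pos_divide_less_eq)
    finally show ?case
      using i by simp
  qed
  then have "runs compute_base st (1 + (1 + (base - 1) * (1 + 1))) (\<lambda>st'. nats st' ''base'' [] = base)"
    unfolding compute_base_def by (intro runs_Seq runs_NAssign) (simp add: set_nat_def)
  then show ?thesis
    by (rule runs_time) (use base_pos in simp)
qed

lemma runs_powers: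
  assumes st: "nats st ''base'' [] = B" "nats st ''sig'' [] = \<sigma>" and B: "1 \<le> B"
  shows "runs powers st (14 * (\<sigma> * (B * 1)))
    (\<lambda>st'. nats st' ''N'' [] = B ^ \<sigma> \<and> (\<forall>a<\<sigma>. \<forall>v<B. nats st' ''pw'' [a, v] = v * B ^ a))"
proof -
  let ?i = "For ''v'' (Var ''base'')
              (Seq (NAssign ''pw'' [Var ''a'', Var ''v''] (Var ''e''))
                   (NAssign ''e'' [] (NAdd (Var ''e'') (Var ''N''))))"
  let ?p = "Seq (NAssign ''e'' [] (NConst 0)) (Seq ?i (NAssign ''N'' [] (Var ''e'')))"
  let ?I = "\<lambda>a st'. nats st' ''N'' [] = B ^ a \<and> (\<forall>a'<a. \<forall>v<B. nats st' ''pw'' [a', v] = v * B ^ a')"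
  have inner: "runs ?i st1 (6 * (B * 1)) (\<lambda>st'. nats st' ''e'' [] = B * B ^ a \<and> (\<forall>a'\<le>a. \<forall>v<B. nats st' ''pw'' [a', v] = v * B ^ a'))"
    if st1: "?I a st1" "nats st1 ''a'' [] = a" "nats st1 ''base'' [] = B" "nats st1 ''e'' [] = 0" for a st1
  proof -
    let ?K = "\<lambda>v st'. nats st' ''e'' [] = v * B ^ a \<and> (\<forall>a'<a. \<forall>v<B. nats st' ''pw'' [a', v] = v * B ^ a') \<and>
        (\<forall>v'<v. nats st' ''pw'' [a, v'] = v' * B ^ a)"
    have "runs ?i st1 (6 * (B * 1)) (?K B)"
    proof (rule runs_For[where I = ?K and T = 2], goal_cases)
      case (2 st')
      then show ?case
        using same_except_nats[OF 2] st1 by simp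
    next
      case (5 v st2)
      have "nats st2 ''a'' [] = a" "nats st2 ''N'' [] = B ^ a"
        using same_except_nats[OF 5(4)] st1 by simp_all
      then show ?case
        by (intro runs_loop_free) (use 5(2,3) in \<open>auto simp: less_Suc_eq\<close>)
    next
      case 6
      show ?case
        by (rule loop_time[where c = 2]) (use B in auto)
    qed (use st1 in auto)
    then show ?thesis
      by (rule runs_mono[OF _ order_refl]) (auto simp: le_less)
  qed
  have "runs (For ''a'' (Var ''sig'') ?p) (set_nat ''N'' 1 st) (12 * (\<sigma> * (B * 1))) (?I \<sigma>)"
  proof (rule runs_For[where I = ?I and T = "1 + (6 * (B * 1) + 1)"], goal_cases)
    case (2 st')
    then show ?case
      using same_except_nats[OF 2] st by simp
  next
    case (5 a st1)
    let ?st1 = "set_nat ''e'' 0 st1"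
    have "runs ?i ?st1 (6 * (B * 1)) (\<lambda>st'. nats st' ''e'' [] = B * B ^ a \<and> (\<forall>a'\<le>a. \<forall>v<B. nats st' ''pw'' [a', v] = v * B ^ a'))"
      by (rule inner) (use 5 same_except_nats[OF 5(4)] st in auto)
    then show ?case
      by (intro runs_Seq runs_NAssign)
        (simp only: list.map nval.simps flip: set_nat_def, elim runs_mono[OF _ order_refl], intro runs_NAssign, auto)
  next
    case 6
    show ?case
      by (rule loop_time[where c = 8]) (use B pos in auto)
  qed (use st in auto)
  then have "runs powers st (1 + 12 * (\<sigma> * (B * 1))) (?I \<sigma>)"
    unfolding powers_def by (intro runs_Seq runs_NAssign) (simp add: set_nat_def)
  then show ?thesis
    by (rule runs_time) (use B pos in simp)
qed

end

lemma digit_0: "digit B c 0 = c mod B"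
  and digit_Suc: "digit B c (Suc a) = digit B (c div B) a"
  by (simp_all add: digit_def div_mult2_eq)

context rsp
begin

lemma runs_digits:
  assumes st: "nats st ''base'' [] = B" "nats st ''sig'' [] = \<sigma>" "nats st ''N'' [] = M" and B: "1 \<le> B" and M: "1 \<le> M"
  shows "runs digits st (17 * (M * (\<sigma> * 1))) (\<lambda>st'. \<forall>c<M. \<forall>a\<le>\<sigma>. nats st' ''dig'' [c, a] = digit B c a)"
proof -
  let ?i = "For ''a'' (Var ''sig'')
              (NAssign ''dig'' [Var ''c'', NAdd (Var ''a'') (NConst 1)] (NCell ''dig'' [Var ''q'', Var ''a'']))"
  let ?f = "Seq (NAssign ''r'' [] (NAdd (Var ''r'') (NConst 1)))
            (Cond (NLess (Var ''r'') (Var ''base'')) Skip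
               (Seq (NAssign ''r'' [] (NConst 0)) (NAssign ''q'' [] (NAdd (Var ''q'') (NConst 1)))))"
  let ?p = "Seq (NAssign ''dig'' [Var ''c'', NConst 0] (Var ''r'')) (Seq ?i ?f)"
  let ?D = "\<lambda>c st'. \<forall>c'<c. \<forall>a\<le>\<sigma>. nats st' ''dig'' [c', a] = digit B c' a"
  let ?I = "\<lambda>c st'. nats st' ''q'' [] = c div B \<and> nats st' ''r'' [] = c mod B \<and> ?D c st'"
  have inner: "runs ?i st1 (5 * (\<sigma> * 1)) (\<lambda>st'. ?D (Suc c) st' \<and> same_except (nat_writes ?i) (real_writes ?i) st1 st')"
    if st1: "?D c st1" "nats st1 ''c'' [] = c" "nats st1 ''q'' [] = c div B" "nats st1 ''sig'' [] = \<sigma>"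
      "nats st1 ''dig'' [c, 0] = c mod B" for c st1
  proof -
    let ?K = "\<lambda>a st'. ?D c st' \<and> (\<forall>a'\<le>a. nats st' ''dig'' [c, a'] = digit B c a')"
    have "runs ?i st1 (5 * (\<sigma> * 1)) (?K \<sigma>)"
    proof (rule runs_For[where I = ?K and T = 1], goal_cases)
      case (2 st')
      then show ?case
        using same_except_nats[OF 2] st1 by simp
    next
      case (5 a st2)
      have v: "nats st2 ''c'' [] = c" "nats st2 ''q'' [] = c div B"
        using same_except_nats[OF 5(4)] st1 by simp_all
      have "nats st2 ''dig'' [c div B, a] = digit B (c div B) a"
      proof (cases "c div B = c")
        \<comment> \<open>This occurs for \<open>c = 0\<close> or \<open>B = 1\<close>. The row that
          is read is then the row being written, already filled up to column
          \<open>a\<close>.\<close>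
        case True
        then show ?thesis
          using 5(2) by simp
      next
        case False
        then have "c div B < c"
          by (simp add: le_neq_implies_less)
        then show ?thesis
          using 5(1,2) by simp
      qed
      then show ?case
        by (intro runs_loop_free) (use 5(2,3) in \<open>auto simp: v digit_Suc le_Suc_eq\<close>)
    next
      case 6
      show ?case
        by (rule loop_time[where c = 1]) (use pos in auto)
    qed (use st1 in \<open>auto simp: digit_0\<close>)
    then have "runs ?i st1 (5 * (\<sigma> * 1)) (\<lambda>st'. ?K \<sigma> st' \<and> same_except (nat_writes ?i) (real_writes ?i) st1 st')"
      by (rule runs_frame)
    then show ?thesis
      by (rule runs_mono[OF _ order_refl]) (auto simp: less_Suc_eq)
  qed
  have loop: "runs (For ''c'' (Var ''N'') ?p) st0 (15 * (M * (\<sigma> * 1))) (?I M)"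
    if st0: "nats st0 ''q'' [] = 0" "nats st0 ''r'' [] = 0" "nats st0 ''base'' [] = B" "nats st0 ''sig'' [] = \<sigma>"
      "nats st0 ''N'' [] = M" for st0
  proof (rule runs_For[where I = ?I and T = "1 + (5 * (\<sigma> * 1) + 5)"], goal_cases)
    case (2 st')
    then show ?case
      using same_except_nats[OF 2] st0 by simp
  next
    case (5 c st1)
    note f1 = same_except_nats[OF 5(4)]
    show ?case
    proof (rule runs_Seq, rule runs_NAssign, rule runs_Seq, rule runs_mono[OF inner order_refl])
      fix st2
      let ?st1 = "st1\<lparr>nats := store_upd (nats st1) ''dig'' (map (\<lambda>i. nval i st1) [Var ''c'', NConst 0]) (nval (Var ''r'') st1)\<rparr>"
      assume *: "?D (Suc c) st2 \<and> same_except (nat_writes ?i) (real_writes ?i) ?st1 st2"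
      then have f2: "same_except (nat_writes ?i) (real_writes ?i) ?st1 st2"
        by blast
      have "nats st2 ''q'' [] = c div B" "nats st2 ''r'' [] = c mod B" "nats st2 ''base'' [] = B"
        using same_except_nats[OF f2] 5(2) f1 st0 by simp_all
      moreover have "c mod B < B"
        using B by simp
      ultimately show "runs ?f st2 5 (?I (Suc c))"
        using * by (intro runs_loop_free) (auto simp: div_Suc mod_Suc)
    qed (use 5(2,3) f1 st0 in auto)
  next
    case 6
    show ?case
      by (rule loop_time[where c = 11]) (use pos M in auto)
  qed (use st0 in auto)
  have "runs digits st (1 + (1 + 15 * (M * (\<sigma> * 1)))) (?I M)"
    unfolding digits_def
    by (rule runs_Seq, rule runs_NAssign, rule runs_Seq, rule runs_NAssign, rule loop) (use st in simp_all)
  then show ?thesis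
    by (rule runs_mono) (use mult_le_mono[OF M pos(2)] in auto)
qed

definition is_round :: "real \<Rightarrow> nat \<Rightarrow> nat \<Rightarrow> nat \<Rightarrow> nat \<Rightarrow> nat \<Rightarrow> nat \<Rightarrow> bool" where
  "is_round \<delta> B i a j b v \<longleftrightarrow> real v * \<delta> \<le> d i a j b \<and> (v < B \<longrightarrow> d i a j b \<le> (real v + 1) * \<delta>)"

lemma runs_round_dist:
  assumes inp: "holds_input st" and st: "nats st ''base'' [] = B" "reals st ''delta'' [] = \<delta>" and B: "1 \<le> B"
    and v: "nats st ''i'' [] = i" "nats st ''a'' [] = a" "nats st ''j'' [] = j" "nats st ''b'' [] = b"
    and lt: "i < n" "a < m i" "j < n" "b < m j"
  shows "runs round_dist st (5 * (B * 1))
     (\<lambda>st'. \<exists>v. is_round \<delta> B i a j b v \<and> nats st' ''rd'' = (nats st ''rd'')([i, a, j, b] := v))"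
proof -
  let ?b = "BAnd (NLess (Var ''y'') (Var ''base''))
                  (BNot (RLess (RCell ''dist'' [Var ''i'', Var ''a'', Var ''j'', Var ''b''])
                     (RMul (RNat (NAdd (Var ''y'') (NConst 1))) (RCell ''delta'' []))))"
  let ?p = "NAssign ''y'' [] (NAdd (Var ''y'') (NConst 1))"
  let ?e = "NAssign ''rd'' [Var ''i'', Var ''a'', Var ''j'', Var ''b''] (Var ''y'')"
  let ?st = "set_nat ''y'' 0 st"
  let ?I = "\<lambda>y st'. nats st' ''y'' [] = y \<and> y \<le> B \<and> real y * \<delta> \<le> d i a j b"
  have dist: "reals st ''dist'' [i, a, j, b] = d i a j b"
    using input_values(6)[OF inp lt] .
  have "runs (While ?b ?p) ?st (1 + B * (1 + 1)) (\<lambda>st'. (\<exists>i. ?I i st') \<and> \<not> bval ?b st')"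
  proof (rule runs_While)
    show "?I 0 ?st"
      by simp
    fix y st'
    assume I: "?I y st'" and b: "bval ?b st'" and f: "same_except (nat_writes ?p) (real_writes ?p) ?st st'"
    have "nats st' ''base'' [] = B" "reals st' ''delta'' [] = \<delta>" "nats st' ''i'' [] = i" "nats st' ''a'' [] = a"
      "nats st' ''j'' [] = j" "nats st' ''b'' [] = b" "reals st' ''dist'' [i, a, j, b] = d i a j b"
      using same_except_nats[OF f] same_except_reals[OF f] st v dist by simp_all
    with I b show "y < B \<and> runs ?p st' 1 (?I (Suc y))"
      by (auto intro!: runs_loop_free simp: not_less)
  qed
  then have "runs (Seq (While ?b ?p) ?e) ?st ((1 + B * (1 + 1)) + 1)
     (\<lambda>st'. \<exists>v. is_round \<delta> B i a j b v \<and> nats st' ''rd'' = (nats st ''rd'')([i, a, j, b] := v))"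
  proof (rule runs_Seq_frame)
    fix st'
    assume *: "(\<exists>i. ?I i st') \<and> \<not> bval ?b st'"
      and f: "same_except (nat_writes (While ?b ?p)) (real_writes (While ?b ?p)) ?st st'"
    have e: "nats st' ''base'' [] = B" "reals st' ''delta'' [] = \<delta>" "nats st' ''i'' [] = i" "nats st' ''a'' [] = a"
      "nats st' ''j'' [] = j" "nats st' ''b'' [] = b" "reals st' ''dist'' [i, a, j, b] = d i a j b"
      "nats st' ''rd'' = nats st ''rd''"
      using same_except_nats[OF f] same_except_reals[OF f] st v dist by simp_all
    then have "is_round \<delta> B i a j b (nats st' ''y'' [])"
      using * by (auto simp: is_round_def add.commute)
    then show "runs ?e st' 1 (\<lambda>st'. \<exists>v. is_round \<delta> B i a j b v \<and> nats st' ''rd'' = (nats st ''rd'')([i, a, j, b] := v))"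
      using e by (intro runs_NAssign exI[of _ "nats st' ''y'' []"]) (auto simp: store_upd_def)
  qed
  then have "runs round_dist st (1 + ((1 + B * (1 + 1)) + 1))
     (\<lambda>st'. \<exists>v. is_round \<delta> B i a j b v \<and> nats st' ''rd'' = (nats st ''rd'')([i, a, j, b] := v))"
    unfolding round_dist_def by - (rule runs_Seq, rule runs_NAssign, simp add: set_nat_def)
  then show ?thesis
    by (rule runs_time) (use B in simp)
qed

lemma runs_round_all:
  assumes inp: "holds_input st" and st: "nats st ''base'' [] = B" "reals st ''delta'' [] = \<delta>" and B: "1 \<le> B"
  shows "runs round_all st (21 * (n * (\<sigma> * (n * (\<sigma> * (B * 1))))))
     (\<lambda>st'. \<forall>i<n. \<forall>a<m i. \<forall>j<n. \<forall>b<m j. is_round \<delta> B i a j b (nats st' ''rd'' [i, a, j, b]))"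
proof -
  define J where "J = (\<lambda>D (st' :: store). \<forall>(i, a, j, b)\<in>D. is_round \<delta> B i a j b (nats st' ''rd'' [i, a, j, b]))"
  have "runs round_all st (21 * (n * (\<sigma> * (n * (\<sigma> * (B * 1))))))
      (J ({} \<union> (\<Union>i<n. \<Union>a<m i. \<Union>j<n. \<Union>b<m j. {(i, a, j, b)})))"
    unfolding round_all_def
  proof (rule runs_For_table[where T = "17 * (\<sigma> * (n * (\<sigma> * (B * 1))))"], goal_cases)
    case (2 st')
    then show ?case
      using input_values(1)[OF holds_input_same_except[OF 2 inp]] by simp
  next
    case (5 i D1 st1)
    note i = \<open>i < n\<close> and f1 = same_except_nats[OF 5(4)] same_except_reals[OF 5(4)]
    have inp1: "holds_input st1"
      using holds_input_same_except[OF 5(4) inp] by simp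
    have v1: "nats st1 ''i'' [] = i" "nats st1 ''base'' [] = B" "reals st1 ''delta'' [] = \<delta>"
      using 5(3) f1 st by simp_all
    show ?case
    proof (rule runs_For_table[where T = "13 * (n * (\<sigma> * (B * 1)))"], goal_cases)
      case (2 st')
      then show ?case
        using input_values(4)[OF holds_input_same_except[OF 2 inp1] i] same_except_nats[OF 2] v1 by simp
    next
      case (5 a D2 st2)
      note a = \<open>a < m i\<close> and f2 = same_except_nats[OF 5(4)] same_except_reals[OF 5(4)]
      have inp2: "holds_input st2"
        using holds_input_same_except[OF 5(4) inp1] by simp
      have v2: "nats st2 ''i'' [] = i" "nats st2 ''a'' [] = a" "nats st2 ''base'' [] = B" "reals st2 ''delta'' [] = \<delta>"
        using 5(3) f2 v1 by simp_all
      show ?case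
      proof (rule runs_For_table[where T = "9 * (\<sigma> * (B * 1))"], goal_cases)
        case (2 st')
        then show ?case
          using input_values(1)[OF holds_input_same_except[OF 2 inp2]] by simp
      next
        case (5 j D3 st3)
        note j = \<open>j < n\<close> and f3 = same_except_nats[OF 5(4)] same_except_reals[OF 5(4)]
        have inp3: "holds_input st3"
          using holds_input_same_except[OF 5(4) inp2] by simp
        have v3: "nats st3 ''i'' [] = i" "nats st3 ''a'' [] = a" "nats st3 ''j'' [] = j"
            "nats st3 ''base'' [] = B" "reals st3 ''delta'' [] = \<delta>"
          using 5(3) f3 v2 by simp_all
        show ?case
        proof (rule runs_For_table[where T = "5 * (B * 1)"], goal_cases)
          case (2 st')
          then show ?case
            using input_values(4)[OF holds_input_same_except[OF 2 inp3] j] same_except_nats[OF 2] v3 by simp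
        next
          case (5 b D4 st4)
          note f4 = same_except_nats[OF 5(4)] same_except_reals[OF 5(4)]
          have inp4: "holds_input st4"
            using holds_input_same_except[OF 5(4) inp3] by simp
          have v4: "nats st4 ''base'' [] = B" "reals st4 ''delta'' [] = \<delta>"
              "nats st4 ''i'' [] = i" "nats st4 ''a'' [] = a" "nats st4 ''j'' [] = j"
            using f4 v3 by simp_all
          from runs_round_dist[OF inp4 v4(1,2) B v4(3-) 5(3) i a j 5(1)] show ?case
            by (rule runs_mono[OF _ order_refl]) (use 5(2) in \<open>auto simp: J_def\<close>)
        next
          case 6
          show ?case
            by (rule loop_time[where c = 5]) (use B m[OF j] pos in auto)
        qed (use 5 in \<open>auto simp: J_def\<close>)
      next
        case 6
        show ?case
          by (rule loop_time[where c = 9]) (use B pos in \<open>auto simp: Suc_le_eq\<close>)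
      qed (use 5 in \<open>auto simp: J_def\<close>)
    next
      case 6
      show ?case
        by (rule loop_time[where c = 13]) (use B m[OF i] pos in \<open>auto simp: Suc_le_eq\<close>)
    qed (use 5 in \<open>auto simp: J_def\<close>)
  next
    case 6
    show ?case
      by (rule loop_time[where c = 17]) (use B pos in \<open>auto simp: Suc_le_eq\<close>)
  qed (auto simp: J_def)
  then show ?thesis
    by (rule runs_mono[OF _ order_refl]) (auto simp: J_def)
qed

text \<open>The function \<open>rd\<close> is read off the store as it stands, which is why its
  equation ranges over all indices.\<close>

definition holds_tables :: "nat \<Rightarrow> nat \<Rightarrow> (nat \<Rightarrow> nat \<Rightarrow> nat \<Rightarrow> nat \<Rightarrow> nat) \<Rightarrow> store \<Rightarrow> bool" where
  "holds_tables B M rd st \<longleftrightarrow> nats st ''base'' [] = B \<and> nats st ''N'' [] = M \<and>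
     (\<forall>a<\<sigma>. \<forall>v<B. nats st ''pw'' [a, v] = v * B ^ a) \<and>
     (\<forall>c<M. \<forall>a<\<sigma>. nats st ''dig'' [c, a] = digit B c a) \<and>
     (\<forall>i a j b. nats st ''rd'' [i, a, j, b] = rd i a j b)"

lemma holds_tables_same_except:
  assumes "same_except X Y st st'" "holds_tables B M rd st" "X \<inter> {''base'', ''N'', ''pw'', ''dig'', ''rd''} = {}"
  shows "holds_tables B M rd st'"
proof -
  have "x \<in> {''base'', ''N'', ''pw'', ''dig'', ''rd''} \<Longrightarrow> nats st' x = nats st x" for x
    using assms(1,3) unfolding same_except_def by blast
  with assms(2) show ?thesis
    unfolding holds_tables_def by simp
qed

abbreviation longest :: "nat \<Rightarrow> (nat \<Rightarrow> nat \<Rightarrow> nat \<Rightarrow> nat \<Rightarrow> nat) \<Rightarrow> nat \<Rightarrow> nat \<Rightarrow> nat \<Rightarrow> nat \<Rightarrow> nat" where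
  "longest B rd i c j b \<equiv> max_upto (\<lambda>a. digit B c a + rd i a j b) (m i)"

lemma runs_max_length:
  assumes inp: "holds_input st" and tab: "holds_tables B M rd st"
    and v: "nats st ''i'' [] = i" "nats st ''c'' [] = c" "nats st ''j'' [] = j" "nats st ''b'' [] = b"
    and lt: "i < n" "c < M"
  shows "runs max_length st (9 * (\<sigma> * 1)) (\<lambda>st'. nats st' ''mm'' [] = longest B rd i c j b)"
proof -
  let ?p = "Seq (NAssign ''y'' [] (NAdd (NCell ''dig'' [Var ''c'', Var ''a'']) (NCell ''rd'' [Var ''i'', Var ''a'', Var ''j'', Var ''b''])))
            (Cond (NLess (Var ''mm'') (Var ''y'')) (NAssign ''mm'' [] (Var ''y'')) Skip)"
  let ?I = "\<lambda>a st'. nats st' ''mm'' [] = max_upto (\<lambda>a. digit B c a + rd i a j b) a"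
  have "runs (For ''a'' (NCell ''card'' [Var ''i'']) ?p) (set_nat ''mm'' 0 st) (8 * (\<sigma> * 1)) (?I (m i))"
  proof (rule runs_For[where I = ?I and T = 4], goal_cases)
    case (2 st')
    then show ?case
      using same_except_nats[OF 2] v input_values(4)[OF inp lt(1)] by simp
  next
    case (5 a st1)
    have "a < \<sigma>"
      using 5(1) m[OF lt(1)] by simp
    then have e: "nats st1 ''dig'' [c, a] = digit B c a" "nats st1 ''rd'' [i, a, j, b] = rd i a j b"
      "nats st1 ''i'' [] = i" "nats st1 ''c'' [] = c" "nats st1 ''j'' [] = j" "nats st1 ''b'' [] = b"
      using same_except_nats[OF 5(4)] v tab lt by (simp_all add: holds_tables_def)
    show ?case
      by (rule runs_loop_free) (use 5(2,3) in \<open>auto simp: e max_def\<close>)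
  next
    case 6
    show ?case
      by (rule loop_time[where c = 4]) (use m[OF lt(1)] pos in auto)
  qed auto
  then have "runs max_length st (1 + 8 * (\<sigma> * 1)) (?I (m i))"
    unfolding max_length_def by - (rule runs_Seq, rule runs_NAssign, simp add: set_nat_def)
  then show ?thesis
    by (rule runs_time) (use pos in simp)
qed

text \<open>The formula of \<open>next_state\<close> with \<open>M\<close> for the number of states,
  stated outside \<open>rounded_graph\<close>: the relevant instance depends on rounded distances
  found in a store. \<open>runs_refine\<close> identifies the two.\<close>

definition next_value :: "nat \<Rightarrow> nat \<Rightarrow> (nat \<Rightarrow> nat \<Rightarrow> nat \<Rightarrow> nat \<Rightarrow> nat) \<Rightarrow> nat \<Rightarrow> nat \<Rightarrow> nat \<Rightarrow> nat" where
  "next_value B M rd i c j =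
     (\<Sum>b<m j. if longest B rd i c j b < B then longest B rd i c j b * B ^ b else M)"

lemma runs_next_code:
  assumes inp: "holds_input st" and tab: "holds_tables B M rd st"
    and v: "nats st ''i'' [] = i" "nats st ''c'' [] = c" "nats st ''j'' [] = j"
    and lt: "i < n" "c < M" "j < n"
  shows "runs next_code st (19 * (\<sigma> * (\<sigma> * 1)))
    (\<lambda>st'. nats st' ''nxt'' = (nats st ''nxt'')([i, c, j] := next_value B M rd i c j) \<and>
           reals st' ''w'' = (reals st ''w'')([i, c, j] := 0))"
    (is "runs _ _ _ ?Q")
proof -
  let ?c = "Cond (NLess (Var ''mm'') (Var ''base''))
                  (NAssign ''e'' [] (NAdd (Var ''e'') (NCell ''pw'' [Var ''b'', Var ''mm''])))
                  (NAssign ''e'' [] (NAdd (Var ''e'') (Var ''N'')))"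
  let ?l = "For ''b'' (NCell ''card'' [Var ''j'']) (Seq max_length ?c)"
  let ?f = "Seq (NAssign ''nxt'' [Var ''i'', Var ''c'', Var ''j''] (Var ''e''))
          (RAssign ''w'' [Var ''i'', Var ''c'', Var ''j''] (RNat (NConst 0)))"
  let ?st = "set_nat ''e'' 0 st"
  let ?I = "\<lambda>b st'. nats st' ''e'' [] =
     (\<Sum>b<b. if longest B rd i c j b < B then longest B rd i c j b * B ^ b else M)"
  have "runs ?l ?st (16 * (\<sigma> * (\<sigma> * 1))) (?I (m j))"
  proof (rule runs_For[where I = ?I and T = "9 * (\<sigma> * 1) + 3"], goal_cases)
    case (2 st')
    then show ?case
      using same_except_nats[OF 2] v input_values(4)[OF inp lt(3)] by simp
  next
    case (5 b st1)
    have f: "same_except (insert ''e'' (insert ''b'' (nat_writes (Seq max_length ?c)))) (real_writes (Seq max_length ?c)) st st1"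
      using 5(4) by (simp add: same_except_def)
    have inp1: "holds_input st1"
      by (rule holds_input_same_except[OF f inp]) simp_all
    have tab1: "holds_tables B M rd st1"
      by (rule holds_tables_same_except[OF f tab]) simp
    have v1: "nats st1 ''i'' [] = i" "nats st1 ''c'' [] = c" "nats st1 ''j'' [] = j"
      using same_except_nats[OF f] v by simp_all
    show ?case
    proof (rule runs_Seq_frame[OF runs_max_length[OF inp1 tab1 v1 5(3) lt(1,2)]])
      fix st2
      assume mm: "nats st2 ''mm'' [] = longest B rd i c j b"
        and f2: "same_except (nat_writes max_length) (real_writes max_length) st1 st2"
      have "nats st2 ''b'' [] = b" "nats st2 ''e'' [] = nats st1 ''e'' []"
        using same_except_nats[OF f2] 5(3) by simp_all
      moreover have "b < \<sigma>"
        using 5(1) m[OF lt(3)] by simp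
      moreover have "holds_tables B M rd st2"
        by (rule holds_tables_same_except[OF f2 tab1]) simp
      ultimately show "runs ?c st2 3 (?I (Suc b))"
        using 5(2) mm by (intro runs_loop_free) (auto simp: holds_tables_def)
    qed
  next
    case 6
    show ?case
      by (rule loop_time[where c = 12]) (use m[OF lt(3)] pos in auto)
  qed auto
  then have "runs (Seq ?l ?f) ?st (16 * (\<sigma> * (\<sigma> * 1)) + 2) ?Q"
  proof (rule runs_Seq_frame)
    fix st1
    assume I: "?I (m j) st1" and f: "same_except (nat_writes ?l) (real_writes ?l) ?st st1"
    have "nats st1 ''i'' [] = i" "nats st1 ''c'' [] = c" "nats st1 ''j'' [] = j"
        "nats st1 ''nxt'' = nats st ''nxt''" "reals st1 ''w'' = reals st ''w''"
      using same_except_nats[OF f] same_except_reals[OF f] v by simp_all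
    with I show "runs ?f st1 2 ?Q"
      by (intro runs_loop_free) (auto simp: store_upd_def next_value_def)
  qed
  then have "runs next_code st (1 + (16 * (\<sigma> * (\<sigma> * 1)) + 2)) ?Q"
    unfolding next_code_def by - (rule runs_Seq, rule runs_NAssign, simp add: set_nat_def)
  then show ?thesis
    by (rule runs_time) (use pos in simp)
qed

lemma runs_next_codes:
  assumes inp: "holds_input st" and tab: "holds_tables B M rd st" and M: "1 \<le> M"
  shows "runs next_codes st (31 * (n * (M * (n * (\<sigma> * (\<sigma> * 1))))))
    (\<lambda>st'. \<forall>i<n. \<forall>c<M. \<forall>j<n. nats st' ''nxt'' [i, c, j] = next_value B M rd i c j \<and> reals st' ''w'' [i, c, j] = 0)"
proof -
  define J where "J = (\<lambda>D (st' :: store). \<forall>(i, c, j)\<in>D. nats st' ''nxt'' [i, c, j] = next_value B M rd i c j \<and> reals st' ''w'' [i, c, j] = 0)"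
  have "runs next_codes st (31 * (n * (M * (n * (\<sigma> * (\<sigma> * 1))))))
      (J ({} \<union> (\<Union>i<n. \<Union>c<M. \<Union>j<n. {(i, c, j)})))"
    unfolding next_codes_def
  proof (rule runs_For_table[where T = "27 * (M * (n * (\<sigma> * (\<sigma> * 1))))"], goal_cases)
    case (2 st')
    then show ?case
      using input_values(1)[OF holds_input_same_except[OF 2 inp]] by simp
  next
    case (5 i D1 st1)
    note i = \<open>i < n\<close>
    have inp1: "holds_input st1" and tab1: "holds_tables B M rd st1"
      using holds_input_same_except[OF 5(4) inp] holds_tables_same_except[OF 5(4) tab] by simp_all
    have v1: "nats st1 ''i'' [] = i"
      using 5(3) by simp
    show ?case
    proof (rule runs_For_table[where T = "23 * (n * (\<sigma> * (\<sigma> * 1)))"], goal_cases)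
      case (2 st')
      then show ?case
        using holds_tables_same_except[OF 2 tab1] by (simp add: holds_tables_def)
    next
      case (5 c D2 st2)
      note c = \<open>c < M\<close>
      have inp2: "holds_input st2" and tab2: "holds_tables B M rd st2"
        using holds_input_same_except[OF 5(4) inp1] holds_tables_same_except[OF 5(4) tab1] by simp_all
      have v2: "nats st2 ''i'' [] = i" "nats st2 ''c'' [] = c"
        using 5(3) same_except_nats[OF 5(4)] v1 by simp_all
      show ?case
      proof (rule runs_For_table[where T = "19 * (\<sigma> * (\<sigma> * 1))"], goal_cases)
        case (2 st')
        then show ?case
          using input_values(1)[OF holds_input_same_except[OF 2 inp2]] by simp
      next
        case (5 j D3 st3)
        have inp3: "holds_input st3" and tab3: "holds_tables B M rd st3"
          using holds_input_same_except[OF 5(4) inp2] holds_tables_same_except[OF 5(4) tab2] by simp_all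
        have v3: "nats st3 ''i'' [] = i" "nats st3 ''c'' [] = c"
          using same_except_nats[OF 5(4)] v2 by simp_all
        from runs_next_code[OF inp3 tab3 v3 5(3) i c 5(1)] show ?case
          by (rule runs_mono[OF _ order_refl]) (use 5(2) in \<open>auto simp: J_def\<close>)
      next
        case 6
        show ?case
          by (rule loop_time[where c = 19]) (use pos in auto)
      qed (use 5 in \<open>auto simp: J_def\<close>)
    next
      case 6
      show ?case
        by (rule loop_time[where c = 23]) (use M pos in \<open>auto simp: Suc_le_eq\<close>)
    qed (use 5 in \<open>auto simp: J_def\<close>)
  next
    case 6
    show ?case
      by (rule loop_time[where c = 27]) (use M pos in \<open>auto simp: Suc_le_eq\<close>)
  qed (auto simp: J_def)
  then show ?thesis
    by (rule runs_mono[OF _ order_refl]) (auto simp: J_def)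
qed

lemma runs_final_values:
  assumes inp: "holds_input st" and tab: "holds_tables B M rd st" and M: "1 \<le> M"
  shows "runs final_values st (13 * (M * (\<sigma> * 1)))
    (\<lambda>st'. \<forall>c<M. reals st' ''fin'' [c] = real (max_upto (digit B c) (m t)))"
proof -
  let ?p = "Cond (NLess (Var ''mm'') (NCell ''dig'' [Var ''c'', Var ''a'']))
               (NAssign ''mm'' [] (NCell ''dig'' [Var ''c'', Var ''a''])) Skip"
  let ?l = "For ''a'' (NCell ''card'' [Var ''t'']) ?p"
  let ?f = "RAssign ''fin'' [Var ''c''] (RNat (Var ''mm''))"
  show ?thesis
    unfolding final_values_def
  proof (rule runs_For[where I = "\<lambda>c st'. \<forall>c'<c. reals st' ''fin'' [c'] = real (max_upto (digit B c') (m t))"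
        and T = "1 + (7 * (\<sigma> * 1) + 1)"], goal_cases)
    case (2 st')
    then show ?case
      using holds_tables_same_except[OF 2 tab] by (simp add: holds_tables_def)
  next
    case (5 c st1)
    note c = \<open>c < M\<close>
    have inp1: "holds_input st1" and tab1: "holds_tables B M rd st1"
      using holds_input_same_except[OF 5(4) inp] holds_tables_same_except[OF 5(4) tab] by simp_all
    let ?st1 = "set_nat ''mm'' 0 st1"
    have "runs ?l ?st1 (7 * (\<sigma> * 1)) (\<lambda>st'. nats st' ''mm'' [] = max_upto (digit B c) (m t))"
    proof (rule runs_For[where I = "\<lambda>a st'. nats st' ''mm'' [] = max_upto (digit B c) a" and T = 3], goal_cases)
      case (2 st')
      then show ?case
        using same_except_nats[OF 2] input_values(3,4)[OF inp1] t by simp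
    next
      case (5 a st2)
      have "a < \<sigma>"
        using 5(1) m[OF t] by simp
      then have e: "nats st2 ''dig'' [c, a] = digit B c a" "nats st2 ''c'' [] = c"
        using same_except_nats[OF 5(4)] \<open>nats st1 ''c'' [] = c\<close> tab1 c by (simp_all add: holds_tables_def)
      show ?case
        by (rule runs_loop_free) (use 5(2,3) in \<open>auto simp: e max_def\<close>)
    next
      case 6
      show ?case
        by (rule loop_time[where c = 3]) (use m[OF t] pos in auto)
    qed auto
    then have "runs (Seq ?l ?f) ?st1 (7 * (\<sigma> * 1) + 1)
       (\<lambda>st'. \<forall>c'<Suc c. reals st' ''fin'' [c'] = real (max_upto (digit B c') (m t)))"
    proof (rule runs_Seq_frame)
      fix st2
      assume mm: "nats st2 ''mm'' [] = max_upto (digit B c) (m t)" and f: "same_except (nat_writes ?l) (real_writes ?l) ?st1 st2"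
      have "nats st2 ''c'' [] = c" "reals st2 ''fin'' = reals st1 ''fin''"
        using same_except_nats[OF f] same_except_reals[OF f] 5(3) by simp_all
      then show "runs ?f st2 1 (\<lambda>st'. \<forall>c'<Suc c. reals st' ''fin'' [c'] = real (max_upto (digit B c') (m t)))"
        using mm 5(2) by (intro runs_loop_free) (auto simp: less_Suc_eq)
    qed
    then show ?case
      by - (rule runs_Seq, rule runs_NAssign, simp add: set_nat_def)
  next
    case 6
    show ?case
      by (rule loop_time[where c = 9]) (use M pos in auto)
  qed auto
qed

end

subsection \<open>The approximation scheme\<close>

text \<open>\<open>delta\<close> is computed before the second search overwrites
  \<open>best\<close>, which still holds the length found by the first.\<close>

definition refine :: com where
  "refine = Seq compute_base (Seq powers (Seq digits
     (Seq (RAssign ''delta'' [] (RDiv (RMul (RCell ''eps'' []) (RCell ''best'' [])) (RNat (NAdd (Var ''n'') (Var ''n'')))))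
     (Seq round_all (Seq next_codes (Seq final_values (layered ''R2'')))))))"

text \<open>The first search runs on the initial zeros of \<open>nxt\<close> and \<open>fin\<close>:
  they are the single state and a vanishing final value. Both searches write to \<open>path\<close>
  and \<open>len\<close>, so omitting the refinement leaves the first path as the answer.\<close>

definition scheme :: com where
  "scheme = Seq count_positions (Seq weights (Seq (NAssign ''N'' [] (NConst 1)) (Seq (layered ''R1'')
     (Cond (BAnd (NLess (NConst 0) (Var ''found'')) (BAnd (RLess (RCell ''eps'' []) (RNat (NConst 1)))
              (BAnd (NLess (NConst 2) (Var ''n'')) (RLess (RNat (NConst 0)) (RCell ''best'' [])))))
        refine Skip))))"

lemma (in rsp) output_path_vertices:
  assumes "nats st ''len'' [] = Suc L" "\<forall>k\<le>L. nats st ''path'' [k] = p k"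
  shows "output_path st = vertices p L"
  unfolding output_path_def vertices_def assms(1) using assms(2) by (intro map_cong) auto

context rsp_weighted
begin

text \<open>Each of the eight stages costs a constant times at most
  \<open>n * n * n * (\<sigma> * \<sigma>) * base ^ \<sigma>\<close>; the constants 4, 14, 17, 1,
  21, 31, 13 and 64 add up to 165. A single factor \<open>base\<close> is absorbed because
  \<open>1 \<le> \<sigma>\<close>.\<close>

lemma runs_refine:
  assumes inp: "holds_input st" and sig: "nats st ''sig'' [] = \<sigma>"
    and p1: "wg.lex_min p1 L1" and best: "reals st ''best'' [] = upper p1 L1" and pos1: "0 < upper p1 L1"
    and fresh: "\<And>ix. nats st ''R2'' ix = 0"
  shows "runs refine st (165 * (n * n * n * (\<sigma> * \<sigma>) * base ^ \<sigma>)) (\<lambda>st'. correct_answer I \<epsilon> (output_path st'))"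
    (is "runs _ _ _ ?Q")
proof -
  define B where "B = base"
  define M where "M = B ^ \<sigma>"
  define \<delta> where "\<delta> = \<epsilon> * upper p1 L1 / (2 * real n)"
  have B: "1 \<le> B" and M: "1 \<le> M"
    using base_pos by (simp_all add: B_def M_def)
  let ?delta = "RAssign ''delta'' [] (RDiv (RMul (RCell ''eps'' []) (RCell ''best'' [])) (RNat (NAdd (Var ''n'') (Var ''n''))))"
  have "runs refine st (4 * B + (14 * (\<sigma> * (B * 1)) + (17 * (M * (\<sigma> * 1)) + (1 + (21 * (n * (\<sigma> * (n * (\<sigma> * (B * 1))))) +
      (31 * (n * (M * (n * (\<sigma> * (\<sigma> * 1))))) + (13 * (M * (\<sigma> * 1)) + 64 * (n * (n * (M * n)))))))))) ?Q"
    unfolding refine_def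
  proof (rule runs_Seq_frame[OF runs_compute_base[OF inp, folded B_def]])
    fix st1
    assume base1: "nats st1 ''base'' [] = B" and f: "same_except (nat_writes compute_base) (real_writes compute_base) st st1"
    have inp1: "holds_input st1" and sig1: "nats st1 ''sig'' [] = \<sigma>"
      using holds_input_same_except[OF f inp] same_except_nats[OF f] sig by simp_all
    have best1: "reals st1 ''best'' [] = upper p1 L1" and fresh1: "nats st1 ''R2'' = nats st ''R2''"
      using same_except_nats[OF f] same_except_reals[OF f] best by simp_all
    show "runs (Seq powers (Seq digits (Seq ?delta (Seq round_all (Seq next_codes (Seq final_values (layered ''R2''))))))) st1
      (14 * (\<sigma> * (B * 1)) + (17 * (M * (\<sigma> * 1)) + (1 + (21 * (n * (\<sigma> * (n * (\<sigma> * (B * 1))))) +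
      (31 * (n * (M * (n * (\<sigma> * (\<sigma> * 1))))) + (13 * (M * (\<sigma> * 1)) + 64 * (n * (n * (M * n))))))))) ?Q"
    proof (rule runs_Seq_frame[OF runs_powers[OF base1 sig1 B]], fold M_def, elim conjE)
      fix st2
      assume N2: "nats st2 ''N'' [] = M" and pw2: "\<forall>a<\<sigma>. \<forall>v<B. nats st2 ''pw'' [a, v] = v * B ^ a"
        and f: "same_except (nat_writes powers) (real_writes powers) st1 st2"
      have inp2: "holds_input st2" and sig2: "nats st2 ''sig'' [] = \<sigma>" and base2: "nats st2 ''base'' [] = B"
        using holds_input_same_except[OF f inp1] same_except_nats[OF f] sig1 base1 by simp_all
      have best2: "reals st2 ''best'' [] = upper p1 L1" and fresh2: "nats st2 ''R2'' = nats st ''R2''"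
        using same_except_nats[OF f] same_except_reals[OF f] best1 fresh1 by simp_all
      show "runs (Seq digits (Seq ?delta (Seq round_all (Seq next_codes (Seq final_values (layered ''R2'')))))) st2
        (17 * (M * (\<sigma> * 1)) + (1 + (21 * (n * (\<sigma> * (n * (\<sigma> * (B * 1))))) +
        (31 * (n * (M * (n * (\<sigma> * (\<sigma> * 1))))) + (13 * (M * (\<sigma> * 1)) + 64 * (n * (n * (M * n)))))))) ?Q"
      proof (rule runs_Seq_frame[OF runs_digits[OF base2 sig2 N2 B M]])
        fix st3
        assume dig3: "\<forall>c<M. \<forall>a\<le>\<sigma>. nats st3 ''dig'' [c, a] = digit B c a"
          and f: "same_except (nat_writes digits) (real_writes digits) st2 st3"
        let ?st3 = "st3\<lparr>reals := store_upd (reals st3) ''delta'' (map (\<lambda>i. nval i st3) [])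
            (rval (RDiv (RMul (RCell ''eps'' []) (RCell ''best'' [])) (RNat (NAdd (Var ''n'') (Var ''n'')))) st3)\<rparr>"
        have f3: "same_except (nat_writes digits) (insert ''delta'' (real_writes digits)) st2 ?st3"
          using f by (auto simp: same_except_def)
        have inp3: "holds_input ?st3"
          using holds_input_same_except[OF f3 inp2] by simp
        have base3: "nats ?st3 ''base'' [] = B" and N3: "nats ?st3 ''N'' [] = M" and fresh3: "nats ?st3 ''R2'' = nats st ''R2''"
            and pw3: "\<forall>a<\<sigma>. \<forall>v<B. nats ?st3 ''pw'' [a, v] = v * B ^ a"
          using same_except_nats[OF f3] base2 N2 pw2 fresh2 by simp_all
        have "reals st3 ''best'' [] = upper p1 L1" "reals st3 ''eps'' [] = \<epsilon>" "nats st3 ''n'' [] = n"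
          using same_except_reals[OF f] same_except_nats[OF f] best2 input_values[OF inp2] by simp_all
        then have delta3: "reals ?st3 ''delta'' [] = \<delta>"
          by (simp add: \<delta>_def)
        have dig3': "\<forall>c<M. \<forall>a<\<sigma>. nats ?st3 ''dig'' [c, a] = digit B c a"
          using dig3 by simp
        show "runs (Seq ?delta (Seq round_all (Seq next_codes (Seq final_values (layered ''R2''))))) st3
          (1 + (21 * (n * (\<sigma> * (n * (\<sigma> * (B * 1))))) +
          (31 * (n * (M * (n * (\<sigma> * (\<sigma> * 1))))) + (13 * (M * (\<sigma> * 1)) + 64 * (n * (n * (M * n))))))) ?Q"
        proof (rule runs_Seq, rule runs_NAssign runs_RAssign, rule runs_Seq_frame[OF runs_round_all[OF inp3 base3 delta3 B]])
          fix st4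
          assume rd4: "\<forall>i<n. \<forall>a<m i. \<forall>j<n. \<forall>b<m j. is_round \<delta> B i a j b (nats st4 ''rd'' [i, a, j, b])"
            and f: "same_except (nat_writes round_all) (real_writes round_all) ?st3 st4"
          define rd where "rd = (\<lambda>i a j b. nats st4 ''rd'' [i, a, j, b])"
          \<comment> \<open>The rounded distances are whatever the table now holds, so this instance
            can only be formed at this point of the execution.\<close>
          interpret rsp_rounded I pt \<epsilon> wt p1 L1 B \<delta> rd
            by unfold_locales (use p1 pos1 base_gt rd4 in \<open>auto simp: \<delta>_def B_def rd_def is_round_def\<close>)
          have inp4: "holds_input st4"
            by (rule holds_input_same_except[OF f inp3]) simp_all
          have tab4: "holds_tables B M rd st4"
            using same_except_nats[OF f] base3 N3 pw3 dig3' by (simp add: holds_tables_def rd_def)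
          have fresh4: "nats st4 ''R2'' = nats st ''R2''"
            using same_except_nats[OF f] fresh3 by simp
          show "runs (Seq next_codes (Seq final_values (layered ''R2''))) st4
            (31 * (n * (M * (n * (\<sigma> * (\<sigma> * 1))))) + (13 * (M * (\<sigma> * 1)) + 64 * (n * (n * (M * n))))) ?Q"
          proof (rule runs_Seq_frame[OF runs_next_codes[OF inp4 tab4 M]])
            fix st5
            assume nxt5: "\<forall>i<n. \<forall>c<M. \<forall>j<n. nats st5 ''nxt'' [i, c, j] = next_value B M rd i c j \<and> reals st5 ''w'' [i, c, j] = 0"
              and f: "same_except (nat_writes next_codes) (real_writes next_codes) st4 st5"
            have inp5: "holds_input st5"
              by (rule holds_input_same_except[OF f inp4]) simp_all
            have tab5: "holds_tables B M rd st5"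
              by (rule holds_tables_same_except[OF f tab4]) simp
            have fresh5: "nats st5 ''R2'' = nats st ''R2''"
              using same_except_nats[OF f] fresh4 by simp
            show "runs (Seq final_values (layered ''R2'')) st5 (13 * (M * (\<sigma> * 1)) + 64 * (n * (n * (M * n)))) ?Q"
            proof (rule runs_Seq_frame[OF runs_final_values[OF inp5 tab5 M]])
              fix st6
              assume fin6: "\<forall>c<M. reals st6 ''fin'' [c] = real (max_upto (digit B c) (m t))"
                and f: "same_except (nat_writes final_values) (real_writes final_values) st5 st6"
              have inp6: "holds_input st6"
                by (rule holds_input_same_except[OF f inp5]) simp_all
              have tab6: "holds_tables B M rd st6"
                by (rule holds_tables_same_except[OF f tab5]) simp
              have "nats st6 ''nxt'' = nats st5 ''nxt''" "reals st6 ''w'' = reals st5 ''w''"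
                using same_except_nats[OF f] same_except_reals[OF f] by simp_all
              moreover have "next_value B M rd i c j = rg.next_state i c j" for i c j
                unfolding next_value_def rg.next_state_def rg.mx_def M_def by (rule refl)
              ultimately have enc: "rg.encodes st6"
                using inp6 tab6 nxt5 fin6 by (simp add: rg.encodes_def holds_input_def holds_tables_def M_def)
              have "nats st6 ''R2'' [h, i, c] = 0" for h i c
                using same_except_nats[OF f, of "''R2''"] fresh5 fresh by simp
              from rg.runs_layered[OF enc this]
              show "runs (layered ''R2'') st6 (64 * (n * (n * (M * n)))) ?Q"
                unfolding M_def if_P[OF exists_rounded_walk]
                by (rule runs_mono[OF _ order_refl]) (metis output_path_vertices lex_min_rounded_correct)
            qed
          qed
        qed
      qed
    qed
  qed
  then show ?thesis
  proof (rule runs_time)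
    let ?X = "n * n * n * (\<sigma> * \<sigma>) * M"
    have n3: "1 \<le> n * n * n" "n * n \<le> n * n * n"
      using pos by (simp_all add: Suc_le_eq)
    have s2: "1 \<le> \<sigma> * \<sigma>" "\<sigma> \<le> \<sigma> * \<sigma>"
      using pos by (simp_all add: Suc_le_eq)
    have BM: "B \<le> M"
      using power_increasing[of 1 \<sigma> B] pos B by (simp add: M_def)
    have t1: "B \<le> ?X"
      using mult_le_mono[OF mult_le_mono[OF n3(1) s2(1)] BM] by simp
    have t2: "\<sigma> * (B * 1) \<le> ?X"
      using mult_le_mono[OF mult_le_mono[OF n3(1) s2(2)] BM] by simp
    have t3: "M * (\<sigma> * 1) \<le> ?X"
      using mult_le_mono[OF mult_le_mono[OF n3(1) s2(2)] order_refl[of M]] by (simp add: mult_ac)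
    have t4: "n * (\<sigma> * (n * (\<sigma> * (B * 1)))) \<le> ?X"
      using mult_le_mono[OF mult_le_mono[OF n3(2) order_refl[of "\<sigma> * \<sigma>"]] BM] by (simp add: mult_ac)
    have t5: "n * (M * (n * (\<sigma> * (\<sigma> * 1)))) \<le> ?X"
      using mult_le_mono[OF mult_le_mono[OF n3(2) order_refl[of "\<sigma> * \<sigma>"]] order_refl[of M]] by (simp add: mult_ac)
    have t6: "n * (n * (M * n)) \<le> ?X"
      using mult_le_mono[OF mult_le_mono[OF order_refl[of "n * n * n"] s2(1)] order_refl[of M]] by (simp add: mult_ac)
    have "1 \<le> ?X"
      using t1 B by linarith
    with t1 t2 t3 t4 t5 t6 show "4 * B + (14 * (\<sigma> * (B * 1)) + (17 * (M * (\<sigma> * 1)) + (1 + (21 * (n * (\<sigma> * (n * (\<sigma> * (B * 1))))) +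
      (31 * (n * (M * (n * (\<sigma> * (\<sigma> * 1))))) + (13 * (M * (\<sigma> * 1)) + 64 * (n * (n * (M * n))))))))) \<le>
      165 * (n * n * n * (\<sigma> * \<sigma>) * base ^ \<sigma>)"
      unfolding M_def[symmetric] B_def[symmetric] by linarith
  qed
qed

end

context rsp
begin

lemma holds_input_input_store: "holds_input (input_store I pt \<epsilon>)"
  by (simp add: holds_input_def input_store_def input_nats_def input_reals_def)

text \<open>95 adds 7, 21, 1 and 64 for the stages before the branch and 2 for the branch. The cost
  of refining is charged conditionally, because outside that case \<open>base\<close> may exceed
  both 1 and n^2/\<epsilon>.\<close>

lemma runs_scheme:
  "runs scheme (input_store I pt \<epsilon>)
     (95 * (n * n * n * (\<sigma> * \<sigma>)) + (if \<epsilon> < 1 \<and> 2 < n then 165 * (n * n * n * (\<sigma> * \<sigma>) * base ^ \<sigma>) else 0))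
     (\<lambda>st'. correct_answer I \<epsilon> (output_path st'))"
    (is "runs _ _ (_ + ?T) ?Q")
proof -
  let ?st = "input_store I pt \<epsilon>"
  let ?b = "BAnd (NLess (NConst 0) (Var ''found'')) (BAnd (RLess (RCell ''eps'' []) (RNat (NConst 1)))
              (BAnd (NLess (NConst 2) (Var ''n'')) (RLess (RNat (NConst 0)) (RCell ''best'' []))))"
  let ?c = "Cond ?b refine Skip"
  have sig0: "nats ?st ''sig'' [] = 0"
    by (simp add: input_store_def input_nats_def)
  have "runs scheme ?st (7 * (n * 1) + (21 * (n * (n * (\<sigma> * (\<sigma> * 1)))) + (1 + (64 * (n * (n * (Suc 0 * n))) + (1 + (?T + 1)))))) ?Q"
    unfolding scheme_def
  proof (rule runs_Seq_frame[OF runs_count_positions[OF holds_input_input_store sig0]])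
    fix st1
    assume sig1: "nats st1 ''sig'' [] = \<sigma>"
      and f1: "same_except (nat_writes count_positions) (real_writes count_positions) ?st st1"
    have inp1: "holds_input st1"
      by (rule holds_input_same_except[OF f1 holds_input_input_store]) simp_all
    show "runs (Seq weights (Seq (NAssign ''N'' [] (NConst 1)) (Seq (layered ''R1'') ?c))) st1
       (21 * (n * (n * (\<sigma> * (\<sigma> * 1)))) + (1 + (64 * (n * (n * (Suc 0 * n))) + (1 + (?T + 1))))) ?Q"
    proof (rule runs_Seq_frame[OF runs_weights[OF inp1]])
      fix st2
      assume w2: "\<forall>i<n. \<forall>j<n. is_max_dist i j (reals st2 ''w'' [i, 0, j])"
        and f2: "same_except (nat_writes weights) (real_writes weights) st1 st2"
      define wt where "wt = (\<lambda>i j. reals st2 ''w'' [i, 0, j])"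
      interpret rsp_weighted I pt \<epsilon> wt
        by unfold_locales (use w2 in \<open>auto simp: is_max_dist_def wt_def\<close>)
      let ?st2 = "set_nat ''N'' 1 st2"
      have e2: "st2\<lparr>nats := store_upd (nats st2) ''N'' (map (\<lambda>i. nval i st2) []) (nval (NConst 1) st2)\<rparr> = ?st2"
        by (simp add: set_nat_def)
      have inp2: "holds_input ?st2"
        using holds_input_same_except[OF f2 inp1] by (simp add: holds_input_def)
      have zero: "nats ?st2 ''nxt'' ix = 0" "nats ?st2 ''R1'' ix = 0" "nats ?st2 ''R2'' ix = 0" "nats ?st2 ''len'' ix = 0"
          "reals ?st2 ''fin'' ix = 0" for ix
        using same_except_nats[OF f2] same_except_nats[OF f1] same_except_reals[OF f2] same_except_reals[OF f1]
        by (simp_all add: input_store_def input_nats_def input_reals_def)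
      have sig2: "nats ?st2 ''sig'' [] = \<sigma>"
        using same_except_nats[OF f2] sig1 by simp
      have enc: "wg.encodes ?st2"
        unfolding wg.encodes_def using inp2 zero by (simp add: holds_input_def wt_def)
      note L = wg.runs_layered[of ?st2 "''1''", OF enc zero(2)]
      show "runs (Seq (NAssign ''N'' [] (NConst 1)) (Seq (layered ''R1'') ?c)) st2
         (1 + (64 * (n * (n * (Suc 0 * n))) + (1 + (?T + 1)))) ?Q"
      proof (rule runs_Seq, rule runs_NAssign, unfold e2, rule runs_Seq_frame[OF L])
        fix st3
        assume post: "if \<exists>q M. wg.st_walk q M
           then \<exists>p L. wg.lex_min p L \<and> 0 < nats st3 ''found'' [] \<and> reals st3 ''best'' [] = wg.objective p L \<and>
              nats st3 ''len'' [] = Suc L \<and> (\<forall>k\<le>L. nats st3 ''path'' [k] = p k)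
           else nats st3 ''found'' [] = 0 \<and> nats st3 ''len'' = nats ?st2 ''len''"
          and f3: "same_except (nat_writes (layered ''R1'')) (real_writes (layered ''R1'')) ?st2 st3"
        have inp3: "holds_input st3"
          by (rule holds_input_same_except[OF f3 inp2]) simp_all
        have sig3: "nats st3 ''sig'' [] = \<sigma>" and fresh3: "nats st3 ''R2'' ix = 0" for ix
          using same_except_nats[OF f3] sig2 zero(3) by simp_all
        show "runs ?c st3 (1 + (?T + 1)) ?Q"
        proof (cases "\<exists>q M. wg.st_walk q M")
          case False
          then have "nats st3 ''found'' [] = 0" "nats st3 ''len'' [] = 0"
            using post zero(4) by simp_all
          moreover have "\<not> (\<exists>Q. st_path I Q)"
            using False simple_st_walk st_path_obtain by metis
          ultimately show ?thesis
            by (intro runs_Cond runs_Skip) (simp_all add: correct_answer_def output_path_def)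
        next
          case True
          then obtain p L where p: "wg.lex_min p L" "reals st3 ''best'' [] = upper p L"
              "nats st3 ''len'' [] = Suc L" "\<forall>k\<le>L. nats st3 ''path'' [k] = p k" "0 < nats st3 ''found'' []"
            using post by (auto simp: upper_def wg.objective_eq)
          show ?thesis
          proof (rule runs_Cond)
            assume "bval ?b st3"
            then have "\<epsilon> < 1" "2 < n" "0 < upper p L"
              using input_values[OF inp3] p(2) by simp_all
            then show "runs refine st3 ?T ?Q"
              using runs_refine[OF inp3 sig3 p(1,2) _ fresh3] by simp
          next
            assume "\<not> bval ?b st3"
            then have "1 \<le> \<epsilon> \<or> n \<le> 2 \<or> upper p L \<le> 0"
              using input_values[OF inp3] p(2,5) by auto
            then show "runs Skip st3 1 ?Q"
              using lex_min_correct[OF p(1)] output_path_vertices[OF p(3,4)] by (intro runs_Skip) simp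
          qed
        qed
      qed
    qed
  qed
  then show ?thesis
  proof (rule runs_time)
    let ?Y = "n * n * n * (\<sigma> * \<sigma>)"
    have n3: "1 \<le> n * n * n" "n \<le> n * n * n" "n * n \<le> n * n * n"
      using pos by (simp_all add: Suc_le_eq)
    have s2: "1 \<le> \<sigma> * \<sigma>"
      using pos by (simp add: Suc_le_eq)
    have "1 \<le> ?Y" "n * 1 \<le> ?Y" "n * (n * (\<sigma> * (\<sigma> * 1))) \<le> ?Y" "n * (n * (Suc 0 * n)) \<le> ?Y"
      using mult_le_mono[OF n3(1) s2] mult_le_mono[OF n3(2) s2] mult_le_mono[OF n3(3) order_refl[of "\<sigma> * \<sigma>"]]
        mult_le_mono[OF order_refl[of "n * n * n"] s2] by (simp_all add: mult_ac)
    then show "7 * (n * 1) + (21 * (n * (n * (\<sigma> * (\<sigma> * 1)))) + (1 + (64 * (n * (n * (Suc 0 * n))) + (1 + (?T + 1)))))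
        \<le> 95 * ?Y + ?T"
      by linarith
  qed
qed

text \<open>From 2n + \<epsilon> \<le> 3n \<le> n^2. No constant factor appears, as required for
  raising both sides to the power \<sigma>.\<close>

lemma base_le_square_div:
  assumes "\<epsilon> < 1" "2 < n"
  shows "real base \<le> real n ^ 2 / \<epsilon>"
proof -
  have "3 * real n \<le> real n * real n"
    using assms(2) by (intro mult_right_mono) auto
  moreover have "3 \<le> real n"
    using assms(2) by simp
  ultimately have "2 * real n + \<epsilon> \<le> real n ^ 2"
    using assms(1) unfolding power2_eq_square by linarith
  have "real base \<le> 2 * real n / \<epsilon> + 1"
    by (rule base_le)
  also have "\<dots> = (2 * real n + \<epsilon>) / \<epsilon>"
    using eps by (simp add: field_simps)
  also have "\<dots> \<le> real n ^ 2 / \<epsilon>"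
    using \<open>2 * real n + \<epsilon> \<le> real n ^ 2\<close> eps by (intro divide_right_mono) auto
  finally show ?thesis .
qed

text \<open>260 is 95 + 165. Where the refinement is skipped, the maximum with 1 in
  \<open>time_bound\<close> absorbs the missing power.\<close>

lemma scheme_approximates: "approximates_within scheme I pt \<epsilon> (260 * time_bound I \<epsilon>)"
proof -
  let ?Y = "real n ^ 3 * real \<sigma> ^ 2"
  let ?Z = "max 1 (real n ^ 2 / \<epsilon>) ^ \<sigma>"
  define T where "T = 95 * (n * n * n * (\<sigma> * \<sigma>)) +
    (if \<epsilon> < 1 \<and> 2 < n then 165 * (n * n * n * (\<sigma> * \<sigma>) * base ^ \<sigma>) else 0)"
  obtain k st where k: "exec scheme (input_store I pt \<epsilon>) k st" "k \<le> T" "correct_answer I \<epsilon> (output_path st)"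
    using runs_scheme unfolding runs_def T_def by blast
  have "1 \<le> ?Z"
    by (rule one_le_power) simp
  then have Y: "?Y \<le> ?Y * ?Z" "0 \<le> ?Y * ?Z"
    using mult_left_mono[of 1 ?Z ?Y] by simp_all
  have "real T \<le> 260 * (?Y * ?Z)"
  proof (cases "\<epsilon> < 1 \<and> 2 < n")
    case True
    have "real base ^ \<sigma> \<le> ?Z"
      using base_le_square_div True by (intro power_mono) (auto simp: le_max_iff_disj)
    then have "?Y * real base ^ \<sigma> \<le> ?Y * ?Z"
      by (intro mult_left_mono) auto
    moreover have "real T = 95 * ?Y + 165 * (?Y * real base ^ \<sigma>)"
      using True by (simp add: T_def power2_eq_square power3_eq_cube)
    ultimately show ?thesis
      using Y by linarith
  next
    case False
    have "real T = 95 * ?Y"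
      unfolding T_def if_not_P[OF False] by (simp add: power2_eq_square power3_eq_cube)
    with Y show ?thesis
      by linarith
  qed
  then have "real k \<le> 260 * time_bound I \<epsilon>"
    using k(2) unfolding time_bound_def by linarith
  with k show ?thesis
    unfolding approximates_within_def by blast
qed

text \<open>The adjacency matrix puts n^2 into the input size, so n^2 and 1/\<epsilon> are both at
  most the base on the right, and n^2/\<epsilon> is at most its square. For fixed \<sigma> the
  exponent and the factor \<open>\<sigma>^2\<close> are constants.\<close>

lemma time_bound_le_input_size:
  "time_bound I \<epsilon> \<le> real \<sigma> ^ 2 * (real (input_size I) + 1 / \<epsilon>) ^ (3 + 2 * \<sigma>)"
proof -
  define X where "X = real (input_size I) + 1 / \<epsilon>"
  have S: "n ^ 2 + 1 \<le> input_size I" "n \<le> input_size I"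
    by (simp_all add: input_size_def)
  have "real n ^ 2 + 1 \<le> real (input_size I)"
    using S(1) by (metis of_nat_1 of_nat_add of_nat_mono of_nat_power)
  moreover have "0 < 1 / \<epsilon>" "real n \<le> real (input_size I)"
    using eps S(2) by simp_all
  ultimately have X: "real n ^ 2 \<le> X" "1 \<le> X" "1 / \<epsilon> \<le> X" "real n \<le> X"
    using zero_le_power2[of "real n"] unfolding X_def by linarith+
  have "real n ^ 2 * (1 / \<epsilon>) \<le> X * X"
    using X eps by (intro mult_mono) auto
  moreover have "1 \<le> X * X"
    using mult_mono[OF X(2) X(2)] X(2) by simp
  ultimately have Z: "max 1 (real n ^ 2 / \<epsilon>) \<le> X ^ 2"
    by (simp add: power2_eq_square)
  have "time_bound I \<epsilon> = real \<sigma> ^ 2 * (real n ^ 3 * max 1 (real n ^ 2 / \<epsilon>) ^ \<sigma>)"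
    by (simp add: time_bound_def)
  also have "\<dots> \<le> real \<sigma> ^ 2 * (X ^ 3 * (X ^ 2) ^ \<sigma>)"
    using X Z by (intro mult_left_mono mult_mono power_mono) auto
  also have "\<dots> = real \<sigma> ^ 2 * X ^ (3 + 2 * \<sigma>)"
    by (simp add: power_add power_mult)
  finally show ?thesis
    unfolding X_def .
qed

end

lemma approximates_within_mono: "approximates_within p I pt \<epsilon> T \<Longrightarrow> T \<le> T' \<Longrightarrow> approximates_within p I pt \<epsilon> T'"
  unfolding approximates_within_def by (meson order_trans)

theorem theorem6:
  shows "\<exists>p :: com.
    (\<forall>\<sigma>. fptas_on {I :: 'm robust_sp. wf_instance I \<and> max_positions I = \<sigma>} p) \<and>
    (\<exists>C :: real. \<forall>(I :: 'm robust_sp) pt \<epsilon>.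
        wf_instance I \<longrightarrow> enumerates I pt \<longrightarrow> 0 < \<epsilon> \<longrightarrow>
        approximates_within p I pt \<epsilon> (C * time_bound I \<epsilon>))"
proof (intro exI[of _ scheme] conjI allI)
  fix \<sigma> :: nat
  show "fptas_on {I :: 'm robust_sp. wf_instance I \<and> max_positions I = \<sigma>} scheme"
    unfolding fptas_on_def
  proof (intro exI[of _ "260 * real \<sigma> ^ 2"] exI[of _ "3 + 2 * \<sigma>"] ballI allI impI)
    fix I :: "'m robust_sp" and pt and \<epsilon> :: real
    assume I: "I \<in> {I. wf_instance I \<and> max_positions I = \<sigma>}" and "enumerates I pt" "0 < \<epsilon>"
    then interpret rsp I pt \<epsilon>
      by unfold_locales auto
    have "260 * time_bound I \<epsilon> \<le> 260 * real \<sigma> ^ 2 * (real (input_size I) + 1 / \<epsilon>) ^ (3 + 2 * \<sigma>)"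
      using time_bound_le_input_size I by (simp add: mult.assoc)
    then show "approximates_within scheme I pt \<epsilon> (260 * real \<sigma> ^ 2 * (real (input_size I) + 1 / \<epsilon>) ^ (3 + 2 * \<sigma>))"
      by (rule approximates_within_mono[OF scheme_approximates])
  qed
next
  show "\<exists>C :: real. \<forall>(I :: 'm robust_sp) pt \<epsilon>.
        wf_instance I \<longrightarrow> enumerates I pt \<longrightarrow> 0 < \<epsilon> \<longrightarrow>
        approximates_within scheme I pt \<epsilon> (C * time_bound I \<epsilon>)"
    using rsp.scheme_approximates[OF rsp.intro] by blast
qed

end
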